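(* Consider the long-memory dynamic factor model of the context, satisfying the conditions Model, Long memory, Pervasiveness, Memory structure across factors, Idiosyncratic component, Row boundedness and Gap dominance. Then $\underline{\mathbf K}_{ni}(\theta)$ is Hölder continuous on $\Pi$ with exponent $\rho_q^{(q)}$, where $\rho_0^{(q)}=1$ and $$\rho_m^{(q)}=\min\left\{\rho_{m-1}^{(q)},\ \alpha_{m,m+1},\ \min_{0\le l\le m-1}\left\{2\rho_l^{(q)}-\alpha_{l,m}\right\}\right\},\qquad m=1,\dots,q,$$ with $\alpha_{j_1j_2}=2|d_{(j_1)}-d_{(j_2)}|$, $d_{(q+1)}=0$, and $\alpha_{0,j}=1$ for $j=1,\dots,q$. The Hölder constant is independent of $n$ and $T$. Furthermore, there is a constant $C$ such that $$\left\|\underline{\mathbf K}_{ni}^{(r)}(\theta)\right\|_2\le C|\theta|^{\rho_q^{(q)}-r},\qquad r=1,2,$$ where $^{(r)}$ denotes the $r$-th derivative in $\theta$ (for $\theta\neq0$).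
   Context: Notation. $\Pi=(-\pi,\pi]$, $\iota$ is the imaginary unit, $L$ the lag operator, $^*$ conjugate transpose, $\|\cdot\|$, $\|\cdot\|_2$ the Euclidean norm of vectors and the operator norm of matrices. The spectral density matrix $\Sigma_Y$ of a zero-mean stationary vector process is defined by $E[Y_tY_{t-h}']=\int_\Pi e^{\iota h\theta}\Sigma_Y(\theta)\,d\theta$. Constants in the conditions are independent of $n$ and $T$; bounds are for all sufficiently large $n$. Model. $x_{it}=\chi_{it}+\xi_{it}$, $\chi_{it}=\sum_{l=1}^q b_{il}(L)u_{lt}$, $i\in\mathbb N$, $t\in\mathbb Z$, with $q$ fixed. The vector $u_t=(u_{1t},\dots,u_{qt})'$ is orthonormal white noise with finite fourth moments, scaled so that its spectral density matrix is $I_q$. The filters $b_{il}$ may be two-sided and of infinite order, with square summable coefficients. For each $n$, $\xi_t=(\xi_{1t},\dots,\xi_{nt})'$ is zero-mean stationary, $\xi_{it}$ is independent of $u_{l,t-k}$ for all $i,l,t,k$, and $\xi_t=\sum_{m\in\mathbb Z}B_{\xi,m}\epsilon_{t-m}$ with $\epsilon_t$ an $n$-dimensional second-order white noise. Put $X_t=(x_{1t},\dots,x_{nt})'$; its spectral density is $\Sigma(\theta)=\Sigma_\chi(\theta)+\Sigma_\xi(\theta)$. Long memory. $b_{il}(L)=(1-L)^{-d_{il}}g_{il}(L)$ with $d_{il}\in[0,1/2)$ and $g_{il}$ a short-memory filter. Pervasiveness. Let $G(\theta)=[g_{il}(e^{-\iota\theta})]_{i\le n,\,l\le q}$ and $S(\theta)=\frac1nG^*(\theta)G(\theta)$.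 There are constants $0<s^-\le s^+<\infty$ with $s^-I_q\preceq S(\theta)\preceq s^+I_q$ for all $\theta\in\Pi$; $G$ is twice differentiable with $\|G^{(r)}(\theta)\|_2\le C_{G,r}\sqrt n$, $r=1,2$, and $\|G(\theta_2)-G(\theta_1)\|\le\sqrt n\,L_G|\theta_2-\theta_1|$. Memory structure across factors. $d_{il}=d_l$ depends only on the factor $l$, so $\Sigma_\chi(\theta)=G(\theta)\,\mathrm{diag}(|1-e^{-\iota\theta}|^{-2d_l})_{l\le q}\,G^*(\theta)$. The values in decreasing order are $d_{(1)}>\dots>d_{(q)}$. Idiosyncratic component. There are constants $\Lambda_\xi^-,\Lambda_\xi^+$ such that all eigenvalues of $\Sigma_\xi(\theta)$ lie in $[\Lambda_\xi^-,\Lambda_\xi^+]$ for all $\theta\in\Pi$; $\Sigma_\xi$ is twice differentiable, hence Lipschitz, on $\Pi$; and $\sup_{\|v_1\|_2=\dots=\|v_4\|_2=1}|\mathrm{cum}(v_1'\epsilon_t,v_2'\epsilon_t,v_3'\epsilon_t,v_4'\epsilon_t)|$ is bounded. Row boundedness. The $i$-th row $G_i(\theta)$ of $G(\theta)$ satisfies $\|G_i(\theta)\|^2\le C$ with $C$ independent of $n,T$. Gap dominance. With $d_{(q+1)}=0$, $\alpha_{j_1j_2}=2|d_{(j_1)}-d_{(j_2)}|>0$, and $\rho_m^{(q)}$ as in the claim: if $q\ge2$, $2\rho_l^{(q)}>\alpha_{l,m}$ for all $l=1,\dots,m-1$ and $m=2,\dots,q$. Eigenprojection row. Let $\mathbf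 p_j(\theta)$ be orthonormal row eigenvectors of $\Sigma(\theta)$ ($\mathbf p_j\Sigma=\lambda_j\mathbf p_j$, $\lambda_1\ge\dots\ge\lambda_n$), $p_{j,i}$ the $i$-th entry; for $\theta\ne0$, $\underline{\mathbf K}_{ni}(\theta)=\sum_{j=1}^q\overline{p_{j,i}(\theta)}\,\mathbf p_j(\theta)$ (the $i$-th row of the orthogonal projection onto the $q$ leading eigenvectors), and $\underline{\mathbf K}_{ni}(0)$ is defined as the limit as $\theta\to0$.
   Formalization: "Σ_ξ is twice differentiable, hence Lipschitz" is taken to mean that its first and second derivatives are bounded in operator norm on Π by constants independent of n; without a bound on the second derivative the claimed bound for r=2 can fail. *)

theory Defs
  imports
    "HOL-Probability.Probability"
    "Jordan_Normal_Form.Char_Poly"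
    "Jordan_Normal_Form.Schur_Decomposition"
begin

text \<open>
  Conventions.  Cross-section indices \<open>i\<close> and factor indices \<open>l\<close> start at 0 (\<open>i < n\<close>, \<open>l < q\<close>);
  the indices of the ordered memory parameters \<open>d\<^sub>(\<^sub>j\<^sub>)\<close>, of \<open>\<alpha>\<close> and of \<open>\<rho>\<close> start at 1, with \<open>l = 0\<close>
  reserved for the initial values \<open>\<rho>\<^sub>0 = 1\<close> and \<open>\<alpha>\<^sub>0\<^sub>,\<^sub>j = 1\<close>.  A process \<open>Y\<close> has values \<open>Y i t \<omega>\<close>.
\<close>

abbreviation freqs :: "real set" where
  "freqs \<equiv> {-pi<..pi}"

type_synonym 'w process = "nat \<Rightarrow> int \<Rightarrow> 'w \<Rightarrow> real"


section \<open>Norms, Loewner order and derivatives of vectors and matrices of variable size\<close>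

definition vnorm :: "complex Matrix.vec \<Rightarrow> real" where
  "vnorm v = sqrt (\<Sum>k<dim_vec v. (cmod (v $ k))\<^sup>2)"

definition opnorm :: "complex mat \<Rightarrow> real" where
  "opnorm A = (SUP v \<in> {v \<in> carrier_vec (dim_col A). vnorm v \<le> 1}. vnorm (A *\<^sub>v v))"

definition loewner_le :: "complex mat \<Rightarrow> complex mat \<Rightarrow> bool" (infix \<open>\<preceq>\<^sub>L\<close> 50) where
  "A \<preceq>\<^sub>L B \<longleftrightarrow> (\<exists>n. A \<in> carrier_mat n n \<and> B \<in> carrier_mat n n \<and>
     mat_adjoint (B - A) = B - A \<and>
     (\<forall>v \<in> carrier_vec n. 0 \<le> Re (((B - A) *\<^sub>v v) \<bullet>c v)))"

text \<open>
  Functions on \<open>\<Pi> = (-\<pi>, \<pi>]\<close> are differentiated within \<open>\<Pi>\<close>: the derivative is the ordinary one at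
  interior points and the left derivative at \<open>\<pi>\<close>.
\<close>

definition has_vec_deriv ::
  "(real \<Rightarrow> complex Matrix.vec) \<Rightarrow> complex Matrix.vec \<Rightarrow> real \<Rightarrow> bool" where
  "has_vec_deriv f f' \<theta> \<longleftrightarrow> dim_vec f' = dim_vec (f \<theta>) \<and>
     (\<forall>k < dim_vec f'. ((\<lambda>t. f t $ k) has_vector_derivative f' $ k) (at \<theta> within freqs))"

definition has_mat_deriv ::
  "(real \<Rightarrow> complex mat) \<Rightarrow> complex mat \<Rightarrow> real \<Rightarrow> bool" where
  "has_mat_deriv F F' \<theta> \<longleftrightarrow> dim_row F' = dim_row (F \<theta>) \<and> dim_col F' = dim_col (F \<theta>) \<and>
     (\<forall>j < dim_row F'. \<forall>k < dim_col F'.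
        ((\<lambda>t. F t $$ (j, k)) has_vector_derivative F' $$ (j, k)) (at \<theta> within freqs))"

definition twice_diff_bounded :: "(real \<Rightarrow> complex mat) \<Rightarrow> real \<Rightarrow> real \<Rightarrow> bool" where
  "twice_diff_bounded F c1 c2 \<longleftrightarrow> (\<exists>F1 F2. \<forall>\<theta>\<in>freqs.
     has_mat_deriv F (F1 \<theta>) \<theta> \<and> has_mat_deriv F1 (F2 \<theta>) \<theta> \<and>
     opnorm (F1 \<theta>) \<le> c1 \<and> opnorm (F2 \<theta>) \<le> c2)"


section \<open>Second-order processes\<close>

definition square_integrable :: "'w measure \<Rightarrow> ('w \<Rightarrow> real) \<Rightarrow> bool" where
  "square_integrable M f \<longleftrightarrow> f \<in> borel_measurable M \<and> integrable M (\<lambda>\<omega>. (f \<omega>)\<^sup>2)"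

definition zero_mean_stationary :: "'w measure \<Rightarrow> nat \<Rightarrow> 'w process \<Rightarrow> bool" where
  "zero_mean_stationary M n Y \<longleftrightarrow>
     (\<forall>i<n. \<forall>t. square_integrable M (Y i t) \<and> (\<integral>\<omega>. Y i t \<omega> \<partial>M) = 0) \<and>
     (\<forall>i<n. \<forall>j<n. \<forall>t s h.
        (\<integral>\<omega>. Y i (t + h) \<omega> * Y j (s + h) \<omega> \<partial>M) = (\<integral>\<omega>. Y i t \<omega> * Y j s \<omega> \<partial>M))"

definition white_noise :: "'w measure \<Rightarrow> nat \<Rightarrow> 'w process \<Rightarrow> bool" where
  "white_noise M n e \<longleftrightarrow>
     (\<forall>i<n. \<forall>t. square_integrable M (e i t) \<and> (\<integral>\<omega>. e i t \<omega> \<partial>M) = 0) \<and>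
     (\<exists>\<Gamma>. \<forall>i<n. \<forall>j<n. \<forall>t s.
        (\<integral>\<omega>. e i t \<omega> * e j s \<omega> \<partial>M) = (if t = s then \<Gamma> i j else 0))"

definition has_spectral_density ::
  "'w measure \<Rightarrow> nat \<Rightarrow> 'w process \<Rightarrow> (real \<Rightarrow> complex mat) \<Rightarrow> bool" where
  "has_spectral_density M n Y S \<longleftrightarrow>
     zero_mean_stationary M n Y \<and>
     (\<forall>\<theta>\<in>freqs. S \<theta> \<in> carrier_mat n n) \<and>
     (\<forall>j<n. \<forall>k<n. set_integrable lborel freqs (\<lambda>\<theta>. S \<theta> $$ (j, k))) \<and>
     (\<forall>j<n. \<forall>k<n. \<forall>t h.
        complex_of_real (\<integral>\<omega>. Y j t \<omega> * Y k (t - h) \<omega> \<partial>M)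
          = (LINT \<theta>:freqs|lborel. cis (of_int h * \<theta>) * S \<theta> $$ (j, k)))"

definition mean_square_limit ::
  "'w measure \<Rightarrow> (nat \<Rightarrow> 'w \<Rightarrow> real) \<Rightarrow> ('w \<Rightarrow> real) \<Rightarrow> bool" where
  "mean_square_limit M Z Y \<longleftrightarrow>
     (\<forall>N. square_integrable M (Z N)) \<and> square_integrable M Y \<and>
     (\<lambda>N. \<integral>\<omega>. (Z N \<omega> - Y \<omega>)\<^sup>2 \<partial>M) \<longlonglongrightarrow> 0"

text \<open>Joint fourth-order cumulant, computed from the centred variables.\<close>

definition cum4 ::
  "'w measure \<Rightarrow> ('w \<Rightarrow> real) \<Rightarrow> ('w \<Rightarrow> real) \<Rightarrow> ('w \<Rightarrow> real) \<Rightarrow> ('w \<Rightarrow> real) \<Rightarrow> real" where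
  "cum4 M a b c e =
     (let E = (\<lambda>f. \<integral>\<omega>. f \<omega> \<partial>M);
          a' = (\<lambda>\<omega>. a \<omega> - E a); b' = (\<lambda>\<omega>. b \<omega> - E b);
          c' = (\<lambda>\<omega>. c \<omega> - E c); e' = (\<lambda>\<omega>. e \<omega> - E e)
      in E (\<lambda>\<omega>. a' \<omega> * b' \<omega> * c' \<omega> * e' \<omega>)
         - E (\<lambda>\<omega>. a' \<omega> * b' \<omega>) * E (\<lambda>\<omega>. c' \<omega> * e' \<omega>)
         - E (\<lambda>\<omega>. a' \<omega> * c' \<omega>) * E (\<lambda>\<omega>. b' \<omega> * e' \<omega>)
         - E (\<lambda>\<omega>. a' \<omega> * e' \<omega>) * E (\<lambda>\<omega>. b' \<omega> * c' \<omega>))"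


section \<open>Filters\<close>

text \<open>A two-sided linear filter \<open>\<Sum>\<^sub>m a\<^sub>m L\<^sup>m\<close> is represented by its coefficients.\<close>

type_synonym lag_filter = "int \<Rightarrow> real"

definition square_summable :: "lag_filter \<Rightarrow> bool" where
  "square_summable a \<longleftrightarrow> (\<lambda>m. (a m)\<^sup>2) summable_on UNIV"

definition short_memory :: "lag_filter \<Rightarrow> bool" where
  "short_memory a \<longleftrightarrow> (\<lambda>m. \<bar>a m\<bar>) summable_on UNIV"

definition transfer_function :: "lag_filter \<Rightarrow> complex \<Rightarrow> complex" where
  "transfer_function a z = (\<Sum>\<^sub>\<infinity>m. complex_of_real (a m) * z powi m)"

text \<open>
  Binomial series: \<open>(1 - L)\<^sup>-\<^sup>d = \<Sum>\<^sub>k (-1)\<^sup>k binom(-d, k) L\<^sup>k\<close>, multiplied with \<open>a(L)\<close> by convolution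
  of the coefficients.
\<close>

definition frac_integrate :: "real \<Rightarrow> lag_filter \<Rightarrow> lag_filter" where
  "frac_integrate d a m = (\<Sum>k. (-1) ^ k * ((- d) gchoose k) * a (m - int k))"


section \<open>The long-memory dynamic factor model\<close>

definition model_cond ::
  "'w measure \<Rightarrow> nat \<Rightarrow> 'w process \<Rightarrow> 'w process \<Rightarrow> 'w process \<Rightarrow> 'w process \<Rightarrow>
   (nat \<Rightarrow> nat \<Rightarrow> lag_filter) \<Rightarrow> (nat \<Rightarrow> 'w process) \<Rightarrow> (nat \<Rightarrow> int \<Rightarrow> real mat) \<Rightarrow>
   (nat \<Rightarrow> real \<Rightarrow> complex mat) \<Rightarrow> (nat \<Rightarrow> real \<Rightarrow> complex mat) \<Rightarrow>
   (nat \<Rightarrow> real \<Rightarrow> complex mat) \<Rightarrow> bool" where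
  "model_cond M q x chi xi u b \<epsilon> B_xi Sig Sig_chi Sig_xi \<longleftrightarrow>
     prob_space M \<and> 1 \<le> q \<and>
     (\<forall>i t \<omega>. x i t \<omega> = chi i t \<omega> + xi i t \<omega>) \<and>
     white_noise M q u \<and> has_spectral_density M q u (\<lambda>\<theta>. 1\<^sub>m q) \<and>
     (\<forall>l<q. \<forall>t. integrable M (\<lambda>\<omega>. (u l t \<omega>) ^ 4)) \<and>
     (\<forall>i. \<forall>l<q. square_summable (b i l)) \<and>
     (\<forall>i t. mean_square_limit M
        (\<lambda>N \<omega>. \<Sum>l<q. \<Sum>m\<in>{- int N..int N}. b i l m * u l (t - m) \<omega>) (chi i t)) \<and>
     (\<forall>n. zero_mean_stationary M n xi) \<and>
     (\<forall>i t s. \<forall>l<q. prob_space.indep_var M borel (xi i t) borel (u l s)) \<and>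
     (\<forall>n. white_noise M n (\<epsilon> n)) \<and>
     (\<forall>n m. B_xi n m \<in> carrier_mat n n) \<and>
     (\<forall>n t. \<forall>i<n. mean_square_limit M
        (\<lambda>N \<omega>. \<Sum>m\<in>{- int N..int N}. \<Sum>k<n. B_xi n m $$ (i, k) * \<epsilon> n k (t - m) \<omega>) (xi i t)) \<and>
     (\<forall>n. has_spectral_density M n x (Sig n)) \<and>
     (\<forall>n. has_spectral_density M n chi (Sig_chi n)) \<and>
     (\<forall>n. has_spectral_density M n xi (Sig_xi n)) \<and>
     (\<forall>n. \<forall>\<theta>\<in>freqs - {0}. Sig n \<theta> = Sig_chi n \<theta> + Sig_xi n \<theta>)"

text \<open>
  Spectral densities are determined only almost everywhere; the pointwise equations (the last
  conjunct above and the last conjunct of \<open>memory_structure_cond\<close> below) select the versions.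
  The frequency 0 is excluded there, since the density of a long-memory process is infinite at 0.
\<close>

definition long_memory_cond ::
  "nat \<Rightarrow> (nat \<Rightarrow> nat \<Rightarrow> real) \<Rightarrow> (nat \<Rightarrow> nat \<Rightarrow> lag_filter) \<Rightarrow> (nat \<Rightarrow> nat \<Rightarrow> lag_filter) \<Rightarrow> bool"
  where
  "long_memory_cond q d g b \<longleftrightarrow> (\<forall>i. \<forall>l<q.
     0 \<le> d i l \<and> d i l < 1 / 2 \<and> short_memory (g i l) \<and> b i l = frac_integrate (d i l) (g i l))"

definition Gmat :: "nat \<Rightarrow> (nat \<Rightarrow> nat \<Rightarrow> lag_filter) \<Rightarrow> nat \<Rightarrow> real \<Rightarrow> complex mat" where
  "Gmat q g n \<theta> = Matrix.mat n q (\<lambda>(i, l). transfer_function (g i l) (cis (- \<theta>)))"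

definition Smat :: "nat \<Rightarrow> (nat \<Rightarrow> nat \<Rightarrow> lag_filter) \<Rightarrow> nat \<Rightarrow> real \<Rightarrow> complex mat" where
  "Smat q g n \<theta> = (1 / of_nat n) \<cdot>\<^sub>m (mat_adjoint (Gmat q g n \<theta>) * Gmat q g n \<theta>)"

definition pervasiveness_cond :: "nat \<Rightarrow> (nat \<Rightarrow> nat \<Rightarrow> lag_filter) \<Rightarrow> bool" where
  "pervasiveness_cond q g \<longleftrightarrow> (\<exists>s_lo s_hi C1 C2 L. 0 < s_lo \<and> s_lo \<le> s_hi \<and>
     (\<forall>\<^sub>F n in sequentially.
        (\<forall>\<theta>\<in>freqs. complex_of_real s_lo \<cdot>\<^sub>m 1\<^sub>m q \<preceq>\<^sub>L Smat q g n \<theta> \<and>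
                   Smat q g n \<theta> \<preceq>\<^sub>L complex_of_real s_hi \<cdot>\<^sub>m 1\<^sub>m q) \<and>
        twice_diff_bounded (Gmat q g n) (C1 * sqrt (real n)) (C2 * sqrt (real n)) \<and>
        (\<forall>\<theta>1\<in>freqs. \<forall>\<theta>2\<in>freqs.
           opnorm (Gmat q g n \<theta>2 - Gmat q g n \<theta>1) \<le> sqrt (real n) * L * \<bar>\<theta>2 - \<theta>1\<bar>)))"

text \<open>\<open>d\<^sub>(\<^sub>j\<^sub>)\<close> is the \<open>j\<close>-th largest of \<open>df 0, \<dots>, df (q - 1)\<close>, and \<open>d\<^sub>(\<^sub>q\<^sub>+\<^sub>1\<^sub>) = 0\<close>.\<close>

definition d_ord :: "nat \<Rightarrow> (nat \<Rightarrow> real) \<Rightarrow> nat \<Rightarrow> real" where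
  "d_ord q df j = (if 1 \<le> j \<and> j \<le> q then rev (sort (map df [0..<q])) ! (j - 1) else 0)"

definition memory_structure_cond ::
  "nat \<Rightarrow> (nat \<Rightarrow> nat \<Rightarrow> real) \<Rightarrow> (nat \<Rightarrow> real) \<Rightarrow> (nat \<Rightarrow> nat \<Rightarrow> lag_filter) \<Rightarrow>
   (nat \<Rightarrow> real \<Rightarrow> complex mat) \<Rightarrow> bool" where
  "memory_structure_cond q d df g Sig_chi \<longleftrightarrow>
     (\<forall>i. \<forall>l<q. d i l = df l) \<and>
     (\<forall>j. 1 \<le> j \<and> j < q \<longrightarrow> d_ord q df (j + 1) < d_ord q df j) \<and>
     (\<forall>n. \<forall>\<theta>\<in>freqs - {0}. Sig_chi n \<theta> =
        Gmat q g n \<theta>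
        * mat_diag q (\<lambda>l. complex_of_real (cmod (1 - cis (- \<theta>)) powr (- 2 * df l)))
        * mat_adjoint (Gmat q g n \<theta>))"

text \<open>
  The bounds on the derivatives of \<open>\<Sigma>\<^sub>\<xi>\<close> do not depend on \<open>n\<close>; the bound on the first derivative gives
  a Lipschitz constant on \<open>\<Pi>\<close> that does not depend on \<open>n\<close>.
\<close>

definition idiosyncratic_cond ::
  "'w measure \<Rightarrow> (nat \<Rightarrow> 'w process) \<Rightarrow> (nat \<Rightarrow> real \<Rightarrow> complex mat) \<Rightarrow> bool" where
  "idiosyncratic_cond M \<epsilon> Sig_xi \<longleftrightarrow> (\<exists>\<Lambda>_lo \<Lambda>_hi C1 C2 C. \<forall>\<^sub>F n in sequentially.
     (\<forall>\<theta>\<in>freqs. \<forall>ev. eigenvalue (Sig_xi n \<theta>) ev \<longrightarrow> ev \<in> complex_of_real ` {\<Lambda>_lo..\<Lambda>_hi}) \<and>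
     twice_diff_bounded (Sig_xi n) C1 C2 \<and>
     (\<forall>k<n. \<forall>t. integrable M (\<lambda>\<omega>. (\<epsilon> n k t \<omega>) ^ 4)) \<and>
     (\<forall>t v1 v2 v3 v4.
        (\<forall>v\<in>{v1, v2, v3, v4}. (\<Sum>k<n. (v k)\<^sup>2) = 1) \<longrightarrow>
        (let lin = (\<lambda>v \<omega>. \<Sum>k<n. v k * \<epsilon> n k t \<omega>)
         in \<bar>cum4 M (lin v1) (lin v2) (lin v3) (lin v4)\<bar> \<le> C)))"

definition row_bounded_cond :: "nat \<Rightarrow> (nat \<Rightarrow> nat \<Rightarrow> lag_filter) \<Rightarrow> bool" where
  "row_bounded_cond q g \<longleftrightarrow> (\<exists>C. \<forall>\<^sub>F n in sequentially.
     \<forall>i<n. \<forall>\<theta>\<in>freqs. (vnorm (row (Gmat q g n \<theta>) i))\<^sup>2 \<le> C)"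


section \<open>The exponents\<close>

definition alpha :: "nat \<Rightarrow> (nat \<Rightarrow> real) \<Rightarrow> nat \<Rightarrow> nat \<Rightarrow> real" where
  "alpha q df j1 j2 = (if j1 = 0 then 1 else 2 * \<bar>d_ord q df j1 - d_ord q df j2\<bar>)"

fun rho :: "nat \<Rightarrow> (nat \<Rightarrow> real) \<Rightarrow> nat \<Rightarrow> real" where
  "rho q df 0 = 1"
| "rho q df (Suc m) = Min ({rho q df m, alpha q df (Suc m) (Suc (Suc m))} \<union>
     (\<lambda>l. 2 * rho q df l - alpha q df l (Suc m)) ` {0..m})"

text \<open>Positivity of \<open>\<alpha>\<close> includes the pair \<open>(q, q + 1)\<close>, that is \<open>d\<^sub>(\<^sub>q\<^sub>) > 0\<close>.\<close>

definition gap_dominance_cond :: "nat \<Rightarrow> (nat \<Rightarrow> real) \<Rightarrow> bool" where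
  "gap_dominance_cond q df \<longleftrightarrow>
     (\<forall>j1\<in>{1..q + 1}. \<forall>j2\<in>{1..q + 1}. j1 \<noteq> j2 \<longrightarrow> 0 < alpha q df j1 j2) \<and>
     (2 \<le> q \<longrightarrow> (\<forall>m\<in>{2..q}. \<forall>l\<in>{1..m - 1}. alpha q df l m < 2 * rho q df l))"


section \<open>Eigenprojection rows\<close>

definition row_eigensystem ::
  "nat \<Rightarrow> complex mat \<Rightarrow> (nat \<Rightarrow> real) \<Rightarrow> (nat \<Rightarrow> complex Matrix.vec) \<Rightarrow> bool" where
  "row_eigensystem n A lam p \<longleftrightarrow>
     (\<forall>j<n. p j \<in> carrier_vec n \<and>
        mat_of_row (p j) * A = complex_of_real (lam j) \<cdot>\<^sub>m mat_of_row (p j)) \<and>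
     (\<forall>j<n. \<forall>k<n. p j \<bullet>c p k = (if j = k then 1 else 0)) \<and>
     (\<forall>j k. j \<le> k \<and> k < n \<longrightarrow> lam k \<le> lam j)"

definition eigproj_row ::
  "nat \<Rightarrow> (nat \<Rightarrow> real \<Rightarrow> nat \<Rightarrow> complex Matrix.vec) \<Rightarrow> nat \<Rightarrow> nat \<Rightarrow> real \<Rightarrow> complex Matrix.vec"
  where
  "eigproj_row q p n i \<theta> =
     (let K = (\<lambda>t k. \<Sum>j<q. cnj (p n t j $ i) * p n t j $ k)
      in Matrix.vec n (\<lambda>k. if \<theta> = 0 then Lim (at 0) (\<lambda>t. K t k) else K \<theta> k))"

definition hoelder_on ::
  "real set \<Rightarrow> real \<Rightarrow> real \<Rightarrow> (real \<Rightarrow> complex Matrix.vec) \<Rightarrow> bool" where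
  "hoelder_on S \<rho> H f \<longleftrightarrow> 0 < \<rho> \<and> \<rho> \<le> 1 \<and>
     (\<forall>\<theta>1\<in>S. \<forall>\<theta>2\<in>S. vnorm (f \<theta>2 - f \<theta>1) \<le> H * \<bar>\<theta>2 - \<theta>1\<bar> powr \<rho>)"

end

theory Submission
  imports Defs "Jordan_Normal_Form.Spectral_Radius"
begin

text \<open>
  The subject is \<open>P(\<theta>)\<close>, the orthogonal projection onto the \<open>q\<close> leading eigenvectors of
  \<open>\<Sigma> = G D G\<^sup>* + X\<close>, where \<open>D = diag(\<bar>1 - e\<^sup>-\<^sup>i\<^sup>\<theta>\<bar>\<^sup>-\<^sup>2\<^sup>d)\<close> blows up at frequency 0 and \<open>X\<close> is the
  idiosyncratic density.  Put \<open>\<delta> = 2 d\<^sub>(\<^sub>q\<^sub>) = \<alpha>\<^sub>q\<^sub>,\<^sub>q\<^sub>+\<^sub>1\<close> and \<open>w = \<bar>\<theta>\<bar>\<^sup>\<delta>\<close>.  The recursion gives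
  \<open>0 < \<rho>\<^sub>q \<le> \<delta>\<close> (\<open>rho_pos\<close>, \<open>rho_le_alpha\<close>), so it suffices to establish the exponent \<open>\<delta>\<close>, and because
  a row of an operator is controlled by the operator norm, it suffices to do so for \<open>P\<close> itself, in
  operator norm.

  Write \<open>R = 1 - P\<close>, \<open>K = \<Sigma> R\<close>, and let \<open>a\<close> be the inverse of \<open>\<Sigma>\<close> on the range of \<open>P\<close>, extended by 0.
  By the min-max principle and pervasiveness, the \<open>q\<close> leading eigenvalues are at least a multiple of
  \<open>n / w\<close> while the others stay bounded (\<open>factor_eigensystem\<close>); hence \<open>a = O(w / n)\<close> and \<open>K = O(1)\<close>.
  The singularity of \<open>D\<close> cancels wherever it meets \<open>R\<close> or \<open>a\<close>: \<open>G (D G\<^sup>* R) = K - X R\<close> and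
  \<open>G (D G\<^sup>* a) = P - X a\<close> are bounded, and \<open>G\<close> is bounded below by a multiple of \<open>sqrt n\<close>, so that
  \<open>D G\<^sup>* R\<close> and \<open>a G D\<close> are both \<open>O(1 / sqrt n)\<close> (\<open>coercive_cancel\<close>).

  Differentiating \<open>\<Sigma> P = P \<Sigma>\<close> shows that the off-diagonal block \<open>Y = P P' R\<close> solves
  \<open>Y = a \<Sigma>' R + a Y K\<close>.  For large \<open>n\<close> the map \<open>Y \<mapsto> a Y K\<close> has norm at most 1/2, so \<open>Y\<close> is bounded
  by \<open>2 \<parallel>a \<Sigma>' R\<parallel>\<close>.  Every term of \<open>a \<Sigma>' R\<close> in which \<open>D\<close> occurs contains one of the cancelling products, and
  \<open>D' = H D\<close> with \<open>H = O(1 / \<bar>\<theta>\<bar>)\<close>; this yields \<open>P' = O(w / \<bar>\<theta>\<bar>)\<close>.  The same equation with a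
  right-hand side that involves \<open>\<Sigma>''\<close> and \<open>P'\<close> yields \<open>P'' = O(w / \<theta>\<^sup>2)\<close>
  (\<open>eigenprojection_twice_differentiable\<close>, \<open>factor_bounds\<close>); the terms that do not cancel are
  harmless because \<open>d < 1/2\<close> makes \<open>D = O(1 / \<bar>\<theta>\<bar>)\<close>.

  For two frequencies the same cancellation gives \<open>P(s) - P(t) = O(w(s) + w(t) + \<bar>s - t\<bar>)\<close>
  (\<open>projection_increment_le\<close>).  This is a Cauchy criterion at 0, hence the limit there, and it is a
  Hoelder bound when \<open>s\<close> and \<open>t\<close> are no further from 0 than twice their distance; otherwise the bound on
  \<open>P'\<close> and the mean value theorem apply (\<open>hoelder_of_derivative_bound\<close>).

  So that all constants are visibly independent of \<open>n\<close>, matrices of every size live in a single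
  normed algebra with involution, the adjointable operators on finitely supported sequences.  This
  algebra is not complete, but the only equation ever solved in it, \<open>Z = C + a Z K\<close>, has an explicit
  solution in an eigenbasis (\<open>spectral_sum_sylvester_solvable\<close>).
\<close>

section \<open>Finitely supported sequences\<close>

text \<open>
  Finitely supported complex sequences contain \<open>\<complex>\<^sup>n\<close> for every \<open>n\<close>.  They carry the real inner product
  \<open>Re (\<Sum>i. x\<^sub>i cnj y\<^sub>i)\<close>, which has the same norm as the Hermitian one and is all that adjoints need.
\<close>

typedef fseq = "{f :: nat \<Rightarrow> complex. finite {i. f i \<noteq> 0}}"
  morphisms coord Fseq
  by (rule exI[of _ "\<lambda>_. 0"]) simp

setup_lifting type_definition_fseq

lemma fseq_eqI: "(\<And>i. coord x i = coord y i) \<Longrightarrow> x = y"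
  by (simp add: coord_inject[symmetric] fun_eq_iff)

lemma finite_support_combine:
  assumes "finite {i. f i \<noteq> 0}" "finite {i. g i \<noteq> 0}" "h 0 0 = 0"
  shows "finite {i. h (f i) (g i) \<noteq> 0}"
  by (rule finite_subset[OF _ finite_UnI[OF assms(1,2)]]) (use assms(3) in auto)

instantiation fseq :: real_vector
begin
lift_definition zero_fseq :: fseq is "\<lambda>_. 0" by simp
lift_definition plus_fseq :: "fseq \<Rightarrow> fseq \<Rightarrow> fseq" is "\<lambda>f g i. f i + g i"
  by (rule finite_support_combine) auto
lift_definition minus_fseq :: "fseq \<Rightarrow> fseq \<Rightarrow> fseq" is "\<lambda>f g i. f i - g i"
  by (rule finite_support_combine) auto
lift_definition uminus_fseq :: "fseq \<Rightarrow> fseq" is "\<lambda>f i. - f i" by simp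
lift_definition scaleR_fseq :: "real \<Rightarrow> fseq \<Rightarrow> fseq" is "\<lambda>c f i. c *\<^sub>R f i"
  by (rule finite_subset[where B = "{i. _ i \<noteq> 0}"]) auto
instance
  by standard (transfer; simp add: fun_eq_iff algebra_simps scaleR_add_right scaleR_add_left; fail)+
end

lemmas coord_simps [simp] =
  zero_fseq.rep_eq plus_fseq.rep_eq minus_fseq.rep_eq uminus_fseq.rep_eq scaleR_fseq.rep_eq

lemma coord_sum [simp]: "coord (\<Sum>i\<in>I. f i) k = (\<Sum>i\<in>I. coord (f i) k)"
  by (induction I rule: infinite_finite_induct) auto

lemma coord_supportE:
  obtains N where "\<And>i. i \<ge> N \<Longrightarrow> coord x i = 0"
proof -
  have "finite {i. coord x i \<noteq> 0}" using coord[of x] by simp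
  then obtain N where "\<forall>i\<in>{i. coord x i \<noteq> 0}. i < N"
    using finite_nat_set_iff_bounded by blast
  then show ?thesis by (intro that[of N]) (use not_le in auto)
qed

instantiation fseq :: real_inner
begin
definition inner_fseq :: "fseq \<Rightarrow> fseq \<Rightarrow> real" where
  "inner_fseq x y = (\<Sum>i | coord x i \<noteq> 0. Re (coord x i * cnj (coord y i)))"
definition norm_fseq :: "fseq \<Rightarrow> real" where "norm_fseq x = sqrt (inner x x)"
definition sgn_fseq :: "fseq \<Rightarrow> fseq" where "sgn_fseq x = x /\<^sub>R norm x"
definition dist_fseq :: "fseq \<Rightarrow> fseq \<Rightarrow> real" where "dist_fseq x y = norm (x - y)"
definition uniformity_fseq :: "(fseq \<times> fseq) filter" where
  "uniformity_fseq = (INF e\<in>{0<..}. principal {(x, y). dist x y < e})"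
definition open_fseq :: "fseq set \<Rightarrow> bool" where
  "open_fseq U \<longleftrightarrow> (\<forall>x\<in>U. \<forall>\<^sub>F (x', y) in uniformity. x' = x \<longrightarrow> y \<in> U)"

lemma inner_fseq_upto:
  assumes "\<And>i. i \<ge> N \<Longrightarrow> coord x i = 0"
  shows "inner x y = (\<Sum>i<N. Re (coord x i * cnj (coord y i)))"
  unfolding inner_fseq_def using assms
  by (intro sum.mono_neutral_left) (auto simp: not_le[symmetric])

instance
proof
  fix x y z :: fseq and c :: real
  obtain N1 N2 N3 where N: "\<And>i. i \<ge> N1 \<Longrightarrow> coord x i = 0" "\<And>i. i \<ge> N2 \<Longrightarrow> coord y i = 0"
      "\<And>i. i \<ge> N3 \<Longrightarrow> coord z i = 0"
    by (metis coord_supportE)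
  define N where "N = max N1 (max N2 N3)"
  have x: "coord x i = 0" and y: "coord y i = 0" and z: "coord z i = 0" if "i \<ge> N" for i
    using N that by (auto simp: N_def)
  have upto: "inner v w = (\<Sum>i<N. Re (coord v i * cnj (coord w i)))"
    if "\<And>i. i \<ge> N \<Longrightarrow> coord v i = 0" for v w
    by (rule inner_fseq_upto) (rule that)
  have ix: "inner x w = (\<Sum>i<N. Re (coord x i * cnj (coord w i)))" for w by (rule upto) (rule x)
  have iy: "inner y w = (\<Sum>i<N. Re (coord y i * cnj (coord w i)))" for w by (rule upto) (rule y)
  show "inner x y = inner y x"
    unfolding ix iy by (simp add: mult.commute)
  have "inner (x + y) z = (\<Sum>i<N. Re (coord (x + y) i * cnj (coord z i)))"
    by (rule upto) (simp add: x y)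
  then show "inner (x + y) z = inner x z + inner y z"
    unfolding ix iy by (simp only: coord_simps distrib_right plus_complex.sel sum.distrib)
  have "inner (c *\<^sub>R x) y = (\<Sum>i<N. Re (coord (c *\<^sub>R x) i * cnj (coord y i)))"
    by (rule upto) (simp add: x)
  then show "inner (c *\<^sub>R x) y = c * inner x y"
    unfolding ix by (simp only: coord_simps mult_scaleR_left scaleR_complex.sel sum_distrib_left)
  have sq: "Re (a * cnj a) = (cmod a)\<^sup>2" for a
    by (simp add: cmod_power2) (simp add: power2_eq_square)
  show "0 \<le> inner x x"
    unfolding ix sq by (simp add: sum_nonneg)
  show "(inner x x = 0) = (x = 0)"
  proof
    assume "inner x x = 0"
    then have "\<forall>i<N. coord x i = 0"
      unfolding ix sq by (simp add: sum_nonneg_eq_0_iff)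
    then show "x = 0" using x by (intro fseq_eqI) (metis not_le zero_fseq.rep_eq)
  qed (simp add: inner_fseq_def)
  show "norm x = sqrt (inner x x)" by (rule norm_fseq_def)
qed (simp_all add: sgn_fseq_def dist_fseq_def uniformity_fseq_def open_fseq_def)
end

lemma norm_fseq_upto:
  assumes "\<And>i. i \<ge> N \<Longrightarrow> coord x i = 0"
  shows "norm x = sqrt (\<Sum>i<N. (cmod (coord x i))\<^sup>2)"
  by (simp add: norm_fseq_def inner_fseq_upto[OF assms] cmod_power2) (simp add: power2_eq_square)

lemma cmod_coord_le: "cmod (coord x i) \<le> norm x"
proof -
  obtain N where N: "\<And>i. i \<ge> N \<Longrightarrow> coord x i = 0" by (rule coord_supportE) blast
  show ?thesis
  proof (cases "i < N")
    case True
    then have "(cmod (coord x i))\<^sup>2 \<le> (\<Sum>i<N. (cmod (coord x i))\<^sup>2)"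
      by (intro member_le_sum) auto
    moreover have "norm x = sqrt (\<Sum>i<N. (cmod (coord x i))\<^sup>2)" by (rule norm_fseq_upto) (rule N)
    ultimately show ?thesis by (metis real_le_rsqrt)
  next
    case False
    then show ?thesis by (simp add: N)
  qed
qed

lift_definition fsingle :: "nat \<Rightarrow> complex \<Rightarrow> fseq" is "\<lambda>k z i. if i = k then z else 0"
  by (rule finite_subset[where B = "{k}" for k]) auto

lemma coord_fsingle [simp]: "coord (fsingle k z) i = (if i = k then z else 0)"
  by (simp add: fsingle.rep_eq)

lemma norm_fsingle [simp]: "norm (fsingle k z) = cmod z"
proof -
  have "norm (fsingle k z) = sqrt (\<Sum>i<Suc k. (cmod (coord (fsingle k z) i))\<^sup>2)"
    by (rule norm_fseq_upto) auto
  also have "(\<Sum>i<Suc k. (cmod (coord (fsingle k z) i))\<^sup>2) = (\<Sum>i<Suc k. if i = k then (cmod z)\<^sup>2 else 0)"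
    by (rule sum.cong) auto
  also have "\<dots> = (cmod z)\<^sup>2" by (subst sum.delta) auto
  finally show ?thesis by simp
qed

lemma inner_fsingle: "inner x (fsingle k z) = Re (coord x k * cnj z)"
proof -
  have "inner x (fsingle k z) = inner (fsingle k z) x" by (rule inner_commute)
  also have "\<dots> = (\<Sum>i<Suc k. Re (coord (fsingle k z) i * cnj (coord x i)))"
    by (rule inner_fseq_upto) auto
  also have "\<dots> = (\<Sum>i<Suc k. if i = k then Re (z * cnj (coord x k)) else 0)"
    by (rule sum.cong) auto
  also have "\<dots> = Re (z * cnj (coord x k))" by (subst sum.delta) auto
  finally show ?thesis by (simp add: mult.commute)
qed

section \<open>The algebra of adjointable operators\<close>

definition adjoint_pair :: "(fseq \<Rightarrow>\<^sub>L fseq) \<Rightarrow> (fseq \<Rightarrow>\<^sub>L fseq) \<Rightarrow> bool" where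
  "adjoint_pair T T' \<longleftrightarrow> (\<forall>x y. inner (T x) y = inner x (T' y))"

lemma adjoint_pair_sym: "adjoint_pair T T' \<Longrightarrow> adjoint_pair T' T"
  by (simp add: adjoint_pair_def inner_commute)

lemma adjoint_pair_unique:
  assumes "adjoint_pair T T'" "adjoint_pair T T''" shows "T' = T''"
proof (rule blinfun_eqI)
  fix y
  have "\<forall>x. inner x (T' y) = inner x (T'' y)" using assms by (simp add: adjoint_pair_def)
  then show "T' y = T'' y" by (simp only: vector_eq_ldot)
qed

lemma
  adjoint_pair_0: "adjoint_pair 0 0" and
  adjoint_pair_id: "adjoint_pair id_blinfun id_blinfun" and
  adjoint_pair_minus: "adjoint_pair S S' \<Longrightarrow> adjoint_pair (- S) (- S')" and
  adjoint_pair_scaleR: "adjoint_pair S S' \<Longrightarrow> adjoint_pair (c *\<^sub>R S) (c *\<^sub>R S')" and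
  adjoint_pair_add: "adjoint_pair S S' \<Longrightarrow> adjoint_pair T T' \<Longrightarrow> adjoint_pair (S + T) (S' + T')" and
  adjoint_pair_diff: "adjoint_pair S S' \<Longrightarrow> adjoint_pair T T' \<Longrightarrow> adjoint_pair (S - T) (S' - T')" and
  adjoint_pair_compose:
    "adjoint_pair S S' \<Longrightarrow> adjoint_pair T T' \<Longrightarrow> adjoint_pair (S o\<^sub>L T) (T' o\<^sub>L S')"
  by (simp_all add: adjoint_pair_def blinfun.bilinear_simps inner_add_left inner_add_right
      inner_diff_left inner_diff_right)

text \<open>
  Operators are required to have an adjoint, since the space of sequences is not complete and a bounded
  operator need not have one.
\<close>

typedef fop = "{T. \<exists>T'. adjoint_pair T T'}" morphisms blin_of Fop
  using adjoint_pair_0 by blast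

setup_lifting type_definition_fop

definition fapp :: "fop \<Rightarrow> fseq \<Rightarrow> fseq" where "fapp T x = blinfun_apply (blin_of T) x"

lemma fop_eqI: "(\<And>x. fapp A x = fapp B x) \<Longrightarrow> A = B"
  by (simp add: fapp_def blin_of_inject[symmetric] blinfun_eqI)

instantiation fop :: real_vector
begin
lift_definition zero_fop :: fop is 0
  using adjoint_pair_0 by blast
lift_definition plus_fop :: "fop \<Rightarrow> fop \<Rightarrow> fop" is "(+)"
  using adjoint_pair_add by blast
lift_definition minus_fop :: "fop \<Rightarrow> fop \<Rightarrow> fop" is "(-)"
  using adjoint_pair_diff by blast
lift_definition uminus_fop :: "fop \<Rightarrow> fop" is uminus
  using adjoint_pair_minus by blast
lift_definition scaleR_fop :: "real \<Rightarrow> fop \<Rightarrow> fop" is scaleR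
  using adjoint_pair_scaleR by blast
instance
  by standard (transfer; simp add: algebra_simps scaleR_add_right scaleR_add_left; fail)+
end

instantiation fop :: real_normed_algebra_1
begin
lift_definition one_fop :: fop is id_blinfun
  using adjoint_pair_id by blast
lift_definition times_fop :: "fop \<Rightarrow> fop \<Rightarrow> fop" is "(o\<^sub>L)"
  using adjoint_pair_compose by blast
lift_definition norm_fop :: "fop \<Rightarrow> real" is norm .
definition sgn_fop :: "fop \<Rightarrow> fop" where "sgn_fop x = x /\<^sub>R norm x"
definition dist_fop :: "fop \<Rightarrow> fop \<Rightarrow> real" where "dist_fop x y = norm (x - y)"
definition uniformity_fop :: "(fop \<times> fop) filter" where
  "uniformity_fop = (INF e\<in>{0<..}. principal {(x, y). dist x y < e})"
definition open_fop :: "fop set \<Rightarrow> bool" where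
  "open_fop U \<longleftrightarrow> (\<forall>x\<in>U. \<forall>\<^sub>F (x', y) in uniformity. x' = x \<longrightarrow> y \<in> U)"

instance
proof
  fix a b c :: fop and r s :: real
  show "a * b * c = a * (b * c)" by transfer (auto intro!: blinfun_eqI)
  show "(a + b) * c = a * c + b * c" by transfer (auto intro!: blinfun_eqI simp: blinfun.add_left)
  show "a * (b + c) = a * b + a * c"
    by transfer (auto intro!: blinfun_eqI simp: blinfun.add_left blinfun.add_right)
  show "r *\<^sub>R a * b = r *\<^sub>R (a * b)" by transfer (auto intro!: blinfun_eqI simp: blinfun.scaleR_left)
  show "a * r *\<^sub>R b = r *\<^sub>R (a * b)"
    by transfer (auto intro!: blinfun_eqI simp: blinfun.scaleR_left blinfun.scaleR_right)
  show "1 * a = a" "a * 1 = a" by (transfer; auto intro!: blinfun_eqI)+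
  show "norm (a * b) \<le> norm a * norm b" by transfer (rule norm_blinfun_compose)
  have "norm (id_blinfun :: fseq \<Rightarrow>\<^sub>L fseq) \<ge> 1"
    using norm_blinfun[of "id_blinfun" "fsingle 0 1"] by simp
  moreover have "norm (id_blinfun :: fseq \<Rightarrow>\<^sub>L fseq) \<le> 1" by (rule norm_blinfun_bound) auto
  ultimately show "norm (1::fop) = 1" by transfer simp
  then show "(0::fop) \<noteq> 1" by (metis norm_fop.rep_eq zero_fop.rep_eq norm_zero zero_neq_one)
  show "(norm a = 0) = (a = 0)" by transfer simp
  show "norm (a + b) \<le> norm a + norm b" by transfer (rule norm_triangle_ineq)
  show "norm (r *\<^sub>R a) = \<bar>r\<bar> * norm a" by transfer simp
qed (simp_all add: sgn_fop_def dist_fop_def uniformity_fop_def open_fop_def)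
end

lemma fapp_simps [simp]:
  "fapp 0 x = 0" "fapp 1 x = x" "fapp (A + B) x = fapp A x + fapp B x"
  "fapp (A - B) x = fapp A x - fapp B x" "fapp (- A) x = - fapp A x"
  "fapp (c *\<^sub>R A) x = c *\<^sub>R fapp A x" "fapp (A * B) x = fapp A (fapp B x)"
  by (simp_all add: fapp_def zero_fop.rep_eq one_fop.rep_eq plus_fop.rep_eq minus_fop.rep_eq
      uminus_fop.rep_eq scaleR_fop.rep_eq times_fop.rep_eq blinfun.add_left blinfun.diff_left
      blinfun.minus_left blinfun.scaleR_left)

lemma fapp_linear [simp]:
  "fapp A 0 = 0" "fapp A (x + y) = fapp A x + fapp A y" "fapp A (x - y) = fapp A x - fapp A y"
  "fapp A (c *\<^sub>R x) = c *\<^sub>R fapp A x"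
  by (simp_all add: fapp_def blinfun.add_right blinfun.diff_right blinfun.scaleR_right)

lemma fapp_sum_left [simp]: "fapp (\<Sum>i\<in>I. T i) x = (\<Sum>i\<in>I. fapp (T i) x)"
  by (induction I rule: infinite_finite_induct) auto

lemma norm_fapp: "norm (fapp A x) \<le> norm A * norm x"
  by (simp add: fapp_def norm_fop.rep_eq norm_blinfun)

lemma norm_fop_bound: "0 \<le> b \<Longrightarrow> (\<And>x. norm (fapp A x) \<le> b * norm x) \<Longrightarrow> norm A \<le> b"
  by (simp add: fapp_def norm_fop.rep_eq norm_blinfun_bound)

lift_definition adj :: "fop \<Rightarrow> fop" is "\<lambda>T. THE T'. adjoint_pair T T'"
proof -
  fix T assume "\<exists>T'. adjoint_pair T T'"
  then obtain T' where T: "adjoint_pair T T'" ..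
  then have "(THE T'. adjoint_pair T T') = T'" by (rule the_equality) (use T adjoint_pair_unique in blast)
  then show "\<exists>T'. adjoint_pair (THE T'. adjoint_pair T T') T'" using adjoint_pair_sym[OF T] by auto
qed

lemma inner_adj: "inner (fapp A x) y = inner x (fapp (adj A) y)"
proof -
  have "\<exists>!T'. adjoint_pair (blin_of A) T'"
    using blin_of[of A] adjoint_pair_unique by blast
  then have "adjoint_pair (blin_of A) (blin_of (adj A))" unfolding adj.rep_eq by (rule theI')
  then show ?thesis unfolding adjoint_pair_def fapp_def by blast
qed

lemma inner_adj': "inner (fapp (adj A) x) y = inner x (fapp A y)"
  by (metis inner_adj inner_commute)

lemma adj_eqI:
  assumes "\<And>x y. inner (fapp A x) y = inner x (fapp B y)" shows "adj A = B"
proof (rule fop_eqI)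
  fix y
  have "\<forall>x. inner x (fapp (adj A) y) = inner x (fapp B y)" by (metis assms inner_adj)
  then show "fapp (adj A) y = fapp B y" by (simp only: vector_eq_ldot)
qed

lemma adj_simps [simp]:
  "adj (adj A) = A" "adj (A + B) = adj A + adj B" "adj (A - B) = adj A - adj B" "adj (- A) = - adj A"
  "adj (c *\<^sub>R A) = c *\<^sub>R adj A" "adj (A * B) = adj B * adj A" "adj 0 = 0" "adj 1 = 1"
  by (rule adj_eqI, simp add: inner_adj')
    (rule adj_eqI, simp add: inner_adj inner_add_left inner_add_right inner_diff_left inner_diff_right)+

lemma adj_sum: "adj (\<Sum>i\<in>I. T i) = (\<Sum>i\<in>I. adj (T i))"
  by (induction I rule: infinite_finite_induct) auto

text \<open>
  The C*-identity.  The estimate \<open>\<parallel>A\<parallel>\<^sup>2 \<le> \<parallel>A\<^sup>* A\<parallel>\<close> is Cauchy-Schwarz; it also gives \<open>\<parallel>A\<parallel> \<le> \<parallel>A\<^sup>*\<parallel>\<close>, and by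
  symmetry equality of these norms, from which the opposite estimate follows.
\<close>

lemma norm_adj_mult_self: "norm (adj A * A) = (norm A)\<^sup>2"
proof -
  have *: "norm A \<le> sqrt (norm (adj A * A))" for A
  proof (rule norm_fop_bound)
    fix x
    have "(norm (fapp A x))\<^sup>2 = inner (fapp (adj A * A) x) x"
      by (simp add: inner_adj' power2_norm_eq_inner)
    also have "\<dots> \<le> norm (fapp (adj A * A) x) * norm x" by (rule norm_cauchy_schwarz)
    also have "\<dots> \<le> norm (adj A * A) * norm x * norm x"
      by (intro mult_right_mono norm_fapp) auto
    finally have "norm (fapp A x) \<le> sqrt (norm (adj A * A) * (norm x)\<^sup>2)"
      by (intro real_le_rsqrt) (simp add: power2_eq_square mult.assoc)
    then show "norm (fapp A x) \<le> sqrt (norm (adj A * A)) * norm x"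
      by (simp add: real_sqrt_mult)
  qed auto
  have sq: "(norm A)\<^sup>2 \<le> norm (adj A * A)" for A
    using power_mono[OF *[of A], of 2] by simp
  have le: "norm A \<le> norm (adj A)" for A
  proof (cases "norm A = 0")
    case False
    have "norm A * norm A \<le> norm (adj A) * norm A"
      using sq[of A] norm_mult_ineq[of "adj A" A] by (simp add: power2_eq_square)
    then show ?thesis using False by (simp add: mult_le_cancel_right)
  qed simp
  have "norm (adj A) = norm A" using le[of A] le[of "adj A"] by simp
  then have "norm (adj A * A) \<le> (norm A)\<^sup>2"
    using norm_mult_ineq[of "adj A" A] by (simp add: power2_eq_square)
  with sq[of A] show ?thesis by simp
qed

lemma norm_adj [simp]: "norm (adj A) = norm A"
proof -
  have le: "norm A \<le> norm (adj A)" for A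
  proof (cases "norm A = 0")
    case False
    have "norm A * norm A \<le> norm (adj A) * norm A"
      using norm_adj_mult_self[of A] norm_mult_ineq[of "adj A" A] by (simp add: power2_eq_square)
    then show ?thesis using False by (simp add: mult_le_cancel_right)
  qed simp
  show ?thesis using le[of A] le[of "adj A"] by simp
qed

lemma bounded_linear_adj: "bounded_linear adj"
  by (rule bounded_linear_intro[where K = 1]) auto

lemma norm_selfadjoint_projection:
  assumes "adj P = P" "P * P = P" shows "norm P \<le> 1"
proof -
  have "norm P * norm P = norm P * 1" using norm_adj_mult_self[of P] assms by (simp add: power2_eq_square)
  then show ?thesis by (cases "norm P = 0") simp_all
qed

section \<open>Matrices as operators\<close>

lemma fapp_mk_fop:
  assumes f: "bounded_linear f" and g: "bounded_linear g"
    and adj: "\<And>x y. inner (f x) y = inner x (g y)"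
  shows "fapp (Fop (Blinfun f)) x = f x"
proof -
  have "adjoint_pair (Blinfun f) (Blinfun g)"
    by (simp add: adjoint_pair_def bounded_linear_Blinfun_apply f g adj)
  then have "blin_of (Fop (Blinfun f)) = Blinfun f" by (intro Fop_inverse) auto
  then show ?thesis by (simp add: fapp_def bounded_linear_Blinfun_apply f)
qed

definition unit_op :: "nat \<Rightarrow> nat \<Rightarrow> complex \<Rightarrow> fop" where
  "unit_op j k z = Fop (Blinfun (\<lambda>x. fsingle j (z * coord x k)))"

lemma fapp_unit_op: "fapp (unit_op j k z) x = fsingle j (z * coord x k)"
proof -
  have bl: "bounded_linear (\<lambda>x. fsingle j (z * coord x k))" for j k z
  proof (rule bounded_linear_intro[where K = "cmod z"])
    show "norm (fsingle j (z * coord x k)) \<le> norm x * cmod z" for x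
      using mult_right_mono[OF cmod_coord_le[of x k], of "cmod z"] by (simp add: norm_mult mult.commute)
  qed (auto intro!: fseq_eqI simp: algebra_simps)
  have "inner (fsingle j (z * coord x k)) y = inner x (fsingle k (cnj z * coord y j))" for x y
    by (subst inner_commute) (simp add: inner_fsingle algebra_simps)
  from fapp_mk_fop[OF bl bl this] show ?thesis by (simp add: unit_op_def)
qed

lemma adj_unit_op: "adj (unit_op j k z) = unit_op k j (cnj z)"
  by (rule adj_eqI, subst inner_commute) (simp add: fapp_unit_op inner_fsingle algebra_simps)

lemma bounded_linear_unit_op: "bounded_linear (unit_op j k)"
proof (rule bounded_linear_intro[where K = 1])
  show "norm (unit_op j k z) \<le> norm z * 1" for z
    by (rule norm_fop_bound) (auto simp: fapp_unit_op norm_mult intro!: mult_left_mono cmod_coord_le)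
qed (auto intro!: fop_eqI fseq_eqI simp: fapp_unit_op algebra_simps)

text \<open>
  A matrix acts on the first coordinates and kills the others.  Products of matrices of fitting sizes
  become products of operators, and \<open>norm (mat_op A)\<close> does not change when \<open>A\<close> is padded with zeros.
\<close>

definition mat_op :: "complex mat \<Rightarrow> fop" where
  "mat_op A = (\<Sum>j<dim_row A. \<Sum>k<dim_col A. unit_op j k (A $$ (j, k)))"

lemma coord_mat_op:
  "coord (fapp (mat_op A) x) i =
     (if i < dim_row A then \<Sum>k<dim_col A. A $$ (i, k) * coord x k else 0)"
proof -
  have "coord (fapp (mat_op A) x) i =
      (\<Sum>j<dim_row A. if i = j then \<Sum>k<dim_col A. A $$ (j, k) * coord x k else 0)"
    unfolding mat_op_def fapp_sum_left coord_sum fapp_unit_op coord_fsingle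
    by (intro sum.cong) auto
  then show ?thesis by (simp add: sum.delta')
qed

lemma mat_op_eqI:
  assumes "\<And>x i. i < dim_row A \<Longrightarrow> coord (fapp T x) i = (\<Sum>k<dim_col A. A $$ (i, k) * coord x k)"
    and "\<And>x i. i \<ge> dim_row A \<Longrightarrow> coord (fapp T x) i = 0"
  shows "mat_op A = T"
  by (intro fop_eqI fseq_eqI) (simp add: coord_mat_op assms)

lemma mat_op_add:
  assumes "A \<in> carrier_mat n m" "B \<in> carrier_mat n m"
  shows "mat_op (A + B) = mat_op A + mat_op B"
  using assms by (intro mat_op_eqI) (auto simp: coord_mat_op algebra_simps sum.distrib)

lemma mat_op_diff:
  assumes "A \<in> carrier_mat n m" "B \<in> carrier_mat n m"
  shows "mat_op (A - B) = mat_op A - mat_op B"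
  using assms by (intro mat_op_eqI) (auto simp: coord_mat_op algebra_simps sum_subtractf)

lemma mat_op_smult: "mat_op (complex_of_real c \<cdot>\<^sub>m A) = c *\<^sub>R mat_op A"
  by (intro mat_op_eqI) (auto simp: coord_mat_op sum_distrib_left scaleR_conv_of_real[where 'a = complex] mult_ac)

lemma mat_op_mult:
  assumes A: "A \<in> carrier_mat n m" and B: "B \<in> carrier_mat m l"
  shows "mat_op (A * B) = mat_op A * mat_op B"
proof (rule mat_op_eqI)
  fix x i assume i: "i < dim_row (A * B)"
  then have "coord (fapp (mat_op A * mat_op B) x) i = (\<Sum>k<m. A $$ (i, k) * (\<Sum>r<l. B $$ (k, r) * coord x r))"
    using A B by (simp add: coord_mat_op)
  also have "\<dots> = (\<Sum>k<m. \<Sum>r<l. A $$ (i, k) * B $$ (k, r) * coord x r)"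
    by (simp add: sum_distrib_left mult.assoc)
  also have "\<dots> = (\<Sum>r<l. (\<Sum>k<m. A $$ (i, k) * B $$ (k, r)) * coord x r)"
    by (subst sum.swap) (simp add: sum_distrib_right)
  also have "\<dots> = (\<Sum>r<dim_col (A * B). (A * B) $$ (i, r) * coord x r)"
    using A B i by (intro sum.cong) (auto simp: scalar_prod_def atLeast0LessThan)
  finally show "coord (fapp (mat_op A * mat_op B) x) i = \<dots>" .
qed (use A B in \<open>auto simp: coord_mat_op\<close>)

lemma dim_mat_adjoint [simp]: "dim_row (mat_adjoint A) = dim_col A" "dim_col (mat_adjoint A) = dim_row A"
  by (auto simp: mat_adjoint_def mat_of_rows_def)

lemma index_mat_adjoint:
  fixes A :: "complex mat"
  shows "j < dim_row A \<Longrightarrow> k < dim_col A \<Longrightarrow> mat_adjoint A $$ (k, j) = cnj (A $$ (j, k))"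
  by (simp add: mat_adjoint_def mat_of_rows_index)

lemma mat_op_adjoint: "mat_op (mat_adjoint A) = adj (mat_op A)"
proof -
  have "mat_op (mat_adjoint A) = (\<Sum>k<dim_col A. \<Sum>j<dim_row A. unit_op k j (cnj (A $$ (j, k))))"
    unfolding mat_op_def by (intro sum.cong) (auto simp: index_mat_adjoint)
  also have "\<dots> = adj (mat_op A)"
    unfolding mat_op_def adj_sum adj_unit_op by (rule sum.swap)
  finally show ?thesis .
qed

lift_definition fseq_of_vec :: "complex Matrix.vec \<Rightarrow> fseq" is
  "\<lambda>v i. if i < dim_vec v then vec_index v i else 0"
  by (rule finite_subset[where B = "{..<dim_vec v}" for v :: "complex Matrix.vec"]) auto

lemma coord_fseq_of_vec [simp]: "coord (fseq_of_vec v) i = (if i < dim_vec v then vec_index v i else 0)"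
  by (simp add: fseq_of_vec.rep_eq)

lemma norm_fseq_of_vec: "norm (fseq_of_vec v) = vnorm v"
proof -
  have "norm (fseq_of_vec v) = sqrt (\<Sum>i<dim_vec v. (cmod (coord (fseq_of_vec v) i))\<^sup>2)"
    by (rule norm_fseq_upto) simp
  then show ?thesis by (simp add: vnorm_def)
qed

lemma mat_op_fseq_of_vec:
  assumes "dim_vec v = dim_col A"
  shows "fapp (mat_op A) (fseq_of_vec v) = fseq_of_vec (A *\<^sub>v v)"
  using assms by (intro fseq_eqI) (auto simp: coord_mat_op scalar_prod_def atLeast0LessThan)

lemma sum_coord_le:  "(\<Sum>i<N. (cmod (coord x i))\<^sup>2) \<le> (norm x)\<^sup>2"
proof -
  obtain N' where N': "\<And>i. i \<ge> N' \<Longrightarrow> coord x i = 0" by (rule coord_supportE) blast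
  have "norm x = sqrt (\<Sum>i<max N N'. (cmod (coord x i))\<^sup>2)"
    by (rule norm_fseq_upto) (simp add: N')
  then have "(norm x)\<^sup>2 = (\<Sum>i<max N N'. (cmod (coord x i))\<^sup>2)"
    by (simp add: sum_nonneg)
  moreover have "(\<Sum>i<N. (cmod (coord x i))\<^sup>2) \<le> (\<Sum>i<max N N'. (cmod (coord x i))\<^sup>2)"
    by (rule sum_mono2) auto
  ultimately show ?thesis by simp
qed

lemma norm_mat_op_le_opnorm: "norm (mat_op A) \<le> opnorm A"
proof -
  let ?V = "{v \<in> carrier_vec (dim_col A). vnorm v \<le> 1}"
  have *: "vnorm (A *\<^sub>v v) \<le> opnorm A" if "v \<in> ?V" for v
    unfolding opnorm_def
  proof (rule cSUP_upper[OF that])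
    show "bdd_above ((\<lambda>v. vnorm (A *\<^sub>v v)) ` ?V)"
    proof (rule bdd_aboveI2)
      fix w assume w: "w \<in> ?V"
      then have "vnorm (A *\<^sub>v w) = norm (fapp (mat_op A) (fseq_of_vec w))"
        by (simp add: mat_op_fseq_of_vec norm_fseq_of_vec)
      also have "\<dots> \<le> norm (mat_op A) * vnorm w" using norm_fapp by (metis norm_fseq_of_vec)
      also have "\<dots> \<le> norm (mat_op A) * 1" using w by (intro mult_left_mono) auto
      finally show "vnorm (A *\<^sub>v w) \<le> norm (mat_op A)" by simp
    qed
  qed
  have nonneg: "0 \<le> opnorm A"
    using *[of "0\<^sub>v (dim_col A)"] by (simp add: vnorm_def order_trans[OF _ *] real_sqrt_ge_zero sum_nonneg)
  show ?thesis
  proof (rule norm_fop_bound[OF nonneg])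
    fix x :: fseq
    define v where "v = Matrix.vec (dim_col A) (\<lambda>k. coord x k)"
    have v: "dim_vec v = dim_col A" by (simp add: v_def)
    have Av: "fapp (mat_op A) x = fapp (mat_op A) (fseq_of_vec v)"
      by (intro fseq_eqI) (auto simp: coord_mat_op v_def)
    have "(vnorm v)\<^sup>2 \<le> (norm x)\<^sup>2"
      using sum_coord_le[of x "dim_col A"] by (simp add: vnorm_def v_def sum_nonneg)
    then have vx: "vnorm v \<le> norm x" by (rule power2_le_imp_le) simp
    show "norm (fapp (mat_op A) x) \<le> opnorm A * norm x"
    proof (cases "vnorm v = 0")
      case True
      then have "fseq_of_vec v = 0" using norm_fseq_of_vec by (metis norm_eq_zero)
      then show ?thesis using nonneg by (simp add: Av)
    next
      case False
      have pos: "vnorm v > 0" using False norm_fseq_of_vec[of v] norm_ge_zero[of "fseq_of_vec v"] by linarith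
      define u where "u = complex_of_real (1 / vnorm v) \<cdot>\<^sub>v v"
      have u: "fseq_of_vec u = (1 / vnorm v) *\<^sub>R fseq_of_vec v" "dim_vec u = dim_col A"
        by (auto intro!: fseq_eqI simp: u_def scaleR_conv_of_real v)
      have "vnorm u = 1" using pos norm_fseq_of_vec[of u] by (simp add: u norm_fseq_of_vec)
      then have "vnorm (A *\<^sub>v u) \<le> opnorm A" using u(2) by (intro *) (auto intro: carrier_vecI)
      then have "norm (fapp (mat_op A) (fseq_of_vec u)) \<le> opnorm A"
        using u(2) by (simp add: mat_op_fseq_of_vec norm_fseq_of_vec)
      then have "norm (fapp (mat_op A) x) / vnorm v \<le> opnorm A"
        using pos by (simp add: u Av)
      then have "norm (fapp (mat_op A) x) \<le> opnorm A * vnorm v" using pos by (simp add: divide_le_eq)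
      also have "\<dots> \<le> opnorm A * norm x" using vx nonneg by (intro mult_left_mono)
      finally show ?thesis .
    qed
  qed
qed

lemma mat_op_has_vector_derivative:
  assumes F': "has_mat_deriv F F' \<theta>" and \<theta>: "\<theta> \<in> freqs" and F: "\<And>t. t \<in> freqs \<Longrightarrow> F t \<in> carrier_mat n m"
  shows "((\<lambda>t. mat_op (F t)) has_vector_derivative mat_op F') (at \<theta> within freqs)"
proof (rule has_vector_derivative_transform[OF \<theta>])
  show "mat_op (F t) = (\<Sum>j<n. \<Sum>k<m. unit_op j k (F t $$ (j, k)))" if "t \<in> freqs" for t
    using F[OF that] by (auto simp: mat_op_def)
  have dims: "dim_row F' = n" "dim_col F' = m" using F' F[OF \<theta>] by (auto simp: has_mat_deriv_def)
  have "((\<lambda>t. \<Sum>j<n. \<Sum>k<m. unit_op j k (F t $$ (j, k))) has_vector_derivative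
      (\<Sum>j<n. \<Sum>k<m. unit_op j k (F' $$ (j, k)))) (at \<theta> within freqs)"
    using F' dims
    by (intro has_vector_derivative_sum bounded_linear.has_vector_derivative[OF bounded_linear_unit_op])
      (auto simp: has_mat_deriv_def)
  then show "((\<lambda>t. \<Sum>j<n. \<Sum>k<m. unit_op j k (F t $$ (j, k))) has_vector_derivative mat_op F') (at \<theta> within freqs)"
    by (simp only: mat_op_def dims)
qed

definition entry :: "nat \<Rightarrow> nat \<Rightarrow> fop \<Rightarrow> complex" where
  "entry j k T = coord (fapp T (fsingle k 1)) j"

lemma entry_mat_op: "j < dim_row A \<Longrightarrow> k < dim_col A \<Longrightarrow> entry j k (mat_op A) = A $$ (j, k)"
  by (simp add: entry_def coord_mat_op if_distrib[of "(*) _"] cong: if_cong)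

lemma bounded_linear_entry: "bounded_linear (entry j k)"
proof (rule bounded_linear_intro[where K = 1])
  show "norm (entry j k T) \<le> norm T * 1" for T
    unfolding entry_def using order_trans[OF cmod_coord_le norm_fapp[of T "fsingle k 1"]] by simp
qed (simp_all add: entry_def)

text \<open>
  The real part of row \<open>i\<close> is read off from the adjoint applied to \<open>e\<^sub>i\<close>, and the imaginary part from the
  adjoint applied to \<open>\<i> e\<^sub>i\<close>; as operators are only required to be real linear, these are two separate vectors, which
  costs the factor 2.
\<close>

lemma row_norm_le: "sqrt (\<Sum>k<n. (cmod (entry i k T))\<^sup>2) \<le> 2 * norm T"
proof -
  define y z where "y = fapp (adj T) (fsingle i 1)" and "z = fapp (adj T) (fsingle i \<i>)"
  have Re: "Re (entry i k T) = Re (coord y k)" for k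
    using inner_adj[of T "fsingle k 1" "fsingle i 1"]
    by (simp add: entry_def y_def inner_fsingle) (simp add: inner_commute[of "fsingle k 1"] inner_fsingle)
  have Im: "Im (entry i k T) = Re (coord z k)" for k
    using inner_adj[of T "fsingle k 1" "fsingle i \<i>"]
    by (simp add: entry_def z_def inner_fsingle) (simp add: inner_commute[of "fsingle k 1"] inner_fsingle)
  have "norm y \<le> norm T" "norm z \<le> norm T"
    using norm_fapp[of "adj T" "fsingle i 1"] norm_fapp[of "adj T" "fsingle i \<i>"] by (simp_all add: y_def z_def)
  then have yz: "(norm y)\<^sup>2 \<le> (norm T)\<^sup>2" "(norm z)\<^sup>2 \<le> (norm T)\<^sup>2" by (simp_all add: power_mono)
  have sq: "(Re c)\<^sup>2 \<le> (cmod c)\<^sup>2" for c by (simp add: cmod_power2)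
  have "(\<Sum>k<n. (cmod (entry i k T))\<^sup>2) \<le> (\<Sum>k<n. (cmod (coord y k))\<^sup>2 + (cmod (coord z k))\<^sup>2)"
    unfolding cmod_power2[of "entry _ _ _"] Re Im by (intro sum_mono add_mono sq)
  also have "\<dots> \<le> (norm T)\<^sup>2 + (norm T)\<^sup>2"
    unfolding sum.distrib using sum_coord_le[of y n] sum_coord_le[of z n] yz by linarith
  also have "\<dots> \<le> (2 * norm T)\<^sup>2" by (simp add: power2_eq_square)
  finally show ?thesis by (intro real_le_lsqrt) simp_all
qed

lemma homogeneous_system_nontrivial:
  fixes M :: "nat \<Rightarrow> nat \<Rightarrow> complex"
  assumes "m < n"
  obtains x where "dim_vec x = n" "x \<noteq> 0\<^sub>v n" "\<And>i. i < m \<Longrightarrow> (\<Sum>k<n. M i k * vec_index x k) = 0"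
proof -
  \<comment> \<open>Padding with equations up to a square system that has a zero row, hence is singular.\<close>
  define A where "A = mat\<^sub>r n n (\<lambda>i. if i = n - 1 then 0\<^sub>v n else Matrix.vec n (M i))"
  have A: "A \<in> carrier_mat n n" by (simp add: A_def)
  have "Determinant.det A = 0" unfolding A_def using assms by (intro det_row_0) auto
  then obtain x where x: "x \<in> carrier_vec n" "x \<noteq> 0\<^sub>v n" "A *\<^sub>v x = 0\<^sub>v n"
    using det_0_iff_vec_prod_zero_field[OF A] by auto
  have "(\<Sum>k<n. M i k * vec_index x k) = 0" if "i < m" for i
  proof -
    have "A $$ (i, k) = M i k" if "k < n" for k
      using that \<open>i < m\<close> assms by (simp add: A_def)
    then have "vec_index (A *\<^sub>v x) i = (\<Sum>k<n. M i k * vec_index x k)"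
      using x(1) A that assms by (auto simp: scalar_prod_def atLeast0LessThan intro!: sum.cong)
    then show ?thesis using x(3) that assms by simp
  qed
  with x show ?thesis by (intro that[of x]) auto
qed

lemma norm_power_selfadjoint: 
  assumes "adj T = T" shows "norm (T ^ (2 ^ k)) = norm T ^ (2 ^ k)"
proof (induction k)
  case (Suc k)
  have "adj (T ^ m) = T ^ m" for m by (induction m) (simp_all add: assms power_commutes)
  then have "norm (T ^ (2 ^ k) * T ^ (2 ^ k)) = (norm (T ^ (2 ^ k)))\<^sup>2"
    using norm_adj_mult_self[of "T ^ (2 ^ k)"] by simp
  then show ?case using Suc by (simp add: power_add[symmetric] power_mult[symmetric] mult_2 mult.commute)
qed simp

lemma mat_op_pow: "A \<in> carrier_mat n n \<Longrightarrow> mat_op (A ^\<^sub>m Suc k) = mat_op A ^ Suc k"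
proof (induction k)
  case (Suc k)
  then show ?case
    using mat_op_mult[of "A ^\<^sub>m Suc k" n n A n] pow_carrier_mat[of A n "Suc k"]
    by (metis power_Suc2 pow_mat.simps(2))
qed simp

lemma norm_mat_op_le_sum: "norm (mat_op A) \<le> (\<Sum>j<dim_row A. \<Sum>k<dim_col A. cmod (A $$ (j, k)))"
proof -
  have "norm (unit_op j k z) \<le> cmod z" for j k z
    by (rule norm_fop_bound) (auto simp: fapp_unit_op norm_mult intro!: mult_left_mono cmod_coord_le)
  then show ?thesis unfolding mat_op_def by (intro order_trans[OF norm_sum] sum_mono)
qed

text \<open>
  If all eigenvalues of \<open>B = A / r\<close> lie in the open unit disc, then the powers of \<open>B\<close> stay bounded
  entrywise.  As \<open>B\<close> is Hermitian, \<open>\<parallel>B\<parallel> ^ (2 ^ k) = \<parallel>B ^ (2 ^ k)\<parallel>\<close>, so \<open>\<parallel>B\<parallel> > 1\<close> is impossible.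
\<close>

lemma norm_hermitian_le_eigenvalues:
  assumes A: "A \<in> carrier_mat n n" and herm: "adj (mat_op A) = mat_op A"
    and ev: "\<And>e. eigenvalue A e \<Longrightarrow> cmod e < r" and r: "0 < r"
  shows "norm (mat_op A) \<le> r"
proof (cases "n = 0")
  case True
  then show ?thesis using A r by (simp add: mat_op_def)
next
  case False
  define B where "B = complex_of_real (1 / r) \<cdot>\<^sub>m A"
  have B: "B \<in> carrier_mat n n" using A by (simp add: B_def)
  have opB: "mat_op B = (1 / r) *\<^sub>R mat_op A" unfolding B_def by (rule mat_op_smult)
  have evB: "cmod e < 1" if e: "eigenvalue B e" for e
  proof -
    obtain v where v: "v \<in> carrier_vec n" "v \<noteq> 0\<^sub>v n" "B *\<^sub>v v = e \<cdot>\<^sub>v v"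
      using e unfolding eigenvalue_def eigenvector_def carrier_matD(1)[OF B] by blast
    have "A = complex_of_real r \<cdot>\<^sub>m B" using r A by (auto simp: B_def intro!: eq_matI)
    then have "A *\<^sub>v v = complex_of_real r \<cdot>\<^sub>v (B *\<^sub>v v)"
      using B v(1) by (auto intro!: eq_vecI simp: scalar_prod_def sum_distrib_left mult.assoc)
    then have "A *\<^sub>v v = (complex_of_real r * e) \<cdot>\<^sub>v v" by (simp add: v(3) smult_smult_assoc)
    then have "eigenvalue A (complex_of_real r * e)" using v A by (auto simp: eigenvalue_def eigenvector_def)
    from ev[OF this] show ?thesis using r by (simp add: norm_mult)
  qed
  have "spectral_radius B < 1"
    using spectral_radius_mem_max(1)[OF B] False evB by (auto simp: spectrum_def)
  from spectral_radius_jnf_norm_bound_less_1_upper_triangular[OF B this]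
  obtain c where c: "\<And>k. norm_bound (B ^\<^sub>m k) c" by blast
  have bound: "norm (mat_op B) ^ (2 ^ k) \<le> real n * (real n * c)" for k
  proof -
    obtain m where m: "(2::nat) ^ k = Suc m" by (metis gr0_implies_Suc zero_less_numeral zero_less_power)
    have "adj (mat_op B) = mat_op B" by (simp add: opB herm)
    then have "norm (mat_op B) ^ (2 ^ k) = norm (mat_op (B ^\<^sub>m Suc m))"
      by (metis norm_power_selfadjoint m mat_op_pow[OF B])
    also have "\<dots> \<le> (\<Sum>j<n. \<Sum>l<n. cmod ((B ^\<^sub>m Suc m) $$ (j, l)))"
      using norm_mat_op_le_sum[of "B ^\<^sub>m Suc m"] by (simp only: carrier_matD[OF pow_carrier_mat[OF B]])
    also have "\<dots> \<le> (\<Sum>j<n. \<Sum>l<n. c)"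
      using c[of "Suc m", unfolded norm_bound_def carrier_matD[OF pow_carrier_mat[OF B]]]
      by (intro sum_mono) blast
    finally show ?thesis by simp
  qed
  have "norm (mat_op B) \<le> 1"
  proof (rule ccontr)
    assume "\<not> norm (mat_op B) \<le> 1"
    then have gt: "norm (mat_op B) > 1" by simp
    then obtain k where k: "real n * (real n * c) < norm (mat_op B) ^ k" using real_arch_pow by blast
    have "norm (mat_op B) ^ k \<le> norm (mat_op B) ^ (2 ^ k)" using gt by (intro power_increasing) (auto simp: less_imp_le)
    then show False using bound[of k] k by linarith
  qed
  then show ?thesis using r by (simp add: opB divide_le_eq)
qed

section \<open>Differentiability of spectral projections\<close>

lemma has_vector_derivative_iff_quotient:
  fixes f :: "real \<Rightarrow> 'a::real_normed_vector"
  shows "(f has_vector_derivative D) (at x within S) \<longleftrightarrow>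
    ((\<lambda>t. (f t - f x) /\<^sub>R (t - x)) \<longlongrightarrow> D) (at x within S)"
proof -
  have *: "norm ((f t - f x - (t - x) *\<^sub>R D) /\<^sub>R norm (t - x)) = norm ((f t - f x) /\<^sub>R (t - x) - D)"
    if "t \<noteq> x" for t
  proof -
    have "(f t - f x) /\<^sub>R (t - x) - D = (f t - f x - (t - x) *\<^sub>R D) /\<^sub>R (t - x)"
      using that by (simp add: scaleR_diff_right)
    then show ?thesis by simp
  qed
  have "(f has_vector_derivative D) (at x within S) \<longleftrightarrow>
      ((\<lambda>t. norm ((f t - f x - (t - x) *\<^sub>R D) /\<^sub>R norm (t - x))) \<longlongrightarrow> 0) (at x within S)"
    unfolding has_vector_derivative_def has_derivative_at_within tendsto_norm_zero_iff
    by (simp add: bounded_linear_scaleR_left)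
  also have "\<dots> \<longleftrightarrow> ((\<lambda>t. norm ((f t - f x) /\<^sub>R (t - x) - D)) \<longlongrightarrow> 0) (at x within S)"
    by (intro filterlim_cong refl, subst eventually_at_filter, intro always_eventually allI impI, rule *)
  also have "\<dots> \<longleftrightarrow> ((\<lambda>t. (f t - f x) /\<^sub>R (t - x)) \<longlongrightarrow> D) (at x within S)"
    by (simp add: tendsto_norm_zero_iff LIM_zero_iff)
  finally show ?thesis .
qed

text \<open>
  Half of \<open>X\<close> is absorbed: \<open>X = Y + a X k\<close> with a factor at most 1/2 bounds \<open>X\<close> by \<open>2 Y\<close> whatever \<open>X\<close> is.
\<close>

lemma norm_fixpoint_le:
  fixes X :: "'a::real_normed_algebra"
  assumes X: "X = Y + a * X * k" and "norm a * norm k \<le> 1 / 2"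
  shows "norm X \<le> 2 * norm Y"
proof -
  have "norm (a * X * k) \<le> norm a * norm X * norm k"
    by (meson mult_right_mono norm_ge_zero norm_mult_ineq order_trans)
  also have "\<dots> = (norm a * norm k) * norm X" by simp
  also have "\<dots> \<le> 1 / 2 * norm X" by (intro mult_right_mono assms) auto
  finally have "norm (a * X * k) \<le> norm X / 2" by simp
  moreover have "norm X \<le> norm Y + norm (a * X * k)"
    by (subst X) (rule norm_triangle_ineq)
  ultimately show ?thesis by linarith
qed

text \<open>
  The difference quotient \<open>W\<close> of \<open>X\<close> satisfies the same equation as the candidate \<open>Z\<close> up to an error that
  tends to 0, so \<open>W - Z\<close> is a fixed point with small inhomogeneity and \<open>norm_fixpoint_le\<close> applies.  The
  increments, not \<open>X\<close> itself, enter the equation because both uses below have the coefficient \<open>a\<close> frozen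
  at \<open>\<theta>\<close>.
\<close>

lemma fixpoint_has_vector_derivative:
  fixes X Y k :: "real \<Rightarrow> 'a::real_normed_algebra"
  assumes \<theta>: "\<theta> \<in> S" and X: "\<And>t. t \<in> S \<Longrightarrow> X t - X \<theta> = Y t + a * (X t - X \<theta>) * k t"
    and Y: "((\<lambda>t. Y t /\<^sub>R (t - \<theta>)) \<longlongrightarrow> Y') (at \<theta> within S)"
    and k: "(k \<longlongrightarrow> k \<theta>) (at \<theta> within S)"
    and small: "\<And>t. t \<in> S \<Longrightarrow> norm a * norm (k t) \<le> 1 / 2"
    and Z: "Z = Y' + a * Z * k \<theta>"
  shows "(X has_vector_derivative Z) (at \<theta> within S)"
  unfolding has_vector_derivative_iff_quotient
proof (rule LIM_zero_cancel, rule Lim_null_comparison)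
  define e where "e = (\<lambda>t. (Y t /\<^sub>R (t - \<theta>) - Y') + a * Z * (k t - k \<theta>))"
  show "\<forall>\<^sub>F t in at \<theta> within S. norm ((X t - X \<theta>) /\<^sub>R (t - \<theta>) - Z) \<le> 2 * norm (e t)"
    unfolding eventually_at_filter
  proof (intro always_eventually allI impI)
    fix t assume t: "t \<noteq> \<theta>" "t \<in> S"
    define W where "W = (X t - X \<theta>) /\<^sub>R (t - \<theta>)"
    have "W = (Y t + a * (X t - X \<theta>) * k t) /\<^sub>R (t - \<theta>)"
      unfolding W_def by (subst X[OF t(2)]) simp
    also have "\<dots> = Y t /\<^sub>R (t - \<theta>) + a * W * k t"
      by (simp add: W_def scaleR_add_right)
    finally have W: "W = Y t /\<^sub>R (t - \<theta>) + a * W * k t" .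
    have "W - Z = (Y t /\<^sub>R (t - \<theta>) + a * W * k t) - (Y' + a * Z * k \<theta>)"
      using W Z by simp
    also have "\<dots> = e t + a * (W - Z) * k t"
      by (simp add: e_def algebra_simps)
    finally have "W - Z = e t + a * (W - Z) * k t" .
    from norm_fixpoint_le[OF this small[OF t(2)]]
    show "norm ((X t - X \<theta>) /\<^sub>R (t - \<theta>) - Z) \<le> 2 * norm (e t)" by (simp add: W_def)
  qed
  have "(e \<longlongrightarrow> (Y' - Y') + a * Z * (k \<theta> - k \<theta>)) (at \<theta> within S)"
    unfolding e_def by (intro tendsto_intros Y k)
  then have "((\<lambda>t. norm (e t)) \<longlongrightarrow> 0) (at \<theta> within S)" by (simp add: tendsto_norm_zero)
  then have "((\<lambda>t. 2 * norm (e t)) \<longlongrightarrow> 2 * 0) (at \<theta> within S)" by (rule tendsto_mult_left)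
  then show "((\<lambda>t. 2 * norm (e t)) \<longlongrightarrow> 0) (at \<theta> within S)" by simp
qed

text \<open>
  A family \<open>Sg\<close> of self-adjoint operators with commuting projections \<open>P\<close>; \<open>a\<close> inverts \<open>Sg\<close> on the range of
  \<open>P\<close>.  The condition \<open>gap\<close> separates the two parts of the spectrum uniformly in the parameter.
  \<open>solvable\<close> takes the place of completeness.
\<close>

locale spectral_split =
  fixes S :: "real set" and Sg P a :: "real \<Rightarrow> fop" and \<alpha> :: real
  assumes limit_point: "t \<in> S \<Longrightarrow> at t within S \<noteq> bot"
    and adj_Sg: "t \<in> S \<Longrightarrow> adj (Sg t) = Sg t"
    and adj_P: "t \<in> S \<Longrightarrow> adj (P t) = P t"
    and P_idem: "t \<in> S \<Longrightarrow> P t * P t = P t"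
    and commutes: "t \<in> S \<Longrightarrow> Sg t * P t = P t * Sg t"
    and adj_a: "t \<in> S \<Longrightarrow> adj (a t) = a t"
    and a_P: "t \<in> S \<Longrightarrow> a t * P t = a t"
    and a_Sg: "t \<in> S \<Longrightarrow> a t * Sg t = P t"
    and norm_a: "t \<in> S \<Longrightarrow> norm (a t) \<le> \<alpha>"
    and gap: "t \<in> S \<Longrightarrow> \<alpha> * norm (Sg t * (1 - P t)) \<le> 1 / 2"
    and solvable: "t \<in> S \<Longrightarrow> \<exists>Z. Z = C + a t * Z * (Sg t * (1 - P t))"
begin

abbreviation "R t \<equiv> 1 - P t"
abbreviation "K t \<equiv> Sg t * R t"

lemma P_a: "t \<in> S \<Longrightarrow> P t * a t = a t"
  using a_P[of t] adj_a adj_P by (metis adj_simps(6))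

lemma Sg_a: "t \<in> S \<Longrightarrow> Sg t * a t = P t"
  using a_Sg[of t] adj_a adj_P adj_Sg by (metis adj_simps(6))

lemma adj_R: "t \<in> S \<Longrightarrow> adj (R t) = R t" by (simp add: adj_P)

lemma R_idem: "t \<in> S \<Longrightarrow> R t * R t = R t" by (simp add: algebra_simps P_idem)

lemma R_Sg_R: "t \<in> S \<Longrightarrow> R t * Sg t * R t = K t"
  by (simp add: algebra_simps commutes[symmetric] P_idem)

lemma norm_P: "t \<in> S \<Longrightarrow> norm (P t) \<le> 1"
  by (simp add: norm_selfadjoint_projection adj_P P_idem)

lemma norm_R: "t \<in> S \<Longrightarrow> norm (R t) \<le> 1"
  by (simp add: norm_selfadjoint_projection adj_R R_idem del: adj_simps)

lemma alpha_nonneg: "t \<in> S \<Longrightarrow> 0 \<le> \<alpha>"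
  using norm_a[of t] norm_ge_zero[of "a t"] by linarith

lemma small: "s \<in> S \<Longrightarrow> t \<in> S \<Longrightarrow> norm (a s) * norm (K t) \<le> 1 / 2"
  using mult_right_mono[OF norm_a[of s] norm_ge_zero[of "K t"]] gap[of t] by linarith

text \<open>
  Projections at different parameters are compared through \<open>P s * R t\<close>, which vanishes for \<open>s = t\<close>: it
  satisfies a fixed point equation whose inhomogeneity is the increment of \<open>Sg\<close>.
\<close>

lemma cross_fixpoint:
  assumes "s \<in> S" "t \<in> S"
  shows "P s * R t = a s * (Sg s - Sg t) * R t + a s * (P s * R t) * K t"
proof -
  have "a s * (P s * R t) * K t = (a s * P s) * (R t * Sg t * R t)" by (simp add: mult.assoc)
  also have "\<dots> = a s * (Sg t * R t)" using assms by (simp only: a_P R_Sg_R)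
  finally have 1: "a s * (P s * R t) * K t = a s * (Sg t * R t)" .
  have "a s * (Sg s - Sg t) * R t = (a s * Sg s - a s * Sg t) * R t" by (simp only: right_diff_distrib)
  also have "\<dots> = P s * R t - a s * (Sg t * R t)"
    using assms by (simp only: a_Sg) (simp only: left_diff_distrib mult.assoc)
  finally show ?thesis using 1 by simp
qed

lemma norm_cross_le:
  assumes "s \<in> S" "t \<in> S"
  shows "norm (P s * R t) \<le> 2 * \<alpha> * norm (Sg s - Sg t)"
proof -
  have "norm (P s * R t) \<le> 2 * norm (a s * (Sg s - Sg t) * R t)"
    by (rule norm_fixpoint_le[OF cross_fixpoint[OF assms] small[OF assms]])
  also have "norm (a s * (Sg s - Sg t) * R t) \<le> norm (a s) * norm (Sg s - Sg t) * norm (R t)"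
    by (meson mult_right_mono norm_ge_zero norm_mult_ineq order_trans)
  also have "\<dots> \<le> \<alpha> * norm (Sg s - Sg t) * 1"
    using assms by (intro mult_mono norm_a norm_R) (auto simp: alpha_nonneg[OF assms(1)])
  finally show ?thesis by simp
qed

lemma P_diff:
  assumes "s \<in> S" "t \<in> S"
  shows "P t - P s = - (P s * R t) - adj (P s * R t) + P s * R t * adj (P s * R t) + R s * P t * R s"
    and "R s * P t * R s = adj (P t * R s) * (P t * R s)"
    and "P t - P s = P t * R s - adj (P s * R t)"
proof -
  have [simp]: "P s * P s = P s" "P t * P t = P t" "adj (P s) = P s" "adj (P t) = P t"
    "P s * (P s * x) = P s * x" "P t * (P t * x) = P t * x" for x
    using assms by (simp_all add: P_idem adj_P mult.assoc[symmetric])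
  show "P t - P s = - (P s * R t) - adj (P s * R t) + P s * R t * adj (P s * R t) + R s * P t * R s"
    "R s * P t * R s = adj (P t * R s) * (P t * R s)"
    "P t - P s = P t * R s - adj (P s * R t)"
    by (simp_all add: algebra_simps)
qed

lemma norm_P_diff_le:
  assumes "s \<in> S" "t \<in> S"
  shows "norm (P t - P s) \<le> norm (P t * R s) + norm (P s * R t)"
  by (subst P_diff(3)[OF assms], rule order_trans[OF norm_triangle_ineq4]) (simp del: adj_simps)

lemma Sg_tendsto:
  assumes "(Sg has_vector_derivative Sg1) (at \<theta> within S)"
  shows "(Sg \<longlongrightarrow> Sg \<theta>) (at \<theta> within S)"
  using has_vector_derivative_continuous[OF assms] by (simp add: continuous_within)

lemma P_tendsto:
  assumes \<theta>: "\<theta> \<in> S" and "(Sg has_vector_derivative Sg1) (at \<theta> within S)"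
  shows "(P \<longlongrightarrow> P \<theta>) (at \<theta> within S)"
proof (rule LIM_zero_cancel, rule Lim_null_comparison)
  show "\<forall>\<^sub>F t in at \<theta> within S. norm (P t - P \<theta>) \<le> 4 * \<alpha> * norm (Sg t - Sg \<theta>)"
    unfolding eventually_at_filter
  proof (intro always_eventually allI impI)
    fix t assume "t \<in> S"
    with \<theta> show "norm (P t - P \<theta>) \<le> 4 * \<alpha> * norm (Sg t - Sg \<theta>)"
      using norm_P_diff_le[of \<theta> t] norm_cross_le[of \<theta> t] norm_cross_le[of t \<theta>]
      by (simp add: norm_minus_commute)
  qed
  have "((\<lambda>t. 4 * \<alpha> * norm (Sg t - Sg \<theta>)) \<longlongrightarrow> 4 * \<alpha> * norm (Sg \<theta> - Sg \<theta>)) (at \<theta> within S)"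
    by (intro tendsto_intros Sg_tendsto[OF assms(2)])
  then show "((\<lambda>t. 4 * \<alpha> * norm (Sg t - Sg \<theta>)) \<longlongrightarrow> 0) (at \<theta> within S)" by simp
qed

text \<open>
  Up to terms quadratic in the increment of \<open>Sg\<close>, \<open>P t - P \<theta>\<close> is \<open>- B - adj B\<close> with \<open>B = P \<theta> * R t\<close>
  (\<open>P_diff\<close>), and \<open>B\<close> is differentiable by its fixed point equation.
\<close>

lemma P_differentiable:
  assumes \<theta>: "\<theta> \<in> S" and Sg: "(Sg has_vector_derivative Sg1) (at \<theta> within S)"
  shows "\<exists>P1. (P has_vector_derivative P1) (at \<theta> within S)"
proof -
  obtain Z where Z: "Z = a \<theta> * - Sg1 * R \<theta> + a \<theta> * Z * K \<theta>"
    using solvable[OF \<theta>] by blast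
  define B where "B t = P \<theta> * R t" for t
  have B\<theta>: "B \<theta> = 0" by (simp add: B_def right_diff_distrib P_idem \<theta>)
  have cont: "(P \<longlongrightarrow> P \<theta>) (at \<theta> within S)" "(Sg \<longlongrightarrow> Sg \<theta>) (at \<theta> within S)"
    using P_tendsto[OF assms] Sg_tendsto[OF Sg] .
  have q: "((\<lambda>t. (Sg t - Sg \<theta>) /\<^sub>R (t - \<theta>)) \<longlongrightarrow> Sg1) (at \<theta> within S)"
    using Sg by (simp only: has_vector_derivative_iff_quotient)
  have "((\<lambda>t. a \<theta> * - ((Sg t - Sg \<theta>) /\<^sub>R (t - \<theta>)) * R t) \<longlongrightarrow> a \<theta> * - Sg1 * R \<theta>) (at \<theta> within S)"
    by (intro tendsto_intros q cont)
  moreover have "a \<theta> * - ((Sg t - Sg \<theta>) /\<^sub>R (t - \<theta>)) * R t = (a \<theta> * (Sg \<theta> - Sg t) * R t) /\<^sub>R (t - \<theta>)" for t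
    by (simp only: mult_scaleR_left mult_scaleR_right scaleR_minus_right[symmetric] minus_diff_eq)
  ultimately have lim: "((\<lambda>t. (a \<theta> * (Sg \<theta> - Sg t) * R t) /\<^sub>R (t - \<theta>)) \<longlongrightarrow> a \<theta> * - Sg1 * R \<theta>) (at \<theta> within S)"
    by simp
  have "(B has_vector_derivative Z) (at \<theta> within S)"
  proof (rule fixpoint_has_vector_derivative[where k = K and Z = Z, OF \<theta> _ lim _ _ Z])
    show "B t - B \<theta> = a \<theta> * (Sg \<theta> - Sg t) * R t + a \<theta> * (B t - B \<theta>) * K t" if "t \<in> S" for t
      using cross_fixpoint[OF \<theta> that] by (simp only: B\<theta> diff_0_right) (simp only: B_def)
    show "(K \<longlongrightarrow> K \<theta>) (at \<theta> within S)" by (intro tendsto_intros cont)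
    show "norm (a \<theta>) * norm (K t) \<le> 1 / 2" if "t \<in> S" for t by (rule small[OF \<theta> that])
  qed
  then have Bq: "((\<lambda>t. B t /\<^sub>R (t - \<theta>)) \<longlongrightarrow> Z) (at \<theta> within S)"
    by (simp only: has_vector_derivative_iff_quotient B\<theta> diff_0_right)
  have B0: "(B \<longlongrightarrow> 0) (at \<theta> within S)"
  proof -
    have "(B \<longlongrightarrow> P \<theta> * R \<theta>) (at \<theta> within S)" unfolding B_def by (intro tendsto_intros cont)
    then show ?thesis using B\<theta> by (simp only: B_def)
  qed
  have quad: "((\<lambda>t. (R \<theta> * P t * R \<theta>) /\<^sub>R (t - \<theta>)) \<longlongrightarrow> 0) (at \<theta> within S)"
  proof (rule Lim_null_comparison)
    let ?b = "\<lambda>t. (2 * \<alpha>)\<^sup>2 * (norm (Sg t - Sg \<theta>) * norm ((Sg t - Sg \<theta>) /\<^sub>R (t - \<theta>)))"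
    show "\<forall>\<^sub>F t in at \<theta> within S. norm ((R \<theta> * P t * R \<theta>) /\<^sub>R (t - \<theta>)) \<le> ?b t"
      unfolding eventually_at_filter
    proof (intro always_eventually allI impI)
      fix t assume t: "t \<noteq> \<theta>" "t \<in> S"
      have "norm (R \<theta> * P t * R \<theta>) = (norm (P t * R \<theta>))\<^sup>2"
        by (simp only: P_diff(2)[OF \<theta> t(2)] norm_adj_mult_self)
      also have "\<dots> \<le> (2 * \<alpha> * norm (Sg t - Sg \<theta>))\<^sup>2"
        by (intro power_mono norm_cross_le t \<theta>) simp
      finally have "norm (R \<theta> * P t * R \<theta>) / \<bar>t - \<theta>\<bar> \<le> (2 * \<alpha> * norm (Sg t - Sg \<theta>))\<^sup>2 / \<bar>t - \<theta>\<bar>"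
        by (intro divide_right_mono) auto
      also have "\<dots> = ?b t"
        by (simp add: power_mult_distrib power2_eq_square divide_inverse)
      finally show "norm ((R \<theta> * P t * R \<theta>) /\<^sub>R (t - \<theta>)) \<le> ?b t"
        by (simp add: divide_inverse mult.commute)
    qed
    have "(?b \<longlongrightarrow> (2 * \<alpha>)\<^sup>2 * (norm (Sg \<theta> - Sg \<theta>) * norm Sg1)) (at \<theta> within S)"
      by (intro tendsto_intros q cont)
    then show "(?b \<longlongrightarrow> 0) (at \<theta> within S)" by simp
  qed
  have "((\<lambda>t. - (B t /\<^sub>R (t - \<theta>)) - adj (B t /\<^sub>R (t - \<theta>)) + (B t /\<^sub>R (t - \<theta>)) * adj (B t)
      + (R \<theta> * P t * R \<theta>) /\<^sub>R (t - \<theta>)) \<longlongrightarrow> - Z - adj Z + Z * adj 0 + 0) (at \<theta> within S)"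
    by (intro tendsto_intros Bq B0 quad bounded_linear.tendsto[OF bounded_linear_adj])
  moreover have "\<forall>\<^sub>F t in at \<theta> within S. - (B t /\<^sub>R (t - \<theta>)) - adj (B t /\<^sub>R (t - \<theta>))
      + (B t /\<^sub>R (t - \<theta>)) * adj (B t) + (R \<theta> * P t * R \<theta>) /\<^sub>R (t - \<theta>) = (P t - P \<theta>) /\<^sub>R (t - \<theta>)"
    unfolding eventually_at_filter
  proof (intro always_eventually allI impI)
    fix t assume t: "t \<in> S"
    show "- (B t /\<^sub>R (t - \<theta>)) - adj (B t /\<^sub>R (t - \<theta>))
      + (B t /\<^sub>R (t - \<theta>)) * adj (B t) + (R \<theta> * P t * R \<theta>) /\<^sub>R (t - \<theta>) = (P t - P \<theta>) /\<^sub>R (t - \<theta>)"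
      by (subst P_diff(1)[OF \<theta> t])
        (simp only: B_def adj_simps(5) mult_scaleR_left scaleR_add_right scaleR_diff_right scaleR_minus_right)
  qed
  ultimately have "((\<lambda>t. (P t - P \<theta>) /\<^sub>R (t - \<theta>)) \<longlongrightarrow> - Z - adj Z + Z * adj 0 + 0) (at \<theta> within S)"
    by (rule Lim_transform_eventually)
  then show ?thesis unfolding has_vector_derivative_iff_quotient by blast
qed

text \<open>
  On the whole space \<open>a + R\<close> is the inverse of \<open>Sg P + R\<close>, and inversion is differentiable.
\<close>

lemma a_differentiable:
  assumes \<theta>: "\<theta> \<in> S" and Sg: "(Sg has_vector_derivative Sg1) (at \<theta> within S)"
    and P: "(P has_vector_derivative P1) (at \<theta> within S)"
  shows "\<exists>a1. (a has_vector_derivative a1) (at \<theta> within S)"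
proof -
  define c where "c t = a t + R t" for t
  define m where "m t = Sg t * P t + R t" for t
  have mc: "m t * c t = 1" and cm: "c t * m t = 1" if t: "t \<in> S" for t
  proof -
    have 0: "P t * R t = 0" "R t * P t = 0" "R t * a t = 0" "a t * R t = 0"
      using t by (simp_all add: right_diff_distrib left_diff_distrib P_idem P_a a_P)
    have "m t * c t = Sg t * (P t * a t) + Sg t * (P t * R t) + (R t * a t + R t * R t)"
      by (simp only: m_def c_def distrib_left distrib_right mult.assoc add_ac)
    also have "\<dots> = P t + 0 + (0 + R t)"
      using t by (simp only: 0 P_a Sg_a R_idem mult_zero_right)
    finally show "m t * c t = 1" by simp
    have "c t * m t = (a t * Sg t) * P t + a t * R t + (R t * Sg t * P t + R t * R t)"
      by (simp only: m_def c_def distrib_left distrib_right mult.assoc add_ac)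
    also have "R t * Sg t * P t = R t * P t * Sg t" using t by (simp only: commutes mult.assoc)
    also have "(a t * Sg t) * P t + a t * R t + (R t * P t * Sg t + R t * R t) = P t + 0 + (0 + R t)"
      using t by (simp only: 0 a_Sg P_idem R_idem mult_zero_left)
    finally show "c t * m t = 1" by simp
  qed
  have c_diff: "c t - c \<theta> = - (c t * (m t - m \<theta>) * c \<theta>)" if t: "t \<in> S" for t
  proof -
    have "c t * (m t - m \<theta>) * c \<theta> = (c t * m t) * c \<theta> - c t * (m \<theta> * c \<theta>)"
      by (simp only: left_diff_distrib right_diff_distrib mult.assoc)
    then show ?thesis by (simp only: mc cm t \<theta>) simp
  qed
  have c_le: "norm (c t) \<le> \<alpha> + 1" if t: "t \<in> S" for t
    unfolding c_def using norm_triangle_ineq[of "a t" "R t"] norm_a[OF t] norm_R[OF t] by linarith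
  have m: "(m has_vector_derivative (Sg \<theta> * P1 + Sg1 * P \<theta> + (0 - P1))) (at \<theta> within S)"
    unfolding m_def by (intro derivative_intros Sg P)
  then have mq: "((\<lambda>t. (m t - m \<theta>) /\<^sub>R (t - \<theta>)) \<longlongrightarrow> (Sg \<theta> * P1 + Sg1 * P \<theta> + (0 - P1))) (at \<theta> within S)"
    by (simp only: has_vector_derivative_iff_quotient)
  have m0: "(m \<longlongrightarrow> m \<theta>) (at \<theta> within S)"
    using has_vector_derivative_continuous[OF m] by (simp add: continuous_within)
  have c0: "(c \<longlongrightarrow> c \<theta>) (at \<theta> within S)"
  proof (rule LIM_zero_cancel, rule Lim_null_comparison)
    show "\<forall>\<^sub>F t in at \<theta> within S. norm (c t - c \<theta>) \<le> (\<alpha> + 1) * norm (m t - m \<theta>) * (\<alpha> + 1)"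
      unfolding eventually_at_filter
    proof (intro always_eventually allI impI)
      fix t assume t: "t \<in> S"
      have "norm (c t * (m t - m \<theta>) * c \<theta>) \<le> norm (c t) * norm (m t - m \<theta>) * norm (c \<theta>)"
        by (meson mult_right_mono norm_ge_zero norm_mult_ineq order_trans)
      also have "\<dots> \<le> (\<alpha> + 1) * norm (m t - m \<theta>) * (\<alpha> + 1)"
        using alpha_nonneg[OF t] by (intro mult_mono c_le t \<theta>) auto
      finally show "norm (c t - c \<theta>) \<le> (\<alpha> + 1) * norm (m t - m \<theta>) * (\<alpha> + 1)"
        by (simp only: c_diff[OF t] norm_minus_cancel)
    qed
    have "((\<lambda>t. (\<alpha> + 1) * norm (m t - m \<theta>) * (\<alpha> + 1)) \<longlongrightarrow> (\<alpha> + 1) * norm (m \<theta> - m \<theta>) * (\<alpha> + 1)) (at \<theta> within S)"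
      by (intro tendsto_intros m0)
    then show "((\<lambda>t. (\<alpha> + 1) * norm (m t - m \<theta>) * (\<alpha> + 1)) \<longlongrightarrow> 0) (at \<theta> within S)" by simp
  qed
  let ?m1 = "Sg \<theta> * P1 + Sg1 * P \<theta> + (0 - P1)"
  have "((\<lambda>t. - (c t * ((m t - m \<theta>) /\<^sub>R (t - \<theta>)) * c \<theta>)) \<longlongrightarrow> - (c \<theta> * ?m1 * c \<theta>)) (at \<theta> within S)"
    by (intro tendsto_intros c0 mq)
  moreover have "\<forall>\<^sub>F t in at \<theta> within S. - (c t * ((m t - m \<theta>) /\<^sub>R (t - \<theta>)) * c \<theta>) = (c t - c \<theta>) /\<^sub>R (t - \<theta>)"
    unfolding eventually_at_filter
    by (intro always_eventually allI impI) (simp add: c_diff)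
  ultimately have "((\<lambda>t. (c t - c \<theta>) /\<^sub>R (t - \<theta>)) \<longlongrightarrow> - (c \<theta> * ?m1 * c \<theta>)) (at \<theta> within S)"
    by (rule Lim_transform_eventually)
  then have "(c has_vector_derivative - (c \<theta> * ?m1 * c \<theta>)) (at \<theta> within S)"
    by (simp only: has_vector_derivative_iff_quotient)
  then have "((\<lambda>t. c t - R t) has_vector_derivative (- (c \<theta> * ?m1 * c \<theta>) - (0 - P1))) (at \<theta> within S)"
    by (intro derivative_intros P)
  moreover have "(\<lambda>t. c t - R t) = a" by (simp add: c_def fun_eq_iff)
  ultimately show ?thesis by metis
qed


text \<open>
  With the coefficient \<open>a\<close> frozen at \<open>\<theta>\<close>, the increments of \<open>X\<close> satisfy a fixed point equation whose
  inhomogeneity \<open>D\<close> collects the increments of \<open>Y\<close>, \<open>a\<close> and \<open>K\<close>.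
\<close>

lemma fixpoint_differentiable:
  assumes \<theta>: "\<theta> \<in> S" and X: "\<And>t. t \<in> S \<Longrightarrow> X t = Y t + a t * X t * K t"
    and Y: "(Y has_vector_derivative Y1) (at \<theta> within S)"
    and a: "(a has_vector_derivative a1) (at \<theta> within S)"
    and K: "(K has_vector_derivative K1) (at \<theta> within S)"
  shows "\<exists>X1. (X has_vector_derivative X1) (at \<theta> within S)"
proof -
  define D where "D t = (Y t - Y \<theta>) + (a t - a \<theta>) * X t * K t + a \<theta> * X \<theta> * (K t - K \<theta>)" for t
  have D: "X t - X \<theta> = D t + a \<theta> * (X t - X \<theta>) * K t" if "t \<in> S" for t
  proof -
    have "X t - X \<theta> = (Y t + a t * X t * K t) - (Y \<theta> + a \<theta> * X \<theta> * K \<theta>)"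
      using X[OF that] X[OF \<theta>] by presburger
    also have "\<dots> = D t + a \<theta> * (X t - X \<theta>) * K t"
      unfolding D_def by (simp only: left_diff_distrib[of _ _ "K _"] left_diff_distrib[of "a _"] right_diff_distrib[of "a _"]
          right_diff_distrib[of "_ * _" "K _"])
         simp
    finally show ?thesis .
  qed
  have cont: "(Y \<longlongrightarrow> Y \<theta>) (at \<theta> within S)" "(a \<longlongrightarrow> a \<theta>) (at \<theta> within S)" "(K \<longlongrightarrow> K \<theta>) (at \<theta> within S)"
    using has_vector_derivative_continuous[OF Y] has_vector_derivative_continuous[OF a]
      has_vector_derivative_continuous[OF K] by (simp_all add: continuous_within)
  have q: "((\<lambda>t. (Y t - Y \<theta>) /\<^sub>R (t - \<theta>)) \<longlongrightarrow> Y1) (at \<theta> within S)"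
    "((\<lambda>t. (a t - a \<theta>) /\<^sub>R (t - \<theta>)) \<longlongrightarrow> a1) (at \<theta> within S)"
    "((\<lambda>t. (K t - K \<theta>) /\<^sub>R (t - \<theta>)) \<longlongrightarrow> K1) (at \<theta> within S)"
    using Y a K by (simp_all only: has_vector_derivative_iff_quotient)
  have X0: "(X \<longlongrightarrow> X \<theta>) (at \<theta> within S)"
  proof (rule LIM_zero_cancel, rule Lim_null_comparison)
    let ?b = "\<lambda>t. 2 * (norm (Y t - Y \<theta>) + norm (a t - a \<theta>) * (2 * norm (Y t)) * norm (K t)
       + norm (a \<theta> * X \<theta>) * norm (K t - K \<theta>))"
    show "\<forall>\<^sub>F t in at \<theta> within S. norm (X t - X \<theta>) \<le> ?b t"
      unfolding eventually_at_filter
    proof (intro always_eventually allI impI)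
      fix t assume t: "t \<in> S"
      have "norm (X t - X \<theta>) \<le> 2 * norm (D t)" by (rule norm_fixpoint_le[OF D[OF t] small[OF \<theta> t]])
      also have "norm (D t) \<le> norm (Y t - Y \<theta>) + norm ((a t - a \<theta>) * X t * K t) + norm (a \<theta> * X \<theta> * (K t - K \<theta>))"
        unfolding D_def by (rule order_trans[OF norm_triangle_ineq add_right_mono[OF norm_triangle_ineq]])
      also have "norm ((a t - a \<theta>) * X t * K t) \<le> norm (a t - a \<theta>) * norm (X t) * norm (K t)"
        by (meson mult_right_mono norm_ge_zero norm_mult_ineq order_trans)
      also have "\<dots> \<le> norm (a t - a \<theta>) * (2 * norm (Y t)) * norm (K t)"
        by (intro mult_right_mono mult_left_mono norm_fixpoint_le[OF X[OF t] small[OF t t]]) auto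
      also have "norm (a \<theta> * X \<theta> * (K t - K \<theta>)) \<le> norm (a \<theta> * X \<theta>) * norm (K t - K \<theta>)"
        by (rule norm_mult_ineq)
      finally show "norm (X t - X \<theta>) \<le> ?b t" by simp
    qed
    have "(?b \<longlongrightarrow> 2 * (norm (Y \<theta> - Y \<theta>) + norm (a \<theta> - a \<theta>) * (2 * norm (Y \<theta>)) * norm (K \<theta>)
       + norm (a \<theta> * X \<theta>) * norm (K \<theta> - K \<theta>))) (at \<theta> within S)"
      by (intro tendsto_intros cont[unfolded right_diff_distrib] cont)
    then show "(?b \<longlongrightarrow> 0) (at \<theta> within S)" by simp
  qed
  have "((\<lambda>t. (Y t - Y \<theta>) /\<^sub>R (t - \<theta>) + ((a t - a \<theta>) /\<^sub>R (t - \<theta>)) * X t * K t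
      + a \<theta> * X \<theta> * ((K t - K \<theta>) /\<^sub>R (t - \<theta>))) \<longlongrightarrow> Y1 + a1 * X \<theta> * K \<theta> + a \<theta> * X \<theta> * K1) (at \<theta> within S)"
    by (rule tendsto_add[OF tendsto_add[OF q(1) tendsto_mult[OF tendsto_mult[OF q(2) X0] cont(3)]]
        tendsto_mult[OF tendsto_const q(3)]])
  then have lim: "((\<lambda>t. D t /\<^sub>R (t - \<theta>)) \<longlongrightarrow> Y1 + a1 * X \<theta> * K \<theta> + a \<theta> * X \<theta> * K1) (at \<theta> within S)"
    by (simp only: D_def scaleR_add_right mult_scaleR_left mult_scaleR_right)
  obtain Z where Z: "Z = Y1 + a1 * X \<theta> * K \<theta> + a \<theta> * X \<theta> * K1 + a \<theta> * Z * K \<theta>"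
    using solvable[OF \<theta>] by blast
  have "(X has_vector_derivative Z) (at \<theta> within S)"
    by (rule fixpoint_has_vector_derivative[where k = K and Z = Z, OF \<theta> D lim cont(3) small[OF \<theta>] Z])
  then show ?thesis ..
qed

text \<open>
  The first and the second derivative of \<open>Sg P = P Sg\<close> both have the form assumed here, with \<open>V\<close> the
  derivative of \<open>P\<close> of highest order.
\<close>

lemma off_diagonal_fixpoint:
  assumes t: "t \<in> S" and E: "Sg t * V + W = U + V * Sg t"
  shows "P t * V * R t = a t * (U - W) * R t + a t * (P t * V * R t) * K t"
proof -
  have "a t * (Sg t * V + W) * R t = a t * (U + V * Sg t) * R t" using E by simp
  then have "a t * Sg t * V * R t + a t * W * R t = a t * U * R t + a t * V * (Sg t * R t)"
    by (simp only: distrib_left distrib_right mult.assoc)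
  moreover have "a t * V * (Sg t * R t) = a t * (P t * V * R t) * K t"
  proof -
    have "a t * (P t * V * R t) * K t = (a t * P t) * V * (R t * Sg t * R t)" by (simp only: mult.assoc)
    then show ?thesis using t by (simp only: a_P R_Sg_R)
  qed
  ultimately show ?thesis using t by (simp only: a_Sg) (simp add: algebra_simps)
qed

lemma block_decomposition:
  assumes t: "t \<in> S" and V: "adj V = V"
  shows "V = P t * V * R t + adj (P t * V * R t) + P t * V * P t + R t * V * R t"
  using t by (simp add: algebra_simps V adj_P)

text \<open>
  By \<open>P P = P\<close> the derivative of \<open>P\<close> has no diagonal blocks, and the diagonal blocks of the second
  derivative are quadratic in the first.  The off-diagonal blocks satisfy fixed point equations, which
  give both their size and, for the first derivative, once more their differentiability.
\<close>

lemma eigenprojection_twice_differentiable: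
  assumes Sg1: "\<And>t. t \<in> S \<Longrightarrow> (Sg has_vector_derivative Sg1 t) (at t within S)"
    and Sg2: "\<And>t. t \<in> S \<Longrightarrow> (Sg1 has_vector_derivative Sg2 t) (at t within S)"
  shows "\<exists>P1 P2. \<forall>t\<in>S. (P has_vector_derivative P1 t) (at t within S) \<and>
     (P1 has_vector_derivative P2 t) (at t within S) \<and>
     norm (P1 t) \<le> 4 * norm (a t * Sg1 t * R t) \<and>
     norm (P2 t) \<le> 4 * norm (a t * (Sg2 t + 2 *\<^sub>R (P1 t * Sg1 t) - 2 *\<^sub>R (Sg1 t * P1 t)) * R t)
       + 4 * (norm (P1 t))\<^sup>2"
proof -
  have "\<forall>t\<in>S. \<exists>P1. (P has_vector_derivative P1) (at t within S)"
    using P_differentiable Sg1 by blast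
  then obtain P1 where P1: "\<And>t. t \<in> S \<Longrightarrow> (P has_vector_derivative P1 t) (at t within S)" by metis
  have unique: "f' = g'"
    if "t \<in> S" "(f has_vector_derivative f') (at t within S)" "(g has_vector_derivative g') (at t within S)"
      "\<And>s. s \<in> S \<Longrightarrow> f s = g s" for f g :: "real \<Rightarrow> fop" and f' g' t
    using vector_derivative_unique_within[OF limit_point[OF that(1)] that(2)]
      has_vector_derivative_transform[OF that(1) that(4) that(3)] by metis
  \<comment> \<open>Identities between functions on \<open>S\<close> are differentiated; \<open>unique\<close> compares the derivatives of both sides.\<close>
  have adj_P1: "adj (P1 t) = P1 t" if "t \<in> S" for t
    by (rule unique[OF that bounded_linear.has_vector_derivative[OF bounded_linear_adj P1[OF that]] P1[OF that]])
      (simp add: adj_P)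
  have E1: "P t * P1 t + P1 t * P t = P1 t" if "t \<in> S" for t
    by (rule unique[OF that has_vector_derivative_mult[OF P1[OF that] P1[OF that]] P1[OF that]])
      (simp add: P_idem)
  have E2: "Sg t * P1 t + Sg1 t * P t = P t * Sg1 t + P1 t * Sg t" if "t \<in> S" for t
    by (rule unique[OF that has_vector_derivative_mult[OF Sg1[OF that] P1[OF that]]
         has_vector_derivative_mult[OF P1[OF that] Sg1[OF that]]])
      (simp add: commutes)
  define X where "X t = P t * P1 t * R t" for t
  have aPR: "a t * (U * P t) * R t = 0" "a t * (P t * U) * R t = a t * U * R t" if "t \<in> S" for t U
  proof -
    have "a t * (U * P t) * R t = a t * U * (P t * R t)" by (simp only: mult.assoc)
    then show "a t * (U * P t) * R t = 0" using that by (simp add: right_diff_distrib P_idem)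
    show "a t * (P t * U) * R t = a t * U * R t" using that by (simp only: mult.assoc[symmetric] a_P)
  qed
  have X: "X t = a t * Sg1 t * R t + a t * X t * K t" if "t \<in> S" for t
  proof -
    have "X t = a t * (P t * Sg1 t - Sg1 t * P t) * R t + a t * X t * K t"
      unfolding X_def by (rule off_diagonal_fixpoint[OF that E2[OF that]])
    also have "a t * (P t * Sg1 t - Sg1 t * P t) * R t = a t * (P t * Sg1 t) * R t - a t * (Sg1 t * P t) * R t"
      by (simp only: left_diff_distrib[of "a t * _"] right_diff_distrib[of "a t"])
    finally show ?thesis using that by (simp only: aPR diff_0_right)
  qed
  have PP1P: "P t * P1 t * P t = 0" and RP1R: "R t * P1 t * R t = 0" if "t \<in> S" for t
  proof -
    have "P t * (P t * P1 t + P1 t * P t) * P t = P t * P1 t * P t" by (simp only: E1[OF that])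
    then show 1: "P t * P1 t * P t = 0"
      using that by (simp add: algebra_simps P_idem) (simp add: mult.assoc[symmetric] P_idem)
    have "P1 t = P t * P1 t + P1 t * P t" by (simp only: E1[OF that])
    with 1 show "R t * P1 t * R t = 0"
      by (simp add: algebra_simps)
  qed
  have P1X: "P1 t = X t + adj (X t)" if "t \<in> S" for t
    unfolding X_def using block_decomposition[OF that adj_P1[OF that]] that by (simp only: PP1P RP1R add_0_right)
  have norm_P1: "norm (P1 t) \<le> 4 * norm (a t * Sg1 t * R t)" if "t \<in> S" for t
    using norm_fixpoint_le[OF X[OF that] small[OF that that]] norm_triangle_ineq[of "X t" "adj (X t)"] P1X[OF that]
    by simp
  have "\<exists>P2. (P1 has_vector_derivative P2) (at t within S)" if t: "t \<in> S" for t
  proof -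
    obtain a1 where a1: "(a has_vector_derivative a1) (at t within S)"
      using a_differentiable[OF t Sg1[OF t] P1[OF t]] by blast
    have R1: "(R has_vector_derivative (0 - P1 t)) (at t within S)"
      by (intro derivative_intros P1 t)
    have Y: "((\<lambda>t. a t * Sg1 t * R t) has_vector_derivative
        (a t * Sg1 t * (0 - P1 t) + (a t * Sg2 t + a1 * Sg1 t) * R t)) (at t within S)"
      by (rule has_vector_derivative_mult[OF has_vector_derivative_mult[OF a1 Sg2[OF t]] R1])
    obtain X1 where X1: "(X has_vector_derivative X1) (at t within S)"
      using fixpoint_differentiable[OF t X Y a1 has_vector_derivative_mult[OF Sg1[OF t] R1]] by blast
    have "((\<lambda>t. X t + adj (X t)) has_vector_derivative (X1 + adj X1)) (at t within S)"
      by (rule has_vector_derivative_add[OF X1 bounded_linear.has_vector_derivative[OF bounded_linear_adj X1]])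
    from has_vector_derivative_transform[OF t P1X this] show ?thesis by blast
  qed
  then obtain P2 where P2: "\<And>t. t \<in> S \<Longrightarrow> (P1 has_vector_derivative P2 t) (at t within S)" by metis
  have norm_P2: "norm (P2 t) \<le> 4 * norm (a t * (Sg2 t + 2 *\<^sub>R (P1 t * Sg1 t) - 2 *\<^sub>R (Sg1 t * P1 t)) * R t)
       + 4 * (norm (P1 t))\<^sup>2" if t: "t \<in> S" for t
  proof -
    have adj_P2: "adj (P2 t) = P2 t"
      by (rule unique[OF t bounded_linear.has_vector_derivative[OF bounded_linear_adj P2[OF t]] P2[OF t]])
        (simp add: adj_P1)
    have F1: "(P t * P2 t + P1 t * P1 t) + (P1 t * P1 t + P2 t * P t) = P2 t"
      by (rule unique[OF t has_vector_derivative_add[OF has_vector_derivative_mult[OF P1[OF t] P2[OF t]]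
          has_vector_derivative_mult[OF P2[OF t] P1[OF t]]] P2[OF t]]) (simp add: E1)
    have F2: "(Sg t * P2 t + Sg1 t * P1 t) + (Sg1 t * P1 t + Sg2 t * P t)
        = (P t * Sg2 t + P1 t * Sg1 t) + (P1 t * Sg1 t + P2 t * Sg t)"
      by (rule unique[OF t has_vector_derivative_add[OF has_vector_derivative_mult[OF Sg1[OF t] P2[OF t]]
          has_vector_derivative_mult[OF Sg2[OF t] P1[OF t]]]
          has_vector_derivative_add[OF has_vector_derivative_mult[OF P1[OF t] Sg2[OF t]]
          has_vector_derivative_mult[OF P2[OF t] Sg1[OF t]]]]) (simp add: E2)
    define X2 where "X2 = P t * P2 t * R t"
    let ?U = "P t * Sg2 t + 2 *\<^sub>R (P1 t * Sg1 t)" and ?W = "2 *\<^sub>R (Sg1 t * P1 t) + Sg2 t * P t"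
    have "Sg t * P2 t + ?W = ?U + P2 t * Sg t"
      using F2 by (simp add: scaleR_2 algebra_simps)
    from off_diagonal_fixpoint[OF t this]
    have "X2 = a t * (?U - ?W) * R t + a t * X2 * K t" unfolding X2_def .
    also have "?U - ?W = (P t * Sg2 t + (2 *\<^sub>R (P1 t * Sg1 t) - 2 *\<^sub>R (Sg1 t * P1 t))) - Sg2 t * P t"
      by simp
    also have "a t * \<dots> * R t = a t * (P t * Sg2 t) * R t
        + a t * (2 *\<^sub>R (P1 t * Sg1 t) - 2 *\<^sub>R (Sg1 t * P1 t)) * R t - a t * (Sg2 t * P t) * R t"
      by (simp only: left_diff_distrib[of "_" "a t * _"] right_diff_distrib[of "a t" _ "Sg2 t * P t"]
          distrib_left[of "a t"] distrib_right)
    also have "\<dots> = a t * (Sg2 t + 2 *\<^sub>R (P1 t * Sg1 t) - 2 *\<^sub>R (Sg1 t * P1 t)) * R t"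
      using t by (simp only: aPR diff_0_right) (simp only: distrib_left[symmetric] distrib_right[symmetric] add_diff_eq)
    finally have "X2 = a t * (Sg2 t + 2 *\<^sub>R (P1 t * Sg1 t) - 2 *\<^sub>R (Sg1 t * P1 t)) * R t + a t * X2 * K t" .
    note X2 = norm_fixpoint_le[OF this small[OF t t]]
    have 1: "P t * P2 t * P t = - 2 *\<^sub>R (P t * (P1 t * P1 t) * P t)"
    proof -
      have "P t * ((P t * P2 t + P1 t * P1 t) + (P1 t * P1 t + P2 t * P t)) * P t = P t * P2 t * P t"
        by (simp only: F1)
      moreover have "P t * ((P t * P2 t + P1 t * P1 t) + (P1 t * P1 t + P2 t * P t)) * P t
         = (P t * P t) * P2 t * P t + 2 *\<^sub>R (P t * (P1 t * P1 t) * P t) + P t * P2 t * (P t * P t)"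
        by (simp add: scaleR_2 distrib_left distrib_right mult.assoc)
      ultimately show ?thesis using t by (simp only: P_idem) (simp add: eq_neg_iff_add_eq_0)
    qed
    have 2: "R t * P2 t * R t = 2 *\<^sub>R (R t * (P1 t * P1 t) * R t)"
    proof -
      have "R t * P2 t * R t = R t * ((P t * P2 t + P1 t * P1 t) + (P1 t * P1 t + P2 t * P t)) * R t"
        by (simp only: F1)
      also have "\<dots> = (R t * P t) * P2 t * R t + 2 *\<^sub>R (R t * (P1 t * P1 t) * R t) + R t * P2 t * (P t * R t)"
        by (simp only: scaleR_2 distrib_left distrib_right mult.assoc add_ac)
      also have "R t * P t = 0" using t by (simp add: left_diff_distrib P_idem)
      also have "P t * R t = 0" using t by (simp add: right_diff_distrib P_idem)
      finally show ?thesis by simp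
    qed
    have sandwich: "norm (Q * (P1 t * P1 t) * Q) \<le> (norm (P1 t))\<^sup>2" if "norm Q \<le> 1" for Q
    proof -
      have "norm (Q * (P1 t * P1 t) * Q) \<le> norm Q * norm (P1 t * P1 t) * norm Q"
        by (meson mult_right_mono norm_ge_zero norm_mult_ineq order_trans)
      also have "\<dots> \<le> 1 * (norm (P1 t) * norm (P1 t)) * 1"
        by (intro mult_mono that norm_mult_ineq) auto
      finally show ?thesis by (simp add: power2_eq_square)
    qed
    have "P2 t = X2 + adj X2 + P t * P2 t * P t + R t * P2 t * R t"
      unfolding X2_def by (rule block_decomposition[OF t adj_P2])
    then have "norm (P2 t) = norm (X2 + adj X2 + P t * P2 t * P t + R t * P2 t * R t)" by (rule arg_cong)
    also have "\<dots> \<le> norm X2 + norm (adj X2) + norm (P t * P2 t * P t) + norm (R t * P2 t * R t)"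
      by (rule order_trans[OF norm_triangle_ineq add_right_mono[OF order_trans[OF norm_triangle_ineq
            add_right_mono[OF norm_triangle_ineq]]]])
    also have "norm (P t * P2 t * P t) \<le> 2 * (norm (P1 t))\<^sup>2"
      using sandwich[OF norm_P[OF t]] by (simp only: 1) simp
    also have "norm (R t * P2 t * R t) \<le> 2 * (norm (P1 t))\<^sup>2"
      using sandwich[OF norm_R[OF t]] by (simp only: 2) simp
    finally show ?thesis using X2 by simp
  qed
  show ?thesis using P1 P2 norm_P1 norm_P2 by blast
qed

end

section \<open>Spectral sums\<close>

lemma unit_op_mult: "unit_op j k z * unit_op k' l w = (if k = k' then unit_op j l (z * w) else 0)"
  by (intro fop_eqI fseq_eqI) (auto simp: fapp_unit_op)

definition diag_op :: "nat \<Rightarrow> (nat \<Rightarrow> real) \<Rightarrow> fop" where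
  "diag_op n c = (\<Sum>j<n. unit_op j j (complex_of_real (c j)))"

definition orthogonal_projections :: "nat \<Rightarrow> (nat \<Rightarrow> fop) \<Rightarrow> bool" where
  "orthogonal_projections n E \<longleftrightarrow> (\<forall>j<n. adj (E j) = E j) \<and>
     (\<forall>j<n. \<forall>k<n. E j * E k = (if j = k then E j else 0))"

text \<open>
  Functions of a Hermitian matrix with eigenprojections \<open>E\<close>: the matrix, its leading projection, the
  partial inverse \<open>a\<close> and the remainder \<open>K\<close> are all of this form, and their products are computed
  pointwise.
\<close>

definition spectral_sum :: "nat \<Rightarrow> (nat \<Rightarrow> fop) \<Rightarrow> (nat \<Rightarrow> real) \<Rightarrow> fop" where
  "spectral_sum n E c = (\<Sum>j<n. c j *\<^sub>R E j)"

context
  fixes n E assumes E: "orthogonal_projections n E"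
begin

lemma spectral_sum_mult: "spectral_sum n E c * spectral_sum n E d = spectral_sum n E (\<lambda>j. c j * d j)"
proof -
  have "spectral_sum n E c * spectral_sum n E d = (\<Sum>j<n. \<Sum>k<n. (c j * d k) *\<^sub>R (E j * E k))"
    by (simp add: spectral_sum_def sum_product mult.commute)
  also have "\<dots> = (\<Sum>j<n. \<Sum>k<n. if k = j then (c j * d j) *\<^sub>R E j else 0)"
    using E by (intro sum.cong) (auto simp: orthogonal_projections_def)
  finally show ?thesis by (simp add: spectral_sum_def)
qed

lemma adj_spectral_sum: "adj (spectral_sum n E c) = spectral_sum n E c"
  using E by (simp add: spectral_sum_def adj_sum orthogonal_projections_def)

lemma inner_spectral_sum: "inner (fapp (spectral_sum n E c) x) x = (\<Sum>j<n. c j * (norm (fapp (E j) x))\<^sup>2)"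
proof -
  have "inner (fapp (E j) x) x = (norm (fapp (E j) x))\<^sup>2" if "j < n" for j
  proof -
    have "fapp (E j) x = fapp (E j) (fapp (E j) x)" using E that
      by (metis fapp_simps(7) orthogonal_projections_def)
    then have "inner (fapp (E j) x) x = inner (fapp (E j) (fapp (E j) x)) x" by simp
    also have "\<dots> = inner (fapp (E j) x) (fapp (adj (E j)) x)" by (rule inner_adj)
    finally show ?thesis using E that by (simp add: orthogonal_projections_def power2_norm_eq_inner)
  qed
  then show ?thesis by (simp add: spectral_sum_def inner_sum_left)
qed

lemma norm_spectral_sum_le:
  assumes c: "\<And>j. j < n \<Longrightarrow> \<bar>c j\<bar> \<le> M" and M: "0 \<le> M"
  shows "norm (spectral_sum n E c) \<le> M"
proof (rule norm_fop_bound[OF M])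
  fix x
  have bessel: "(\<Sum>j<n. (norm (fapp (E j) x))\<^sup>2) \<le> (norm x)\<^sup>2"
  proof -
    let ?F = "spectral_sum n E (\<lambda>_. 1)"
    have "norm ?F \<le> 1" by (rule norm_selfadjoint_projection) (simp_all add: spectral_sum_mult adj_spectral_sum)
    have "(\<Sum>j<n. (norm (fapp (E j) x))\<^sup>2) = inner (fapp ?F x) x" by (simp add: inner_spectral_sum)
    also have "\<dots> \<le> norm (fapp ?F x) * norm x" by (rule norm_cauchy_schwarz)
    also have "\<dots> \<le> norm ?F * norm x * norm x" by (intro mult_right_mono norm_fapp) auto
    also have "\<dots> \<le> 1 * norm x * norm x" by (intro mult_right_mono \<open>norm ?F \<le> 1\<close>) auto
    finally show ?thesis by (simp add: power2_eq_square)
  qed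
  have "(norm (fapp (spectral_sum n E c) x))\<^sup>2 = inner x (fapp (adj (spectral_sum n E c)) (fapp (spectral_sum n E c) x))"
    by (simp only: power2_norm_eq_inner inner_adj)
  also have "\<dots> = inner (fapp (spectral_sum n E c * spectral_sum n E c) x) x"
    by (simp add: adj_spectral_sum inner_commute)
  also have "\<dots> = (\<Sum>j<n. (c j)\<^sup>2 * (norm (fapp (E j) x))\<^sup>2)"
    by (simp only: spectral_sum_mult inner_spectral_sum power2_eq_square[of "c _"])
  also have "\<dots> \<le> (\<Sum>j<n. M\<^sup>2 * (norm (fapp (E j) x))\<^sup>2)"
    using c M by (intro sum_mono mult_right_mono) (auto simp: abs_le_square_iff[symmetric])
  also have "\<dots> \<le> M\<^sup>2 * (norm x)\<^sup>2"
    using bessel by (simp add: sum_distrib_left[symmetric] mult_left_mono)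
  finally have "(norm (fapp (spectral_sum n E c) x))\<^sup>2 \<le> (M * norm x)\<^sup>2" by (simp add: power_mult_distrib)
  then show "norm (fapp (spectral_sum n E c) x) \<le> M * norm x"
    using M by (rule_tac power2_le_imp_le) auto
qed

text \<open>
  In the eigenbasis the equation decouples: the \<open>(j, k)\<close> component of \<open>Z\<close> is that of \<open>C\<close> divided by
  \<open>1 - c j * d k\<close>.  The sum below adds only the difference, because \<open>C\<close> need not be supported on the
  first \<open>n\<close> coordinates.
\<close>

lemma spectral_sum_sylvester_solvable:
  assumes "\<And>j k. j < n \<Longrightarrow> k < n \<Longrightarrow> c j * d k \<noteq> 1"
  shows "\<exists>Z. Z = C + spectral_sum n E c * Z * spectral_sum n E d"
proof -
  define w where "w j k = c j * d k / (1 - c j * d k)" for j k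
  have w: "w j k = c j * d k + c j * d k * w j k" if "j < n" "k < n" for j k
    using assms[OF that] by (simp add: w_def field_simps)
  define Z where "Z = C + (\<Sum>j<n. \<Sum>k<n. w j k *\<^sub>R (E j * C * E k))"
  have cE: "spectral_sum n E c * E j = c j *\<^sub>R E j" if "j < n" for j
  proof -
    have "spectral_sum n E c * E j = (\<Sum>i<n. if i = j then c j *\<^sub>R E j else 0)"
      unfolding spectral_sum_def sum_distrib_right
      using E that by (intro sum.cong) (auto simp: orthogonal_projections_def)
    then show ?thesis using that by simp
  qed
  have Ed: "E k * spectral_sum n E d = d k *\<^sub>R E k" if "k < n" for k
  proof -
    have "E k * spectral_sum n E d = (\<Sum>i<n. if i = k then d k *\<^sub>R E k else 0)"
      unfolding spectral_sum_def sum_distrib_left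
      using E that by (intro sum.cong) (auto simp: orthogonal_projections_def)
    then show ?thesis using that by simp
  qed
  have 1: "spectral_sum n E c * C * spectral_sum n E d = (\<Sum>j<n. \<Sum>k<n. (c j * d k) *\<^sub>R (E j * C * E k))"
    by (simp add: spectral_sum_def sum_distrib_left sum_distrib_right scaleR_sum_right) (subst sum.swap, simp add: mult.commute)
  have 2: "spectral_sum n E c * (E j * C * E k) * spectral_sum n E d = (c j * d k) *\<^sub>R (E j * C * E k)"
    if "j < n" "k < n" for j k
  proof -
    have "spectral_sum n E c * (E j * C * E k) * spectral_sum n E d
        = (spectral_sum n E c * E j) * C * (E k * spectral_sum n E d)" by (simp only: mult.assoc)
    then show ?thesis by (simp add: cE Ed that mult.commute)
  qed
  have "spectral_sum n E c * Z * spectral_sum n E d = spectral_sum n E c * C * spectral_sum n E d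
      + (\<Sum>j<n. \<Sum>k<n. w j k *\<^sub>R (spectral_sum n E c * (E j * C * E k) * spectral_sum n E d))"
    by (simp add: Z_def distrib_left distrib_right sum_distrib_left sum_distrib_right)
  also have "\<dots> = (\<Sum>j<n. \<Sum>k<n. (c j * d k + c j * d k * w j k) *\<^sub>R (E j * C * E k))"
    unfolding 1 sum.distrib[symmetric]
    by (intro sum.cong refl) (simp add: 2 scaleR_add_left mult.commute)
  also have "\<dots> = (\<Sum>j<n. \<Sum>k<n. w j k *\<^sub>R (E j * C * E k))"
    by (intro sum.cong refl) (simp add: w[symmetric])
  finally have "Z = C + spectral_sum n E c * Z * spectral_sum n E d" by (simp add: Z_def)
  then show ?thesis ..
qed

end

lemma orthogonal_projections_unit_op: "orthogonal_projections n (\<lambda>j. unit_op j j 1)"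
  by (simp add: orthogonal_projections_def adj_unit_op unit_op_mult)

lemma diag_op_eq_spectral_sum: "diag_op n c = spectral_sum n (\<lambda>j. unit_op j j 1) c"
proof -
  have "unit_op j j (complex_of_real r) = r *\<^sub>R unit_op j j 1" for j r
    using linear_scale[OF bounded_linear.linear[OF bounded_linear_unit_op], of j j r 1]
    by (simp add: scaleR_conv_of_real[where 'a = complex])
  then show ?thesis by (simp add: diag_op_def spectral_sum_def)
qed

lemmas diag_op_mult = spectral_sum_mult[OF orthogonal_projections_unit_op, folded diag_op_eq_spectral_sum]
lemmas adj_diag_op = adj_spectral_sum[OF orthogonal_projections_unit_op, folded diag_op_eq_spectral_sum]
lemmas norm_diag_op_le = norm_spectral_sum_le[OF orthogonal_projections_unit_op, folded diag_op_eq_spectral_sum]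

lemma diag_op_cong: "(\<And>j. j < n \<Longrightarrow> c j = d j) \<Longrightarrow> diag_op n c = diag_op n d"
  unfolding diag_op_def by (intro sum.cong) auto

lemma coord_diag_op: "coord (fapp (diag_op n c) x) i = (if i < n then complex_of_real (c i) * coord x i else 0)"
proof -
  have "coord (fapp (diag_op n c) x) i = (\<Sum>j<n. if i = j then complex_of_real (c j) * coord x j else 0)"
    unfolding diag_op_def fapp_sum_left coord_sum fapp_unit_op coord_fsingle by simp
  then show ?thesis by (simp add: sum.delta')
qed

lemma mat_op_diag: "mat_op (mat_diag n (\<lambda>l. complex_of_real (c l))) = diag_op n c"
proof (rule mat_op_eqI)
  fix x i assume "i < dim_row (mat_diag n (\<lambda>l. complex_of_real (c l)))"
  then have i: "i < n" by (simp add: mat_diag_def)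
  have "(\<Sum>k<n. mat_diag n (\<lambda>l. complex_of_real (c l)) $$ (i, k) * coord x k)
      = (\<Sum>k<n. if k = i then complex_of_real (c i) * coord x i else 0)"
    using i by (intro sum.cong) (auto simp: mat_diag_def)
  then show "coord (fapp (diag_op n c) x) i =
      (\<Sum>k<dim_col (mat_diag n (\<lambda>l. complex_of_real (c l))). mat_diag n (\<lambda>l. complex_of_real (c l)) $$ (i, k) * coord x k)"
    using i by (simp add: coord_diag_op) (simp add: mat_diag_def)
qed (simp add: coord_diag_op mat_diag_def)

lemma diag_op_one_eq:
  assumes "\<And>i. i \<ge> n \<Longrightarrow> coord x i = 0" shows "fapp (diag_op n (\<lambda>_. 1)) x = x"
  using assms by (intro fseq_eqI) (simp add: coord_diag_op)

lemma inner_diag_op_ge: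
  assumes c: "\<And>j. j < n \<Longrightarrow> m \<le> c j" and x: "\<And>i. i \<ge> n \<Longrightarrow> coord x i = 0"
  shows "m * (norm x)\<^sup>2 \<le> inner (fapp (diag_op n c) x) x"
proof -
  have "fapp (diag_op n (\<lambda>_. 1)) x = x" by (rule diag_op_one_eq) (rule x)
  then have "(norm x)\<^sup>2 = inner (fapp (diag_op n (\<lambda>_. 1)) x) x" by (simp add: power2_norm_eq_inner)
  also have "\<dots> = (\<Sum>j<n. 1 * (norm (fapp (unit_op j j 1) x))\<^sup>2)"
    unfolding diag_op_eq_spectral_sum by (rule inner_spectral_sum[OF orthogonal_projections_unit_op])
  finally have "m * (norm x)\<^sup>2 = (\<Sum>j<n. m * (norm (fapp (unit_op j j 1) x))\<^sup>2)"
    by (simp add: sum_distrib_left)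
  also have "\<dots> \<le> (\<Sum>j<n. c j * (norm (fapp (unit_op j j 1) x))\<^sup>2)"
    by (intro sum_mono mult_right_mono c) auto
  also have "\<dots> = inner (fapp (diag_op n c) x) x"
    unfolding diag_op_eq_spectral_sum by (rule inner_spectral_sum[OF orthogonal_projections_unit_op, symmetric])
  finally show ?thesis .
qed

section \<open>Eigensystems\<close>

definition eigen_mat :: "nat \<Rightarrow> (nat \<Rightarrow> complex Matrix.vec) \<Rightarrow> complex mat" where
  "eigen_mat n p = Matrix.mat n n (\<lambda>(j, k). vec_index (p j) k)"

text \<open>
  The projection onto the conjugate of \<open>p j\<close>: a row eigenvector \<open>p j\<close> of a Hermitian matrix corresponds
  to the column eigenvector \<open>cnj (p j)\<close>.
\<close>

definition eigen_op :: "nat \<Rightarrow> (nat \<Rightarrow> complex Matrix.vec) \<Rightarrow> nat \<Rightarrow> fop" where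
  "eigen_op n p j = adj (mat_op (eigen_mat n p)) * unit_op j j 1 * mat_op (eigen_mat n p)"

lemma eigen_mat_carrier: "eigen_mat n p \<in> carrier_mat n n" by (simp add: eigen_mat_def)

lemma diag_op_unit_op: "j < n \<Longrightarrow> diag_op n c * unit_op j k z = unit_op j k (complex_of_real (c j) * z)"
  by (intro fop_eqI fseq_eqI) (auto simp: coord_diag_op fapp_unit_op)

lemma diag_op_one_mat_op: "B \<in> carrier_mat n m \<Longrightarrow> diag_op n (\<lambda>_. 1) * mat_op B = mat_op B"
  by (intro fop_eqI, simp, rule diag_op_one_eq) (auto simp: coord_mat_op)

context
  fixes n A lam p
  assumes sys: "row_eigensystem n A lam p" and A: "A \<in> carrier_mat n n"
begin

lemma dim_p: "j < n \<Longrightarrow> dim_vec (p j) = n" using sys by (auto simp: row_eigensystem_def)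

lemma eigen_mat_unitary:
  "mat_op (eigen_mat n p) * adj (mat_op (eigen_mat n p)) = diag_op n (\<lambda>_. 1)"
  "adj (mat_op (eigen_mat n p)) * mat_op (eigen_mat n p) = diag_op n (\<lambda>_. 1)"
proof -
  let ?U = "eigen_mat n p"
  have U: "?U \<in> carrier_mat n n" "mat_adjoint ?U \<in> carrier_mat n n"
    by (rule carrier_matI; simp add: eigen_mat_def)+
  have 1: "?U * mat_adjoint ?U = 1\<^sub>m n"
  proof (rule eq_matI)
    fix j k assume "j < dim_row (1\<^sub>m n :: complex mat)" "k < dim_col (1\<^sub>m n :: complex mat)"
    then have jk: "j < n" "k < n" by auto
    have "(?U * mat_adjoint ?U) $$ (j, k) = (\<Sum>i<n. ?U $$ (j, i) * mat_adjoint ?U $$ (i, k))"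
      using U jk by (auto simp: scalar_prod_def atLeast0LessThan intro!: sum.cong)
    also have "\<dots> = (\<Sum>i<n. vec_index (p j) i * cnj (vec_index (p k) i))"
      using U jk by (intro sum.cong) (auto simp: index_mat_adjoint eigen_mat_def)
    also have "\<dots> = p j \<bullet>c p k" using jk by (simp add: scalar_prod_def atLeast0LessThan dim_p)
    finally show "(?U * mat_adjoint ?U) $$ (j, k) = (1\<^sub>m n :: complex mat) $$ (j, k)"
      using sys jk by (simp add: row_eigensystem_def)
  qed (use U in auto)
  have 2: "mat_adjoint ?U * ?U = 1\<^sub>m n"
    using mat_mult_left_right_inverse[OF U 1] .
  have one: "mat_op (1\<^sub>m n) = diag_op n (\<lambda>_. 1)"
    using mat_op_diag[of n "\<lambda>_. 1"] by (simp add: mat_diag_def one_mat_def)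
  show "mat_op ?U * adj (mat_op ?U) = diag_op n (\<lambda>_. 1)"
    using arg_cong[OF 1, of mat_op] by (simp add: mat_op_mult[OF U(1,2)] mat_op_adjoint one)
  show "adj (mat_op ?U) * mat_op ?U = diag_op n (\<lambda>_. 1)"
    using arg_cong[OF 2, of mat_op] by (simp add: mat_op_mult[OF U(2,1)] mat_op_adjoint one)
qed

lemma eigen_op_projections: "orthogonal_projections n (eigen_op n p)"
  unfolding orthogonal_projections_def
proof (intro conjI allI impI)
  show "adj (eigen_op n p j) = eigen_op n p j" for j
    by (simp add: eigen_op_def adj_unit_op mult.assoc)
  fix j k assume jk: "j < n" "k < n"
  let ?u = "mat_op (eigen_mat n p)"
  have "eigen_op n p j * eigen_op n p k = adj ?u * (unit_op j j 1 * (?u * adj ?u * unit_op k k 1)) * ?u"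
    by (simp only: eigen_op_def mult.assoc)
  also have "unit_op j j 1 * (?u * adj ?u * unit_op k k 1) = (if j = k then unit_op j j 1 else 0)"
    using jk by (simp add: eigen_mat_unitary diag_op_unit_op unit_op_mult)
  finally show "eigen_op n p j * eigen_op n p k = (if j = k then eigen_op n p j else 0)"
    by (simp add: eigen_op_def)
qed

lemma spectral_sum_eigen_op:
  "spectral_sum n (eigen_op n p) c = adj (mat_op (eigen_mat n p)) * diag_op n c * mat_op (eigen_mat n p)"
  by (simp add: spectral_sum_def eigen_op_def diag_op_eq_spectral_sum sum_distrib_left sum_distrib_right)

lemma eigen_op_complete: "spectral_sum n (eigen_op n p) (\<lambda>_. 1) = diag_op n (\<lambda>_. 1)"
  unfolding spectral_sum_eigen_op
  by (simp add: mult.assoc diag_op_one_mat_op[OF eigen_mat_carrier] eigen_mat_unitary)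

lemma eigen_decomposition: "mat_op A = spectral_sum n (eigen_op n p) lam"
proof -
  let ?U = "eigen_mat n p"
  have U: "?U \<in> carrier_mat n n" by (rule eigen_mat_carrier)
  have "?U * A = mat_diag n (\<lambda>l. complex_of_real (lam l)) * ?U"
  proof (rule eq_matI)
    fix j k assume "j < dim_row (mat_diag n (\<lambda>l. complex_of_real (lam l)) * ?U)"
      "k < dim_col (mat_diag n (\<lambda>l. complex_of_real (lam l)) * ?U)"
    then have jk: "j < n" "k < n" using U by (auto simp: mat_diag_def)
    have pA: "mat_of_row (p j) * A = complex_of_real (lam j) \<cdot>\<^sub>m mat_of_row (p j)"
      using sys jk by (simp add: row_eigensystem_def)
    have "(mat_of_row (p j) * A) $$ (0, k) = (\<Sum>i<n. vec_index (p j) i * A $$ (i, k))"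
      using A jk by (simp add: scalar_prod_def atLeast0LessThan mat_of_row_def dim_p)
    moreover have "(?U * A) $$ (j, k) = (\<Sum>i<n. vec_index (p j) i * A $$ (i, k))"
      using A U jk by (simp add: scalar_prod_def atLeast0LessThan) (simp add: eigen_mat_def)
    moreover have "(complex_of_real (lam j) \<cdot>\<^sub>m mat_of_row (p j)) $$ (0, k) = complex_of_real (lam j) * vec_index (p j) k"
      using jk by (simp add: mat_of_row_def dim_p)
    moreover have "(mat_diag n (\<lambda>l. complex_of_real (lam l)) * ?U) $$ (j, k) = complex_of_real (lam j) * ?U $$ (j, k)"
      using U jk by (simp add: mat_diag_mult_left[OF U])
    ultimately show "(?U * A) $$ (j, k) = (mat_diag n (\<lambda>l. complex_of_real (lam l)) * ?U) $$ (j, k)"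
      using pA jk by (simp add: eigen_mat_def)
  qed (use A U in \<open>auto simp: mat_diag_def\<close>)
  from arg_cong[OF this, of mat_op]
  have "mat_op ?U * mat_op A = diag_op n lam * mat_op ?U"
    by (simp add: mat_op_mult[OF U A] mat_op_mult[OF mat_diag_dim U] mat_op_diag)
  then have "adj (mat_op ?U) * mat_op ?U * mat_op A = adj (mat_op ?U) * diag_op n lam * mat_op ?U"
    by (simp add: mult.assoc)
  then show ?thesis by (simp add: eigen_mat_unitary diag_op_one_mat_op[OF A] spectral_sum_eigen_op)
qed

lemma entry_eigen_op:
  assumes "j < n" "i < n" "k < n"
  shows "entry i k (eigen_op n p j) = cnj (vec_index (p j) i) * vec_index (p j) k"
proof -
  let ?U = "eigen_mat n p"
  have 1: "coord (fapp (mat_op ?U) (fsingle k 1)) j = ?U $$ (j, k)"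
    using entry_mat_op[of j ?U k] assms by (simp add: entry_def eigen_mat_def)
  have "entry i k (eigen_op n p j) = coord (fapp (mat_op (mat_adjoint ?U)) (fsingle j (?U $$ (j, k)))) i"
    by (simp add: entry_def eigen_op_def mat_op_adjoint fapp_unit_op 1)
  also have "\<dots> = mat_adjoint ?U $$ (i, j) * ?U $$ (j, k)"
    using assms by (simp add: coord_mat_op eigen_mat_def if_distrib[of "(*) _"] cong: if_cong)
  finally show ?thesis using assms by (simp add: index_mat_adjoint eigen_mat_def)
qed

lemma fapp_eigen_op_eq_0:
  assumes "coord (fapp (mat_op (eigen_mat n p)) x) j = 0" shows "fapp (eigen_op n p j) x = 0"
proof -
  have "fapp (unit_op j j 1) (fapp (mat_op (eigen_mat n p)) x) = 0"
    by (intro fseq_eqI) (simp add: fapp_unit_op assms)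
  then show ?thesis by (simp add: eigen_op_def)
qed

end

section \<open>Bounds on the eigenvalues of a factor model\<close>

text \<open>
  A Hermitian matrix \<open>A = G diag(\<phi>) G\<^sup>* + X\<close> with \<open>\<phi> \<ge> m\<close> and \<open>X\<close> of norm at most \<open>\<kappa>\<close>, together with an
  orthonormal eigenbasis in decreasing order.
\<close>

locale factor_eigensystem =
  fixes n q :: nat and A G :: "complex mat" and lam :: "nat \<Rightarrow> real" and p :: "nat \<Rightarrow> complex Matrix.vec"
    and \<phi> :: "nat \<Rightarrow> real" and X :: fop and \<kappa> m :: real
  assumes sys: "row_eigensystem n A lam p" and A: "A \<in> carrier_mat n n" and G: "G \<in> carrier_mat n q"
    and q: "1 \<le> q" "q < n"
    and decomposition: "mat_op A = mat_op G * diag_op q \<phi> * adj (mat_op G) + X"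
    and X: "norm X \<le> \<kappa>" and \<phi>: "\<And>l. l < q \<Longrightarrow> m \<le> \<phi> l" and m: "0 \<le> m"
begin

abbreviation "E \<equiv> eigen_op n p"
abbreviation "g \<equiv> mat_op G"

lemma lam_antimono: "j \<le> k \<Longrightarrow> k < n \<Longrightarrow> lam k \<le> lam j"
  using sys by (simp add: row_eigensystem_def)

lemma quadratic_form: "inner (fapp (mat_op A) x) x = (\<Sum>j<n. lam j * (norm (fapp (E j) x))\<^sup>2)"
  unfolding eigen_decomposition[OF sys A]
  by (rule inner_spectral_sum[OF eigen_op_projections[OF sys A]])

lemma norm_eigen_coordinates:
  assumes "\<And>i. i \<ge> n \<Longrightarrow> coord x i = 0"
  shows "(norm x)\<^sup>2 = (\<Sum>j<n. (norm (fapp (E j) x))\<^sup>2)"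
proof -
  have "fapp (spectral_sum n E (\<lambda>_. 1)) x = x"
    unfolding eigen_op_complete[OF sys A] using assms by (rule diag_op_one_eq)
  then have "(norm x)\<^sup>2 = inner (fapp (spectral_sum n E (\<lambda>_. 1)) x) x" by (simp add: power2_norm_eq_inner)
  then show ?thesis by (simp add: inner_spectral_sum[OF eigen_op_projections[OF sys A]])
qed

lemma inner_X: "\<bar>inner (fapp X x) x\<bar> \<le> \<kappa> * (norm x)\<^sup>2"
proof -
  have "\<bar>inner (fapp X x) x\<bar> \<le> norm (fapp X x) * norm x" by (rule Cauchy_Schwarz_ineq2)
  also have "\<dots> \<le> norm X * norm x * norm x" by (intro mult_right_mono norm_fapp) auto
  also have "\<dots> \<le> \<kappa> * norm x * norm x" by (intro mult_right_mono X) auto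
  finally show ?thesis by (simp add: power2_eq_square)
qed

lemma adj_g_support: "i \<ge> q \<Longrightarrow> coord (fapp (adj g) x) i = 0"
  using G by (simp add: mat_op_adjoint[symmetric] coord_mat_op)

lemma inner_A: "inner (fapp (mat_op A) x) x =
    inner (fapp (diag_op q \<phi>) (fapp (adj g) x)) (fapp (adj g) x) + inner (fapp X x) x"
  by (simp add: decomposition inner_add_left inner_adj[of g])

lemma inner_A_ge: "m * (norm (fapp (adj g) x))\<^sup>2 - \<kappa> * (norm x)\<^sup>2 \<le> inner (fapp (mat_op A) x) x"
proof -
  have "m * (norm (fapp (adj g) x))\<^sup>2 \<le> inner (fapp (diag_op q \<phi>) (fapp (adj g) x)) (fapp (adj g) x)"
    by (rule inner_diag_op_ge) (auto simp: \<phi> adj_g_support)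
  then show ?thesis using inner_X[of x] unfolding inner_A by linarith
qed

text \<open>
  Min-max: the \<open>n - 1\<close> linear conditions "orthogonal to the columns of \<open>G\<close>" and "no component along
  \<open>p j\<close> for \<open>j > q\<close>" leave a nonzero vector.  On it the quadratic form of \<open>A\<close> is that of \<open>X\<close>, and it is at
  least \<open>lam q\<close>.
\<close>

lemma lower_eigenvalues_bounded_above: "lam q \<le> \<kappa>"
proof -
  define M where "M i k = (if i < q then mat_adjoint G $$ (i, k) else vec_index (p (Suc i)) k)" for i k
  obtain v where v: "dim_vec v = n" "v \<noteq> 0\<^sub>v n" "\<And>i. i < n - 1 \<Longrightarrow> (\<Sum>k<n. M i k * vec_index v k) = 0"
    by (rule homogeneous_system_nontrivial[where M = M and m = "n - 1" and n = n]) (use q in auto)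
  define x where "x = fseq_of_vec v"
  have supp: "coord x i = 0" if "i \<ge> n" for i using that v(1) by (simp add: x_def)
  have "x \<noteq> 0"
  proof
    assume "x = 0"
    then have "vec_index v i = 0" if "i < n" for i
      using that v(1) coord_fseq_of_vec[of v i] by (simp add: x_def)
    then have "v = 0\<^sub>v n" using v(1) by (intro eq_vecI) auto
    then show False using v(2) by simp
  qed
  have "fapp (adj g) x = 0"
  proof (rule fseq_eqI)
    fix i
    show "coord (fapp (adj g) x) i = coord 0 i"
    proof (cases "i < q")
      case True
      then have "(\<Sum>k<n. M i k * vec_index v k) = 0" using q by (intro v(3)) auto
      then show ?thesis using True G v(1) by (simp add: mat_op_adjoint[symmetric] coord_mat_op x_def M_def)
    qed (simp add: adj_g_support)
  qed
  then have le: "inner (fapp (mat_op A) x) x \<le> \<kappa> * (norm x)\<^sup>2"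
    using inner_X[of x] by (simp add: inner_A)
  have zero: "fapp (E j) x = 0" if j: "q < j" "j < n" for j
  proof (rule fapp_eigen_op_eq_0[OF sys A])
    have "(\<Sum>k<n. M (j - 1) k * vec_index v k) = 0" using j by (intro v(3)) auto
    moreover have "M (j - 1) k = vec_index (p j) k" for k using j by (auto simp: M_def)
    ultimately show "coord (fapp (mat_op (eigen_mat n p)) x) j = 0"
      using j v(1) by (simp add: coord_mat_op eigen_mat_def x_def)
  qed
  have "lam q * (norm x)\<^sup>2 = (\<Sum>j<n. lam q * (norm (fapp (E j) x))\<^sup>2)"
    by (subst norm_eigen_coordinates) (simp_all add: supp sum_distrib_left)
  also have "\<dots> \<le> (\<Sum>j<n. lam j * (norm (fapp (E j) x))\<^sup>2)"
  proof (rule sum_mono)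
    fix j assume "j \<in> {..<n}"
    then show "lam q * (norm (fapp (E j) x))\<^sup>2 \<le> lam j * (norm (fapp (E j) x))\<^sup>2"
      using zero[of j] q by (cases "j \<le> q") (auto intro!: mult_right_mono lam_antimono)
  qed
  also have "\<dots> \<le> \<kappa> * (norm x)\<^sup>2" using le by (simp add: quadratic_form)
  finally show ?thesis using \<open>x \<noteq> 0\<close> by (simp add: mult_le_cancel_right)
qed

lemma eigenvalues_bounded_below: "k < n \<Longrightarrow> - \<kappa> \<le> lam k"
proof -
  assume k: "k < n"
  let ?u = "mat_op (eigen_mat n p)"
  define x where "x = fapp (adj ?u) (fsingle k 1)"
  have ux: "fapp ?u x = fsingle k 1"
  proof -
    have "fapp ?u x = fapp (?u * adj ?u) (fsingle k 1)" by (simp add: x_def)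
    also have "\<dots> = fsingle k 1" unfolding eigen_mat_unitary[OF sys A] by (rule diag_op_one_eq) (use k in auto)
    finally show ?thesis .
  qed
  have supp: "coord x i = 0" if "i \<ge> n" for i
    using that by (simp add: x_def mat_op_adjoint[symmetric] coord_mat_op eigen_mat_def)
  have "x \<noteq> 0"
  proof
    assume "x = 0" then show False using ux norm_fsingle[of k 1] by simp
  qed
  have zero: "fapp (E j) x = 0" if "j \<noteq> k" for j
    by (rule fapp_eigen_op_eq_0[OF sys A]) (simp add: ux that)
  have "lam k * (norm x)\<^sup>2 = (\<Sum>j<n. lam k * (norm (fapp (E j) x))\<^sup>2)"
    by (subst norm_eigen_coordinates) (simp_all add: supp sum_distrib_left)
  also have "\<dots> = (\<Sum>j<n. lam j * (norm (fapp (E j) x))\<^sup>2)"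
    by (rule sum.cong) (use zero in \<open>metis mult_zero_right norm_zero zero_eq_power2\<close>)+
  also have "\<dots> \<ge> - \<kappa> * (norm x)\<^sup>2"
    using inner_A_ge[of x, unfolded quadratic_form] mult_nonneg_nonneg[OF m zero_le_power2[of "norm (fapp (adj g) x)"]]
    by linarith
  finally have "- \<kappa> * (norm x)\<^sup>2 \<le> lam k * (norm x)\<^sup>2" .
  then show ?thesis using \<open>x \<noteq> 0\<close> by (simp only: mult_le_cancel_right) (auto simp: not_less)
qed

lemma lower_eigenvalues_bounded: "q \<le> k \<Longrightarrow> k < n \<Longrightarrow> \<bar>lam k\<bar> \<le> \<kappa>"
  using lower_eigenvalues_bounded_above eigenvalues_bounded_below[of k] lam_antimono[of q k] by linarith

text \<open>
  Min-max from the other side: the range of \<open>G\<close> has dimension \<open>q\<close> and hence contains a nonzero \<open>x\<close> without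
  components along the first \<open>q - 1\<close> eigenvectors.  There \<open>\<parallel>G\<^sup>* x\<parallel> \<ge> \<sigma> \<parallel>x\<parallel>\<close> by coercivity.
\<close>

lemma upper_eigenvalues_large:
  assumes coercive: "\<And>y. (\<And>i. i \<ge> q \<Longrightarrow> coord y i = 0) \<Longrightarrow> \<sigma> * norm y \<le> norm (fapp g y)" and \<sigma>: "0 < \<sigma>"
    and j: "j < q"
  shows "m * \<sigma>\<^sup>2 - \<kappa> \<le> lam j"
proof -
  let ?U = "eigen_mat n p"
  have U: "?U \<in> carrier_mat n n" by (simp add: eigen_mat_def)
  obtain v where v: "dim_vec v = q" "v \<noteq> 0\<^sub>v q" "\<And>i. i < q - 1 \<Longrightarrow> (\<Sum>k<q. (?U * G) $$ (i, k) * vec_index v k) = 0"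
    by (rule homogeneous_system_nontrivial[where M = "\<lambda>i k. (?U * G) $$ (i, k)" and m = "q - 1" and n = q]) (use q in auto)
  define y where "y = fseq_of_vec v"
  define x where "x = fapp g y"
  have y_supp: "coord y i = 0" if "i \<ge> q" for i using that v(1) by (simp add: y_def)
  have "y \<noteq> 0"
  proof
    assume "y = 0"
    then have "vec_index v i = 0" if "i < q" for i
      using that v(1) coord_fseq_of_vec[of v i] by (simp add: y_def)
    then have "v = 0\<^sub>v q" using v(1) by (intro eq_vecI) auto
    then show False using v(2) by simp
  qed
  have xy: "\<sigma> * norm y \<le> norm x" unfolding x_def by (rule coercive) (rule y_supp)
  then have "x \<noteq> 0" using \<open>y \<noteq> 0\<close> \<sigma> mult_pos_pos[of \<sigma> "norm y"] by fastforce
  have x_supp: "coord x i = 0" if "i \<ge> n" for i using that G by (simp add: x_def coord_mat_op)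
  have zero: "fapp (E i) x = 0" if i: "i < q - 1" for i
  proof (rule fapp_eigen_op_eq_0[OF sys A])
    have "fapp (mat_op ?U) x = fapp (mat_op (?U * G)) y" by (simp add: x_def mat_op_mult[OF U G])
    moreover have "dim_row (?U * G) = n" "dim_col (?U * G) = q" using U G by auto
    ultimately have "coord (fapp (mat_op ?U) x) i = (\<Sum>k<q. (?U * G) $$ (i, k) * vec_index v k)"
      using i v(1) q by (simp only: coord_mat_op) (simp add: y_def)
    then show "coord (fapp (mat_op ?U) x) i = 0" using v(3)[OF i] by simp
  qed
  have gx: "\<sigma> * norm x \<le> norm (fapp (adj g) x)"
  proof -
    have "(norm x)\<^sup>2 = inner y (fapp (adj g) x)"
      by (simp add: x_def inner_adj[symmetric] power2_norm_eq_inner)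
    also have "\<dots> \<le> norm y * norm (fapp (adj g) x)" by (rule norm_cauchy_schwarz)
    finally have "\<sigma> * (norm x)\<^sup>2 \<le> (\<sigma> * norm y) * norm (fapp (adj g) x)" using \<sigma> by simp
    also have "\<dots> \<le> norm x * norm (fapp (adj g) x)" by (intro mult_right_mono xy) auto
    finally have "norm x * (\<sigma> * norm x) \<le> norm x * norm (fapp (adj g) x)"
      by (simp add: power2_eq_square mult.left_commute)
    then show ?thesis using \<open>x \<noteq> 0\<close> by (simp add: mult_le_cancel_left)
  qed
  have "(\<sigma> * norm x)\<^sup>2 \<le> (norm (fapp (adj g) x))\<^sup>2" using \<sigma> by (intro power_mono gx) auto
  then have "m * (\<sigma>\<^sup>2 * (norm x)\<^sup>2) \<le> m * (norm (fapp (adj g) x))\<^sup>2"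
    using m by (simp add: mult_left_mono power_mult_distrib)
  then have "(m * \<sigma>\<^sup>2 - \<kappa>) * (norm x)\<^sup>2 \<le> inner (fapp (mat_op A) x) x"
    using inner_A_ge[of x] by (simp add: algebra_simps)
  also have "\<dots> \<le> (\<Sum>i<n. lam (q - 1) * (norm (fapp (E i) x))\<^sup>2)"
    unfolding quadratic_form
  proof (rule sum_mono)
    fix i assume "i \<in> {..<n}"
    then show "lam i * (norm (fapp (E i) x))\<^sup>2 \<le> lam (q - 1) * (norm (fapp (E i) x))\<^sup>2"
      using zero[of i] by (cases "i < q - 1") (auto intro!: mult_right_mono lam_antimono)
  qed
  also have "\<dots> = lam (q - 1) * (norm x)\<^sup>2"
    by (subst norm_eigen_coordinates) (simp_all add: x_supp sum_distrib_left)
  finally have "m * \<sigma>\<^sup>2 - \<kappa> \<le> lam (q - 1)" using \<open>x \<noteq> 0\<close> by (simp add: mult_le_cancel_right)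
  also have "\<dots> \<le> lam j" using j q by (intro lam_antimono) auto
  finally show ?thesis .
qed

end

section \<open>Bounds on the derivatives of the eigenprojection\<close>

lemma norm_mult_le:
  fixes x y :: "'a::real_normed_algebra"
  shows "norm x \<le> r \<Longrightarrow> norm y \<le> s \<Longrightarrow> norm (x * y) \<le> r * s"
  by (rule order_trans[OF norm_mult_ineq mult_mono]) (auto intro: order_trans[OF norm_ge_zero])

text \<open>
  The situation at a single frequency \<open>\<theta>\<close>, after division of \<open>Sg\<close> by \<open>n\<close>, with \<open>v = 1 / \<bar>\<theta>\<bar>\<close> and
  \<open>w = \<bar>\<theta>\<bar> powr \<delta>\<close>.  All bounds are collected in one constant \<open>c\<close>.  \<open>H1 * D\<close> and \<open>H2 * D\<close> are the derivatives
  of the diagonal factor \<open>D\<close>; \<open>Sg1\<close>, \<open>Sg2\<close> and \<open>P1\<close> those of \<open>Sg\<close> and of the projection.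
\<close>

locale factor_bounds =
  fixes G G1 G2 D H1 H2 X1 X2 a R P1 Sg1 Sg2 :: fop and c v w :: real
  assumes c: "1 \<le> c" and v: "0 < v" and w: "0 < w" "w \<le> c" and cv: "1 \<le> c * v" and cvw: "1 \<le> c * v * w"
    and G: "norm G \<le> c" "norm G1 \<le> c" "norm G2 \<le> c"
    and X: "norm X1 \<le> c" "norm X2 \<le> c"
    and D: "norm D \<le> c * v" and H: "norm H1 \<le> c * v" "norm H2 \<le> c * v\<^sup>2"
    and commute: "H1 * D = D * H1"
    and a: "norm a \<le> c * w" and R: "norm R \<le> 1"
    and DGR: "norm (D * adj G * R) \<le> c" and aGD: "norm (a * G * D) \<le> c"
    and Sg1: "Sg1 = G1 * D * adj G + G * (H1 * D) * adj G + G * D * adj G1 + X1"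
    and Sg2: "Sg2 = G2 * D * adj G + G * (H2 * D) * adj G + G * D * adj G2
        + 2 *\<^sub>R (G1 * (H1 * D) * adj G + G1 * D * adj G1 + G * (H1 * D) * adj G1) + X2"
    and P1: "norm P1 \<le> 4 * norm (a * Sg1 * R)"
begin

lemma adj_G: "norm (adj G) \<le> c" "norm (adj G1) \<le> c" "norm (adj G2) \<le> c"
  using G by simp_all

lemma weaken:
  assumes "x \<le> y" "0 \<le> y" "1 \<le> z" shows "x \<le> y * (z::real)"
  using mult_left_mono[OF assms(3,2)] assms(1) by simp

lemma nonneg [simp]: "0 \<le> c" "0 \<le> v" "0 \<le> w" using c v w by simp_all

text \<open>
  The factors by which the bounds below are enlarged to reach a common monomial.
\<close>

lemma one_le_factors:
  "1 \<le> (c * v * w) * (c * v) * c"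
  "1 \<le> (c * v * w) * c"
  "1 \<le> (c * v)"
  "1 \<le> (c * v) * (c * v)"
  "1 \<le> (c * v) * (c * v) * c"
  "1 \<le> (c * v) * c"
  "1 \<le> (c * v) * c * c"
  "1 \<le> c"
  "1 \<le> c * c"
  by (intro mult_ge1_I[OF mult_ge1_I] mult_ge1_I c cv cvw; simp only: mult.assoc[symmetric] c cv cvw)+

text \<open>
  In every term \<open>D\<close> is absorbed either by \<open>D * adj G * R\<close> on its right or by \<open>a * G * D\<close> on its left.
\<close>

lemma norm_a_Sg1_R: "norm (a * Sg1 * R) \<le> 4 * c ^ 4 * w * v"
proof -
  have eq: "a * Sg1 * R = a * G1 * (D * adj G * R) + a * G * H1 * (D * adj G * R) + a * G * D * adj G1 * R + a * X1 * R"
    unfolding Sg1 by (simp only: distrib_left distrib_right mult.assoc)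
  have 1: "norm (a * G1 * (D * adj G * R)) \<le> c ^ 4 * w * v"
  proof -
    have "norm (a * G1 * (D * adj G * R)) \<le> c * w * c * c" by (intro norm_mult_le a G DGR)
    then have "norm (a * G1 * (D * adj G * R)) \<le> c * w * c * c * ((c * v))"
      by (rule weaken) (rule one_le_factors | simp)+
    then show ?thesis by (simp add: eval_nat_numeral mult_ac)
  qed
  have 2: "norm (a * G * H1 * (D * adj G * R)) \<le> c ^ 4 * w * v"
  proof -
    have "norm (a * G * H1 * (D * adj G * R)) \<le> c * w * c * (c * v) * c" by (intro norm_mult_le a G H DGR)
    then show ?thesis by (simp add: eval_nat_numeral mult_ac)
  qed
  have 3: "norm (a * G * D * adj G1 * R) \<le> c ^ 4 * w * v"
  proof -
    have "norm (a * G * D * adj G1 * R) \<le> c * c * 1" by (intro norm_mult_le aGD adj_G R)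
    then have "norm (a * G * D * adj G1 * R) \<le> c * c * 1 * ((c * v * w) * c)"
      by (rule weaken) (rule one_le_factors | simp)+
    then show ?thesis by (simp add: eval_nat_numeral mult_ac)
  qed
  have 4: "norm (a * X1 * R) \<le> c ^ 4 * w * v"
  proof -
    have "norm (a * X1 * R) \<le> c * w * c * 1" by (intro norm_mult_le a X R)
    then have "norm (a * X1 * R) \<le> c * w * c * 1 * ((c * v) * c)"
      by (rule weaken) (rule one_le_factors | simp)+
    then show ?thesis by (simp add: eval_nat_numeral mult_ac)
  qed
  have "norm (a * Sg1 * R) \<le> norm (a * G1 * (D * adj G * R)) + norm (a * G * H1 * (D * adj G * R))
      + norm (a * G * D * adj G1 * R) + norm (a * X1 * R)"
    unfolding eq by (intro order_trans[OF norm_triangle_ineq] add_mono order_refl)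
  then show ?thesis using 1 2 3 4 by linarith
qed

lemma norm_P1: "norm P1 \<le> 16 * c ^ 4 * w * v"
  using P1 norm_a_Sg1_R by linarith

lemma norm_a_Sg1: "norm (a * Sg1) \<le> 4 * c ^ 5 * v"
proof -
  have eq: "a * Sg1 = a * G1 * D * adj G + a * G * D * H1 * adj G + a * G * D * adj G1 + a * X1"
    unfolding Sg1 commute by (simp only: distrib_left distrib_right mult.assoc)
  have 1: "norm (a * G1 * D * adj G) \<le> c ^ 5 * v"
  proof -
    have "norm (a * G1 * D * adj G) \<le> c * w * c * (c * v) * c" by (intro norm_mult_le a G D adj_G)
    also have "\<dots> \<le> c * c * c * (c * v) * c" using c v w by (intro mult_right_mono mult_left_mono) auto
    finally show ?thesis by (simp add: eval_nat_numeral mult_ac)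
  qed
  have 2: "norm (a * G * D * H1 * adj G) \<le> c ^ 5 * v"
  proof -
    have "norm (a * G * D * H1 * adj G) \<le> c * (c * v) * c" by (intro norm_mult_le aGD H adj_G)
    then have "norm (a * G * D * H1 * adj G) \<le> c * (c * v) * c * (c * c)"
      by (rule weaken) (rule one_le_factors | simp)+
    then show ?thesis by (simp add: eval_nat_numeral mult_ac)
  qed
  have 3: "norm (a * G * D * adj G1) \<le> c ^ 5 * v"
  proof -
    have "norm (a * G * D * adj G1) \<le> c * c" by (intro norm_mult_le aGD adj_G)
    then have "norm (a * G * D * adj G1) \<le> c * c * ((c * v) * c * c)"
      by (rule weaken) (rule one_le_factors | simp)+
    then show ?thesis by (simp add: eval_nat_numeral mult_ac)
  qed
  have 4: "norm (a * X1) \<le> c ^ 5 * v"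
  proof -
    have "norm (a * X1) \<le> c * w * c" by (intro norm_mult_le a X)
    also have "\<dots> \<le> c * c * c" using c w by (intro mult_right_mono mult_left_mono) auto
    finally have "norm (a * X1) \<le> c * c * c * ((c * v) * c)"
      by (rule weaken) (rule one_le_factors | simp)+
    then show ?thesis by (simp add: eval_nat_numeral mult_ac)
  qed
  have "norm (a * Sg1) \<le> norm (a * G1 * D * adj G) + norm (a * G * D * H1 * adj G)
      + norm (a * G * D * adj G1) + norm (a * X1)"
    unfolding eq by (intro order_trans[OF norm_triangle_ineq] add_mono order_refl)
  then show ?thesis using 1 2 3 4 by linarith
qed

lemma norm_Sg1_R: "norm (Sg1 * R) \<le> 4 * c ^ 3 * v"
proof -
  have eq: "Sg1 * R = G1 * (D * adj G * R) + G * H1 * (D * adj G * R) + G * D * adj G1 * R + X1 * R"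
    unfolding Sg1 by (simp only: distrib_left distrib_right mult.assoc)
  have 1: "norm (G1 * (D * adj G * R)) \<le> c ^ 3 * v"
  proof -
    have "norm (G1 * (D * adj G * R)) \<le> c * c" by (intro norm_mult_le G DGR)
    then have "norm (G1 * (D * adj G * R)) \<le> c * c * ((c * v))"
      by (rule weaken) (rule one_le_factors | simp)+
    then show ?thesis by (simp add: eval_nat_numeral mult_ac)
  qed
  have 2: "norm (G * H1 * (D * adj G * R)) \<le> c ^ 3 * v"
  proof -
    have "norm (G * H1 * (D * adj G * R)) \<le> c * (c * v) * c" by (intro norm_mult_le G H DGR)
    then show ?thesis by (simp add: eval_nat_numeral mult_ac)
  qed
  have 3: "norm (G * D * adj G1 * R) \<le> c ^ 3 * v"
  proof -
    have "norm (G * D * adj G1 * R) \<le> c * (c * v) * c * 1" by (intro norm_mult_le G D adj_G R)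
    then show ?thesis by (simp add: eval_nat_numeral mult_ac)
  qed
  have 4: "norm (X1 * R) \<le> c ^ 3 * v"
  proof -
    have "norm (X1 * R) \<le> c * 1" by (intro norm_mult_le X R)
    then have "norm (X1 * R) \<le> c * 1 * ((c * v) * c)"
      by (rule weaken) (rule one_le_factors | simp)+
    then show ?thesis by (simp add: eval_nat_numeral mult_ac)
  qed
  have "norm (Sg1 * R) \<le> norm (G1 * (D * adj G * R)) + norm (G * H1 * (D * adj G * R))
      + norm (G * D * adj G1 * R) + norm (X1 * R)"
    unfolding eq by (intro order_trans[OF norm_triangle_ineq] add_mono order_refl)
  then show ?thesis using 1 2 3 4 by linarith
qed

lemma norm_a_Sg2_R: "norm (a * Sg2 * R) \<le> 10 * c ^ 5 * w * v\<^sup>2"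
proof -
  let ?b = "c ^ 5 * w * v\<^sup>2"
  have eq: "a * Sg2 * R = a * G2 * (D * adj G * R) + a * G * H2 * (D * adj G * R) + a * G * D * adj G2 * R
      + 2 *\<^sub>R (a * G1 * H1 * (D * adj G * R) + a * G1 * D * adj G1 * R + a * G * D * H1 * adj G1 * R) + a * X2 * R"
  proof -
    have "a * G * D * H1 = a * G * (H1 * D)" by (simp only: commute mult.assoc)
    then show ?thesis
      unfolding Sg2 by (simp only: distrib_left distrib_right mult_scaleR_left mult_scaleR_right mult.assoc)
  qed
  have 1: "norm (a * G2 * (D * adj G * R)) \<le> ?b"
  proof -
    have "norm (a * G2 * (D * adj G * R)) \<le> c * w * c * c" by (intro norm_mult_le a G DGR)
    then have "norm (a * G2 * (D * adj G * R)) \<le> c * w * c * c * ((c * v) * (c * v))"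
      by (rule weaken) (rule one_le_factors | simp)+
    then show ?thesis by (simp add: eval_nat_numeral mult_ac)
  qed
  have 2: "norm (a * G * H2 * (D * adj G * R)) \<le> ?b"
  proof -
    have "norm (a * G * H2 * (D * adj G * R)) \<le> c * w * c * (c * v\<^sup>2) * c" by (intro norm_mult_le a G H DGR)
    then have "norm (a * G * H2 * (D * adj G * R)) \<le> c * w * c * (c * v\<^sup>2) * c * (c)"
      by (rule weaken) (rule one_le_factors | simp)+
    then show ?thesis by (simp add: eval_nat_numeral mult_ac)
  qed
  have 3: "norm (a * G * D * adj G2 * R) \<le> ?b"
  proof -
    have "norm (a * G * D * adj G2 * R) \<le> c * c * 1" by (intro norm_mult_le aGD adj_G R)
    then have "norm (a * G * D * adj G2 * R) \<le> c * c * 1 * ((c * v * w) * (c * v) * c)"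
      by (rule weaken) (rule one_le_factors | simp)+
    then show ?thesis by (simp add: eval_nat_numeral mult_ac)
  qed
  have 4: "norm (a * G1 * H1 * (D * adj G * R)) \<le> ?b"
  proof -
    have "norm (a * G1 * H1 * (D * adj G * R)) \<le> c * w * c * (c * v) * c" by (intro norm_mult_le a G H DGR)
    then have "norm (a * G1 * H1 * (D * adj G * R)) \<le> c * w * c * (c * v) * c * ((c * v))"
      by (rule weaken) (rule one_le_factors | simp)+
    then show ?thesis by (simp add: eval_nat_numeral mult_ac)
  qed
  have 5: "norm (a * G1 * D * adj G1 * R) \<le> ?b"
  proof -
    have "norm (a * G1 * D * adj G1 * R) \<le> c * w * c * (c * v) * c * 1" by (intro norm_mult_le a G D adj_G R)
    then have "norm (a * G1 * D * adj G1 * R) \<le> c * w * c * (c * v) * c * 1 * ((c * v))"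
      by (rule weaken) (rule one_le_factors | simp)+
    then show ?thesis by (simp add: eval_nat_numeral mult_ac)
  qed
  have 6: "norm (a * G * D * H1 * adj G1 * R) \<le> ?b"
  proof -
    have "norm (a * G * D * H1 * adj G1 * R) \<le> c * (c * v) * c * 1" by (intro norm_mult_le aGD H adj_G R)
    then have "norm (a * G * D * H1 * adj G1 * R) \<le> c * (c * v) * c * 1 * ((c * v * w) * c)"
      by (rule weaken) (rule one_le_factors | simp)+
    then show ?thesis by (simp add: eval_nat_numeral mult_ac)
  qed
  have 7: "norm (a * X2 * R) \<le> ?b"
  proof -
    have "norm (a * X2 * R) \<le> c * w * c * 1" by (intro norm_mult_le a X R)
    then have "norm (a * X2 * R) \<le> c * w * c * 1 * ((c * v) * (c * v) * c)"
      by (rule weaken) (rule one_le_factors | simp)+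
    then show ?thesis by (simp add: eval_nat_numeral mult_ac)
  qed
  have "norm (a * G1 * H1 * (D * adj G * R) + a * G1 * D * adj G1 * R + a * G * D * H1 * adj G1 * R)
      \<le> ?b + ?b + ?b"
    by (intro norm_triangle_mono 4 5 6)
  then have 8: "norm (2 *\<^sub>R (a * G1 * H1 * (D * adj G * R) + a * G1 * D * adj G1 * R + a * G * D * H1 * adj G1 * R))
      \<le> 6 * ?b" by simp
  have "norm (a * Sg2 * R) \<le> ?b + ?b + ?b + 6 * ?b + ?b"
    unfolding eq by (intro norm_triangle_mono 1 2 3 7 8)
  also have "\<dots> = 10 * ?b" by simp
  finally have "norm (a * Sg2 * R) \<le> 10 * ?b" .
  then show ?thesis by (simp add: mult.assoc)
qed

text \<open>
  In the mixed terms \<open>P1\<close> separates \<open>Sg1\<close> from \<open>a\<close> or from \<open>R\<close>, so that only one of the two cancelling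
  products is left and some summands are estimated with \<open>D = O(v)\<close> alone (\<open>norm_a_Sg1\<close>, \<open>norm_Sg1_R\<close>).
  Since \<open>P1 = O(w v)\<close> this costs one more factor \<open>v\<close>, which the second derivative may lose.
\<close>

lemma norm_P2_le:
  assumes "norm P2 \<le> 4 * norm (a * (Sg2 + 2 *\<^sub>R (P1 * Sg1) - 2 *\<^sub>R (Sg1 * P1)) * R) + 4 * (norm P1)\<^sup>2"
  shows "norm P2 \<le> 3000 * c ^ 9 * w * v\<^sup>2"
proof -
  let ?b = "c ^ 9 * w * v\<^sup>2"
  have 1: "norm (a * Sg2 * R) \<le> 10 * ?b"
  proof -
    have "norm (a * Sg2 * R) \<le> 10 * c ^ 5 * w * v\<^sup>2 * c ^ 4"
      using c v w one_le_power[OF c] by (rule_tac weaken[OF norm_a_Sg2_R]) auto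
    then show ?thesis by (simp add: eval_nat_numeral mult_ac)
  qed
  have ww: "c ^ 8 * w * w * v\<^sup>2 \<le> ?b"
  proof -
    have "c ^ 8 * w * w * v\<^sup>2 \<le> c ^ 8 * w * c * v\<^sup>2"
      using c w v by (intro mult_right_mono mult_left_mono) auto
    then show ?thesis by (simp add: eval_nat_numeral mult_ac)
  qed
  have 2: "norm (a * P1 * (Sg1 * R)) \<le> 64 * ?b"
  proof -
    have "norm (a * P1 * (Sg1 * R)) \<le> c * w * (16 * c ^ 4 * w * v) * (4 * c ^ 3 * v)"
      by (intro norm_mult_le a norm_P1 norm_Sg1_R)
    also have "\<dots> = 64 * (c ^ 8 * w * w * v\<^sup>2)" by (simp add: eval_nat_numeral mult_ac)
    finally show ?thesis using ww by linarith
  qed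
  have 3: "norm (a * Sg1 * P1 * R) \<le> 64 * ?b"
  proof -
    have "norm (a * Sg1 * P1 * R) \<le> 4 * c ^ 5 * v * (16 * c ^ 4 * w * v) * 1"
      by (intro norm_mult_le norm_a_Sg1 norm_P1 R)
    then show ?thesis by (simp add: eval_nat_numeral mult_ac)
  qed
  have 4: "(norm P1)\<^sup>2 \<le> 256 * ?b"
  proof -
    have "(norm P1)\<^sup>2 \<le> (16 * c ^ 4 * w * v)\<^sup>2" by (intro power_mono norm_P1) auto
    also have "\<dots> = 256 * (c ^ 8 * w * w * v\<^sup>2)" by (simp add: eval_nat_numeral mult_ac)
    finally show ?thesis using ww by linarith
  qed
  have "norm (a * (Sg2 + 2 *\<^sub>R (P1 * Sg1) - 2 *\<^sub>R (Sg1 * P1)) * R) =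
      norm (a * Sg2 * R + 2 *\<^sub>R (a * P1 * (Sg1 * R)) - 2 *\<^sub>R (a * Sg1 * P1 * R))"
    by (simp add: algebra_simps)
  also have "\<dots> \<le> norm (a * Sg2 * R) + norm (2 *\<^sub>R (a * P1 * (Sg1 * R))) + norm (2 *\<^sub>R (a * Sg1 * P1 * R))"
    by (rule order_trans[OF norm_triangle_ineq4 add_right_mono[OF norm_triangle_ineq]])
  also have "\<dots> = norm (a * Sg2 * R) + 2 * norm (a * P1 * (Sg1 * R)) + 2 * norm (a * Sg1 * P1 * R)" by simp
  finally have "norm P2 \<le> 2088 * ?b" using assms 1 2 3 4 by linarith
  moreover have "0 \<le> ?b" using c w v by simp
  ultimately have "norm P2 \<le> 3000 * ?b" by linarith
  then show ?thesis by (simp add: mult.assoc)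
qed

end

section \<open>The long-memory factor\<close>

text \<open>
  The squared distance of \<open>e\<^sup>-\<^sup>i\<^sup>\<theta>\<close> from 1; the entries of \<open>D\<close> are its powers \<open>- d\<close> (\<open>cmod_powr_eq\<close>).
\<close>

definition sqdist :: "real \<Rightarrow> real" where "sqdist \<theta> = 2 - 2 * cos \<theta>"

lemma cmod_powr_eq: "cmod (1 - cis (- \<theta>)) powr (- 2 * d) = sqdist \<theta> powr (- d)"
proof -
  have "(cmod (1 - cis (- \<theta>)))\<^sup>2 = (1 - cos \<theta>)\<^sup>2 + (sin \<theta>)\<^sup>2"
    by (simp add: cmod_power2)
  also have "\<dots> = sqdist \<theta>"
    using sin_cos_squared_add[of \<theta>] by (simp add: sqdist_def power2_eq_square algebra_simps)
  finally have "cmod (1 - cis (- \<theta>)) = sqdist \<theta> powr (1 / 2)"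
    by (metis norm_ge_zero powr_half_sqrt real_sqrt_abs abs_norm_cancel real_sqrt_unique zero_le_power2)
  then show ?thesis by (simp add: powr_powr)
qed

lemma sqdist_le_square: "sqdist \<theta> \<le> \<theta>\<^sup>2"
proof -
  have "sqdist \<theta> = 4 * (sin (\<theta> / 2))\<^sup>2"
    using cos_double_sin[of "\<theta> / 2"] by (simp add: sqdist_def)
  moreover have "(sin (\<theta> / 2))\<^sup>2 \<le> (\<theta> / 2)\<^sup>2"
    using abs_sin_x_le_abs_x[of "\<theta> / 2"] by (simp only: abs_le_square_iff)
  ultimately show ?thesis by (simp add: power_divide)
qed

lemma sqdist_le_4: "sqdist \<theta> \<le> 4"
  using cos_ge_minus_one[of \<theta>] unfolding sqdist_def by linarith

lemma sin_ge_half: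
  assumes "0 \<le> y" "y \<le> pi / 2" shows "y / 2 \<le> sin y"
proof (cases "y = 0")
  case False
  define x where "x = y / 2"
  have x: "0 < x" "x \<le> pi / 4" using assms False by (simp_all add: x_def)
  have "\<exists>z. 0 < z \<and> z < x \<and> sin x - sin 0 = (x - 0) * cos z"
    using x by (intro MVT2) (auto intro!: derivative_eq_intros)
  then obtain z where z: "0 < z" "z < x" "sin x = x * cos z" by auto
  have c: "cos (pi / 4) \<le> cos x" "cos x \<le> cos z"
    using x z by (auto intro!: cos_monotone_0_pi_le)
  \<comment> \<open>Duplication formula at \<open>x = y / 2\<close>: both cosines are at least \<open>cos (pi / 4)\<close>, whose square is 1/2.\<close>
  have c0: "0 < cos (pi / 4)" by (simp add: cos_45)
  have "x = 2 * (x * cos (pi / 4)) * cos (pi / 4)" by (simp add: cos_45)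
  also have "\<dots> \<le> 2 * (x * cos z) * cos x"
    using x c c0 by (intro mult_mono mult_left_mono mult_nonneg_nonneg) auto
  also have "\<dots> = sin y" 
  proof -
    have "y = 2 * x" by (simp add: x_def)
    then show ?thesis by (simp only: sin_double z(3))
  qed
  finally show ?thesis by (simp add: x_def)
qed simp

lemma sqdist_ge_square:
  assumes "\<bar>\<theta>\<bar> \<le> pi" shows "\<theta>\<^sup>2 / 4 \<le> sqdist \<theta>"
proof -
  have "sqdist \<theta> = 4 * (sin (\<bar>\<theta>\<bar> / 2))\<^sup>2"
    using cos_double_sin[of "\<theta> / 2"] by (cases "\<theta> \<ge> 0") (simp_all add: sqdist_def)
  moreover have "(\<bar>\<theta>\<bar> / 2 / 2)\<^sup>2 \<le> (sin (\<bar>\<theta>\<bar> / 2))\<^sup>2"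
    using assms by (intro power_mono sin_ge_half) auto
  ultimately show ?thesis by (simp add: power_divide)
qed

text \<open>
  The logarithmic derivative of \<open>sqdist \<theta> powr (- d)\<close>, and the ratio of its second derivative to the
  function itself.
\<close>

definition rate1 :: "real \<Rightarrow> real \<Rightarrow> real" where "rate1 d \<theta> = - 2 * d * sin \<theta> / sqdist \<theta>"
definition rate2 :: "real \<Rightarrow> real \<Rightarrow> real" where
  "rate2 d \<theta> = (rate1 d \<theta>)\<^sup>2 - 2 * d * (cos \<theta> * sqdist \<theta> - 2 * (sin \<theta>)\<^sup>2) / (sqdist \<theta>)\<^sup>2"

context
  fixes \<theta> :: real
  assumes \<theta>: "\<theta> \<in> freqs - {0}"
begin

lemma abs_theta: "0 < \<bar>\<theta>\<bar>" "\<bar>\<theta>\<bar> \<le> pi" using \<theta> by auto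

lemma sqdist_pos: "0 < sqdist \<theta>"
proof -
  have "0 < \<theta>\<^sup>2 / 4" using abs_theta by simp
  then show ?thesis using sqdist_ge_square[OF abs_theta(2)] by linarith
qed

lemma sqdist_has_derivative: "(sqdist has_real_derivative 2 * sin \<theta>) (at \<theta> within S)"
  unfolding sqdist_def by (auto intro!: derivative_eq_intros)

lemma powr_has_derivative:
  "((\<lambda>t. sqdist t powr (- d)) has_real_derivative rate1 d \<theta> * sqdist \<theta> powr (- d)) (at \<theta> within S)"
proof -
  have "((\<lambda>t. sqdist t powr (- d)) has_real_derivative (- d * sqdist \<theta> powr (- d - 1)) * (2 * sin \<theta>)) (at \<theta> within S)"
    using sqdist_pos by (auto intro!: derivative_eq_intros sqdist_has_derivative simp: powr_diff)
  moreover have "(- d * sqdist \<theta> powr (- d - 1)) * (2 * sin \<theta>) = rate1 d \<theta> * sqdist \<theta> powr (- d)"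
    using sqdist_pos by (simp add: rate1_def powr_diff)
  ultimately show ?thesis by simp
qed

lemma rate1_powr_has_derivative:
  "((\<lambda>t. rate1 d t * sqdist t powr (- d)) has_real_derivative rate2 d \<theta> * sqdist \<theta> powr (- d)) (at \<theta> within S)"
proof -
  have "(rate1 d has_real_derivative ((- 2 * d * cos \<theta>) * sqdist \<theta> - (- 2 * d * sin \<theta>) * (2 * sin \<theta>)) / (sqdist \<theta> * sqdist \<theta>))
      (at \<theta> within S)"
    unfolding rate1_def
    by (rule DERIV_divide[OF _ sqdist_has_derivative]) (use sqdist_pos in \<open>auto intro!: derivative_eq_intros\<close>)
  then have "((\<lambda>t. rate1 d t * sqdist t powr (- d)) has_real_derivative
     ((- 2 * d * cos \<theta>) * sqdist \<theta> - (- 2 * d * sin \<theta>) * (2 * sin \<theta>)) / (sqdist \<theta> * sqdist \<theta>) * sqdist \<theta> powr (- d)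
     + (rate1 d \<theta> * sqdist \<theta> powr (- d)) * rate1 d \<theta>) (at \<theta> within S)"
    by (rule DERIV_mult[OF _ powr_has_derivative])
  moreover have "((- 2 * d * cos \<theta>) * sqdist \<theta> - (- 2 * d * sin \<theta>) * (2 * sin \<theta>)) / (sqdist \<theta> * sqdist \<theta>) * sqdist \<theta> powr (- d)
     + (rate1 d \<theta> * sqdist \<theta> powr (- d)) * rate1 d \<theta> = rate2 d \<theta> * sqdist \<theta> powr (- d)"
    by (simp add: rate2_def power2_eq_square algebra_simps diff_divide_distrib add_divide_distrib)
  ultimately show ?thesis by simp
qed

lemma inverse_sqdist_le: "1 / sqdist \<theta> \<le> 4 * (1 / \<bar>\<theta>\<bar>)\<^sup>2"
  using sqdist_ge_square[OF abs_theta(2)] sqdist_pos abs_theta(1)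
  by (simp add: field_simps power_divide)

lemma powr_theta_le_pi: "0 \<le> e \<Longrightarrow> e \<le> 1 \<Longrightarrow> \<bar>\<theta>\<bar> powr e \<le> pi"
proof -
  assume e: "0 \<le> e" "e \<le> 1"
  have "\<bar>\<theta>\<bar> powr e \<le> pi powr e" using e abs_theta by (intro powr_mono2) auto
  also have "\<dots> \<le> pi powr 1" using e pi_ge_two by (intro powr_mono) auto
  finally show ?thesis by simp
qed

context
  fixes d :: real
  assumes d: "0 \<le> d" "d < 1 / 2"
begin

lemma abs_rate1_le: "\<bar>rate1 d \<theta>\<bar> \<le> 4 * (1 / \<bar>\<theta>\<bar>)"
proof -
  have cancel: "1 * x * (4 * (1 / x)\<^sup>2) = 4 * (1 / x)" if "0 < x" for x :: real
    using that by (simp add: power2_eq_square)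
  have "\<bar>rate1 d \<theta>\<bar> = 2 * d * \<bar>sin \<theta>\<bar> * (1 / sqdist \<theta>)"
    using d sqdist_pos by (simp add: rate1_def abs_mult)
  also have "\<dots> \<le> 1 * \<bar>\<theta>\<bar> * (4 * (1 / \<bar>\<theta>\<bar>)\<^sup>2)"
    using d sqdist_pos abs_sin_x_le_abs_x[of \<theta>] inverse_sqdist_le by (intro mult_mono) auto
  also have "\<dots> = 4 * (1 / \<bar>\<theta>\<bar>)" by (rule cancel[OF abs_theta(1)])
  finally show ?thesis .
qed

lemma abs_rate2_le: "\<bar>rate2 d \<theta>\<bar> \<le> 28 * (1 / \<bar>\<theta>\<bar>)\<^sup>2"
proof -
  have s: "(sin \<theta>)\<^sup>2 \<le> sqdist \<theta>"
  proof -
    have "(sin \<theta>)\<^sup>2 = (1 + cos \<theta>) * (1 - cos \<theta>)"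
      by (simp add: sin_squared_eq power2_eq_square algebra_simps)
    also have "\<dots> \<le> 2 * (1 - cos \<theta>)" using cos_le_one[of \<theta>] by (intro mult_right_mono) auto
    finally show ?thesis by (simp add: sqdist_def)
  qed
  have "\<bar>cos \<theta> * sqdist \<theta>\<bar> \<le> 1 * sqdist \<theta>"
    unfolding abs_mult using sqdist_pos by (intro mult_mono) auto
  then have "\<bar>cos \<theta> * sqdist \<theta> - 2 * (sin \<theta>)\<^sup>2\<bar> \<le> 3 * sqdist \<theta>" using s zero_le_power2[of "sin \<theta>"] by linarith
  then have "\<bar>2 * d * (cos \<theta> * sqdist \<theta> - 2 * (sin \<theta>)\<^sup>2) / (sqdist \<theta>)\<^sup>2\<bar> \<le> 1 * (3 * sqdist \<theta>) / (sqdist \<theta>)\<^sup>2"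
    unfolding abs_divide abs_mult using d sqdist_pos by (intro frac_le mult_mono) auto
  also have "\<dots> = 3 * (1 / sqdist \<theta>)" using sqdist_pos by (simp add: power2_eq_square)
  also have "\<dots> \<le> 12 * (1 / \<bar>\<theta>\<bar>)\<^sup>2" using inverse_sqdist_le by simp
  finally have 1: "\<bar>2 * d * (cos \<theta> * sqdist \<theta> - 2 * (sin \<theta>)\<^sup>2) / (sqdist \<theta>)\<^sup>2\<bar> \<le> 12 * (1 / \<bar>\<theta>\<bar>)\<^sup>2" .
  have "(rate1 d \<theta>)\<^sup>2 \<le> (4 * (1 / \<bar>\<theta>\<bar>))\<^sup>2"
    using abs_rate1_le abs_theta(1) by (simp add: abs_le_square_iff[symmetric])
  then have "(rate1 d \<theta>)\<^sup>2 \<le> 16 * (1 / \<bar>\<theta>\<bar>)\<^sup>2" by (simp only: power_mult_distrib) simp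
  then have "\<bar>(rate1 d \<theta>)\<^sup>2\<bar> \<le> 16 * (1 / \<bar>\<theta>\<bar>)\<^sup>2" by simp
  from order_trans[OF abs_triangle_ineq4 add_mono[OF this 1]]
  show ?thesis unfolding rate2_def by simp
qed

lemma sqdist_powr_le: "sqdist \<theta> powr (- d) \<le> 2 * pi * (1 / \<bar>\<theta>\<bar>)"
proof -
  have "sqdist \<theta> powr (- d) \<le> (\<theta>\<^sup>2 / 4) powr (- d)"
    using d sqdist_ge_square[OF abs_theta(2)] abs_theta(1) by (intro powr_mono2') auto
  also have "\<dots> = 4 powr d * \<bar>\<theta>\<bar> powr (- 2 * d)"
  proof -
    have e: "\<theta>\<^sup>2 = \<bar>\<theta>\<bar> powr 2" using abs_theta(1) by (simp add: powr_numeral)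
    show ?thesis unfolding e by (simp add: powr_divide powr_powr powr_minus_divide del: powr_numeral)
  qed
  also have "\<bar>\<theta>\<bar> powr (- 2 * d) = \<bar>\<theta>\<bar> powr (1 - 2 * d) * (1 / \<bar>\<theta>\<bar>)"
    using abs_theta(1) by (simp add: powr_diff powr_minus_divide)
  also have "4 powr d * \<dots> \<le> 2 * (pi * (1 / \<bar>\<theta>\<bar>))"
  proof (intro mult_mono powr_theta_le_pi)
    have "4 powr d \<le> 4 powr (1 / 2)" using d by (intro powr_mono) auto
    then show "4 powr d \<le> 2" by (simp add: powr_half_sqrt)
  qed (use d in auto)
  finally show ?thesis by simp
qed

lemma sqdist_powr_ge:
  assumes "0 < \<delta>" "\<delta> \<le> 2 * d" shows "1 / (2 * \<bar>\<theta>\<bar> powr \<delta>) \<le> sqdist \<theta> powr (- d)"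
proof -
  have "sqdist \<theta> powr d = sqdist \<theta> powr (\<delta> / 2) * sqdist \<theta> powr (d - \<delta> / 2)"
    using sqdist_pos by (simp add: powr_add[symmetric])
  also have "\<dots> \<le> \<bar>\<theta>\<bar> powr \<delta> * 2"
  proof (intro mult_mono)
    have "sqdist \<theta> powr (\<delta> / 2) \<le> (\<bar>\<theta>\<bar> powr 2) powr (\<delta> / 2)"
      using assms sqdist_pos sqdist_le_square[of \<theta>] abs_theta(1) by (intro powr_mono2) (auto simp: powr_numeral)
    then show "sqdist \<theta> powr (\<delta> / 2) \<le> \<bar>\<theta>\<bar> powr \<delta>" by (simp only: powr_powr) simp
    have "sqdist \<theta> powr (d - \<delta> / 2) \<le> 4 powr (d - \<delta> / 2)"
      using assms sqdist_pos sqdist_le_4[of \<theta>] by (intro powr_mono2) auto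
    also have "\<dots> \<le> 4 powr (1 / 2)" using d assms by (intro powr_mono) auto
    finally show "sqdist \<theta> powr (d - \<delta> / 2) \<le> 2" by (simp add: powr_half_sqrt)
  qed auto
  finally have "sqdist \<theta> powr d \<le> 2 * \<bar>\<theta>\<bar> powr \<delta>" by simp
  moreover have "0 < sqdist \<theta> powr d" using sqdist_pos by simp
  ultimately have "1 / (2 * \<bar>\<theta>\<bar> powr \<delta>) \<le> 1 / sqdist \<theta> powr d" by (intro divide_left_mono mult_pos_pos) (use abs_theta(1) in auto)
  then show ?thesis by (simp add: powr_minus_divide)
qed

end

end

section \<open>The eigenprojection as a function of the frequency\<close>

lemma (in spectral_split) factor_derivative_bounds:
  fixes G G1 G2 D H1 H2 X X1 X2 :: "real \<Rightarrow> fop" and v w :: "real \<Rightarrow> real"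
  assumes Sg: "\<And>t. t \<in> S \<Longrightarrow> Sg t = G t * D t * adj (G t) + X t"
    and G1: "\<And>t. t \<in> S \<Longrightarrow> (G has_vector_derivative G1 t) (at t within S)"
    and G2: "\<And>t. t \<in> S \<Longrightarrow> (G1 has_vector_derivative G2 t) (at t within S)"
    and D1: "\<And>t. t \<in> S \<Longrightarrow> (D has_vector_derivative H1 t * D t) (at t within S)"
    and D2: "\<And>t. t \<in> S \<Longrightarrow> ((\<lambda>t. H1 t * D t) has_vector_derivative H2 t * D t) (at t within S)"
    and X1: "\<And>t. t \<in> S \<Longrightarrow> (X has_vector_derivative X1 t) (at t within S)"
    and X2: "\<And>t. t \<in> S \<Longrightarrow> (X1 has_vector_derivative X2 t) (at t within S)"
    and c: "1 \<le> c" and vw: "\<And>t. t \<in> S \<Longrightarrow> 0 < v t \<and> 0 < w t \<and> w t \<le> c \<and> 1 \<le> c * v t \<and> 1 \<le> c * v t * w t"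
    and nG: "\<And>t. t \<in> S \<Longrightarrow> norm (G t) \<le> c \<and> norm (G1 t) \<le> c \<and> norm (G2 t) \<le> c"
    and nX: "\<And>t. t \<in> S \<Longrightarrow> norm (X1 t) \<le> c \<and> norm (X2 t) \<le> c"
    and nD: "\<And>t. t \<in> S \<Longrightarrow> norm (D t) \<le> c * v t \<and> norm (H1 t) \<le> c * v t \<and> norm (H2 t) \<le> c * (v t)\<^sup>2"
    and commute: "\<And>t. t \<in> S \<Longrightarrow> H1 t * D t = D t * H1 t"
    and na: "\<And>t. t \<in> S \<Longrightarrow> norm (a t) \<le> c * w t"
    and DGR: "\<And>t. t \<in> S \<Longrightarrow> norm (D t * adj (G t) * R t) \<le> c"
    and aGD: "\<And>t. t \<in> S \<Longrightarrow> norm (a t * G t * D t) \<le> c"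
  shows "\<exists>P1 P2. \<forall>t\<in>S. (P has_vector_derivative P1 t) (at t within S) \<and>
     (P1 has_vector_derivative P2 t) (at t within S) \<and>
     norm (P1 t) \<le> 3000 * c ^ 9 * w t * v t \<and> norm (P2 t) \<le> 3000 * c ^ 9 * w t * (v t)\<^sup>2"
proof -
  define Sg1 where "Sg1 t = G1 t * D t * adj (G t) + G t * (H1 t * D t) * adj (G t) + G t * D t * adj (G1 t) + X1 t" for t
  define Sg2 where "Sg2 t = G2 t * D t * adj (G t) + G t * (H2 t * D t) * adj (G t) + G t * D t * adj (G2 t)
        + 2 *\<^sub>R (G1 t * (H1 t * D t) * adj (G t) + G1 t * D t * adj (G1 t) + G t * (H1 t * D t) * adj (G1 t)) + X2 t" for t
  have adjG: "((\<lambda>t. adj (G t)) has_vector_derivative adj (G1 t)) (at t within S)"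
    "((\<lambda>t. adj (G1 t)) has_vector_derivative adj (G2 t)) (at t within S)" if "t \<in> S" for t
    using that by (auto intro: bounded_linear.has_vector_derivative[OF bounded_linear_adj] G1 G2)
  have dSg: "(Sg has_vector_derivative Sg1 t) (at t within S)" if t: "t \<in> S" for t
  proof (rule has_vector_derivative_transform[OF t Sg])
    have "((\<lambda>t. G t * D t * adj (G t) + X t) has_vector_derivative
        (G t * D t * adj (G1 t) + (G t * (H1 t * D t) + G1 t * D t) * adj (G t) + X1 t)) (at t within S)"
      by (intro has_vector_derivative_add has_vector_derivative_mult G1 D1 X1 adjG t)
    moreover have "G t * D t * adj (G1 t) + (G t * (H1 t * D t) + G1 t * D t) * adj (G t) + X1 t = Sg1 t"
      by (simp add: Sg1_def distrib_right)
    ultimately show "((\<lambda>t. G t * D t * adj (G t) + X t) has_vector_derivative Sg1 t) (at t within S)" by simp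
  qed
  have dSg1: "(Sg1 has_vector_derivative Sg2 t) (at t within S)" if t: "t \<in> S" for t
  proof -
    have "(Sg1 has_vector_derivative
        ((G1 t * D t * adj (G1 t) + (G1 t * (H1 t * D t) + G2 t * D t) * adj (G t))
        + (G t * (H1 t * D t) * adj (G1 t) + (G t * (H2 t * D t) + G1 t * (H1 t * D t)) * adj (G t))
        + (G t * D t * adj (G2 t) + (G t * (H1 t * D t) + G1 t * D t) * adj (G1 t)) + X2 t)) (at t within S)"
      unfolding Sg1_def
      by (intro has_vector_derivative_add has_vector_derivative_mult G1 G2 D1 D2 X2 adjG t)
    moreover have "(G1 t * D t * adj (G1 t) + (G1 t * (H1 t * D t) + G2 t * D t) * adj (G t))
        + (G t * (H1 t * D t) * adj (G1 t) + (G t * (H2 t * D t) + G1 t * (H1 t * D t)) * adj (G t))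
        + (G t * D t * adj (G2 t) + (G t * (H1 t * D t) + G1 t * D t) * adj (G1 t)) + X2 t = Sg2 t"
      by (simp add: Sg2_def scaleR_2 distrib_right)
    ultimately show ?thesis by simp
  qed
  obtain P1 P2 where P: "\<And>t. t \<in> S \<Longrightarrow> (P has_vector_derivative P1 t) (at t within S)"
     "\<And>t. t \<in> S \<Longrightarrow> (P1 has_vector_derivative P2 t) (at t within S)"
     "\<And>t. t \<in> S \<Longrightarrow> norm (P1 t) \<le> 4 * norm (a t * Sg1 t * R t)"
     "\<And>t. t \<in> S \<Longrightarrow> norm (P2 t) \<le> 4 * norm (a t * (Sg2 t + 2 *\<^sub>R (P1 t * Sg1 t) - 2 *\<^sub>R (Sg1 t * P1 t)) * R t)
       + 4 * (norm (P1 t))\<^sup>2"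
    using eigenprojection_twice_differentiable[OF dSg dSg1] by metis
  have "norm (P1 t) \<le> 3000 * c ^ 9 * w t * v t \<and> norm (P2 t) \<le> 3000 * c ^ 9 * w t * (v t)\<^sup>2" if t: "t \<in> S" for t
  proof -
    interpret factor_bounds "G t" "G1 t" "G2 t" "D t" "H1 t" "H2 t" "X1 t" "X2 t" "a t" "R t" "P1 t" "Sg1 t" "Sg2 t" c "v t" "w t"
      using vw[OF t] nG[OF t] nX[OF t] nD[OF t] P(3)[OF t]
      by unfold_locales (simp_all only: c commute[OF t] na[OF t] norm_R[OF t] DGR[OF t] aGD[OF t] Sg1_def Sg2_def)
    have "norm (P1 t) \<le> 16 * c ^ 4 * (w t * v t)" using norm_P1 by (simp add: mult.assoc)
    also have "\<dots> \<le> 3000 * c ^ 9 * (w t * v t)"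
      using vw[OF t] c power_increasing[of 4 9 c] by (intro mult_right_mono mult_mono) auto
    finally show ?thesis using norm_P2_le[OF P(4)[OF t]] by (simp add: mult.assoc)
  qed
  then show ?thesis using P(1,2) by blast
qed

text \<open>
  As \<open>P s = a s * Sg s\<close>, the product \<open>P s * R t\<close> contains \<open>a G D\<close> at \<open>s\<close>, which is bounded, times
  \<open>adj (G s) * R t\<close>.  At equal frequencies the latter is \<open>O(w)\<close>, and \<open>G\<close> is Lipschitz.
\<close>

lemma (in spectral_split) projection_increment_le:
  fixes G D X :: "real \<Rightarrow> fop" and w :: "real \<Rightarrow> real"
  assumes Sg: "\<And>t. t \<in> S \<Longrightarrow> Sg t = G t * D t * adj (G t) + X t"
    and c: "1 \<le> c" and w: "\<And>t. t \<in> S \<Longrightarrow> 0 \<le> w t"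
    and na: "\<And>t. t \<in> S \<Longrightarrow> norm (a t) \<le> c * w t" and nX: "\<And>t. t \<in> S \<Longrightarrow> norm (X t) \<le> c"
    and aGD: "\<And>t. t \<in> S \<Longrightarrow> norm (a t * G t * D t) \<le> c"
    and GR: "\<And>t. t \<in> S \<Longrightarrow> norm (adj (G t) * R t) \<le> c\<^sup>2 * w t"
    and lip: "\<And>s t. s \<in> S \<Longrightarrow> t \<in> S \<Longrightarrow> norm (G s - G t) \<le> c * \<bar>s - t\<bar>"
    and st: "s \<in> S" "t \<in> S"
  shows "norm (P s - P t) \<le> 2 * c ^ 3 * (w s + w t + \<bar>s - t\<bar>)"
proof -
  have *: "norm (P s * R t) \<le> c ^ 3 * (w s + w t + \<bar>s - t\<bar>)" if st: "s \<in> S" "t \<in> S" for s t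
  proof -
    have "P s * R t = a s * Sg s * R t" using st by (simp only: a_Sg)
    also have "\<dots> = a s * G s * D s * (adj (G t) * R t + adj (G s - G t) * R t) + a s * X s * R t"
      unfolding Sg[OF st(1)] by (simp add: algebra_simps)
    also have "norm \<dots> \<le> c * (c\<^sup>2 * w t + c * \<bar>s - t\<bar> * 1) + c * w s * c * 1"
      using st by (intro norm_triangle_mono norm_mult_le aGD GR na nX norm_R) (simp_all only: norm_adj lip)
    also have "\<dots> = c ^ 3 * w t + c\<^sup>2 * \<bar>s - t\<bar> + c\<^sup>2 * w s"
      by (simp add: eval_nat_numeral algebra_simps)
    also have "\<dots> \<le> c ^ 3 * w t + c ^ 3 * \<bar>s - t\<bar> + c ^ 3 * w s"
      using c w[OF st(1)] w[OF st(2)] power_increasing[of 2 3 c] by (intro add_mono mult_right_mono) auto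
    finally show ?thesis by (simp add: algebra_simps)
  qed
  have "norm (P s - P t) \<le> norm (P s * R t) + norm (P t * R s)" by (rule norm_P_diff_le[OF st(2,1)])
  also have "\<dots> \<le> c ^ 3 * (w s + w t + \<bar>s - t\<bar>) + c ^ 3 * (w t + w s + \<bar>t - s\<bar>)"
    by (intro add_mono * st)
  also have "\<dots> = 2 * c ^ 3 * (w s + w t + \<bar>s - t\<bar>)" by (simp add: algebra_simps abs_minus_commute)
  finally show ?thesis .
qed

text \<open>
  If \<open>g\<close> is bounded below on the range of \<open>T\<close>, then \<open>T\<close> is bounded as soon as \<open>g * T\<close> is.  This removes the
  factor \<open>G\<close> from \<open>G D G\<^sup>* R\<close> without inverting \<open>G\<^sup>* G\<close>.
\<close>

lemma coercive_cancel:
  assumes coercive: "\<And>y. (\<And>i. i \<ge> q \<Longrightarrow> coord y i = 0) \<Longrightarrow> \<sigma> * norm y \<le> norm (fapp g y)" and \<sigma>: "0 < \<sigma>"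
    and T: "\<And>x i. i \<ge> q \<Longrightarrow> coord (fapp T x) i = 0" and b: "norm (g * T) \<le> b"
  shows "norm T \<le> b / \<sigma>"
proof (rule norm_fop_bound)
  show "0 \<le> b / \<sigma>" using b \<sigma> norm_ge_zero[of "g * T"] by (intro divide_nonneg_pos) linarith+
  fix x
  have "\<sigma> * norm (fapp T x) \<le> norm (fapp g (fapp T x))" by (rule coercive) (rule T)
  also have "\<dots> = norm (fapp (g * T) x)" by simp
  also have "\<dots> \<le> norm (g * T) * norm x" by (rule norm_fapp)
  also have "\<dots> \<le> b * norm x" by (intro mult_right_mono b) auto
  finally show "norm (fapp T x) \<le> b / \<sigma> * norm x" using \<sigma> by (simp add: field_simps)
qed

lemma diag_op_has_vector_derivative:
  assumes "\<And>l. l < q \<Longrightarrow> ((\<lambda>t. f t l) has_real_derivative f' l) (at \<theta> within S)"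
  shows "((\<lambda>t. diag_op q (f t)) has_vector_derivative diag_op q f') (at \<theta> within S)"
  unfolding diag_op_def
  by (intro has_vector_derivative_sum bounded_linear.has_vector_derivative[OF bounded_linear_unit_op]
      bounded_linear.has_vector_derivative[OF bounded_linear_of_real])
    (use assms in \<open>simp add: has_real_derivative_iff_has_vector_derivative\<close>)

lemma punctured_freqs_limit_point:
  assumes t: "t \<in> freqs - {0}" shows "at t within (freqs - {0}) \<noteq> bot"
  unfolding trivial_limit_within islimpt_approachable not_not
proof (intro allI impI)
  fix e :: real assume e: "0 < e"
  \<comment> \<open>A point slightly to the left of \<open>t\<close>, short of 0 or of \<open>- pi\<close>.\<close>
  define h where "h = min (e / 2) ((if 0 < t then t else t + pi) / 2)"
  have h: "0 < h" "h < e" "h \<le> (if 0 < t then t else t + pi) / 2" using e t by (auto simp: h_def min_def)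
  show "\<exists>x'\<in>freqs - {0}. x' \<noteq> t \<and> dist x' t < e"
    using h t pi_gt_zero by (intro bexI[of _ "t - h"]) (auto simp: dist_real_def split: if_splits)
qed

abbreviation leading_projection :: "nat \<Rightarrow> nat \<Rightarrow> (nat \<Rightarrow> complex Matrix.vec) \<Rightarrow> fop" where
  "leading_projection q n p \<equiv> spectral_sum n (eigen_op n p) (\<lambda>j. if j < q then 1 else 0)"

text \<open>
  The abstract estimates are applied to the embedded matrices divided by \<open>n\<close> (and \<open>G\<close> by \<open>sqrt n\<close>), which
  leaves the projection unchanged and removes \<open>n\<close> from all bounds.
  
  The summands of \<open>c\<close> bound, in order, the scalar constants, the given matrix bounds \<open>c0\<close> and \<open>\<kappa>\<close>, the
  partial inverse \<open>a\<close>, the product \<open>D G\<^sup>* R\<close> and the product \<open>a G D\<close>.  The condition \<open>large\<close> keeps the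
  leading eigenvalues above half of what \<open>G D G\<^sup>*\<close> contributes, and the norm of \<open>Y \<mapsto> a Y K\<close> at most 1/2.
\<close>

lemma leading_projection_bounds:
  fixes n q :: nat and Gm G1m G2m Xm X1m X2m Sig :: "real \<Rightarrow> complex mat"
    and lam :: "real \<Rightarrow> nat \<Rightarrow> real" and p :: "real \<Rightarrow> nat \<Rightarrow> complex Matrix.vec" and df :: "nat \<Rightarrow> real"
  defines "S \<equiv> freqs - {0}"
  assumes q: "1 \<le> q" "q < n"
    and Gc: "\<And>t. t \<in> freqs \<Longrightarrow> Gm t \<in> carrier_mat n q"
    and Xc: "\<And>t. t \<in> freqs \<Longrightarrow> Xm t \<in> carrier_mat n n"
    and sys: "\<And>t. t \<in> S \<Longrightarrow> row_eigensystem n (Sig t) (lam t) (p t)"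
    and dec: "\<And>t. t \<in> S \<Longrightarrow> Sig t = Gm t * mat_diag q (\<lambda>l. complex_of_real (cmod (1 - cis (- t)) powr (- 2 * df l)))
        * mat_adjoint (Gm t) + Xm t"
    and df: "\<And>l. l < q \<Longrightarrow> \<delta> \<le> 2 * df l \<and> df l < 1 / 2" and \<delta>: "0 < \<delta>"
    and coercive: "\<And>t y. t \<in> freqs \<Longrightarrow> (\<And>i. i \<ge> q \<Longrightarrow> coord y i = 0) \<Longrightarrow>
        sqrt (s * real n) * norm y \<le> norm (fapp (mat_op (Gm t)) y)" and s: "0 < s"
    and nG: "\<And>t. t \<in> freqs \<Longrightarrow> norm (mat_op (Gm t)) \<le> c0 * sqrt (real n)"
    and G1: "\<And>t. t \<in> freqs \<Longrightarrow> has_mat_deriv Gm (G1m t) t \<and> opnorm (G1m t) \<le> c0 * sqrt (real n)"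
    and G2: "\<And>t. t \<in> freqs \<Longrightarrow> has_mat_deriv G1m (G2m t) t \<and> opnorm (G2m t) \<le> c0 * sqrt (real n)"
    and lip: "\<And>t u. t \<in> freqs \<Longrightarrow> u \<in> freqs \<Longrightarrow> norm (mat_op (Gm t) - mat_op (Gm u)) \<le> c0 * sqrt (real n) * \<bar>t - u\<bar>"
    and nX: "\<And>t. t \<in> S \<Longrightarrow> norm (mat_op (Xm t)) \<le> \<kappa>"
    and X1: "\<And>t. t \<in> freqs \<Longrightarrow> has_mat_deriv Xm (X1m t) t \<and> opnorm (X1m t) \<le> c0"
    and X2: "\<And>t. t \<in> freqs \<Longrightarrow> has_mat_deriv X1m (X2m t) t \<and> opnorm (X2m t) \<le> c0"
    and large: "32 * \<kappa> \<le> s * real n"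
    and c: "c = 100 + c0 + \<kappa> + 16 / s + 2 * \<kappa> / sqrt s + (1 + 16 / s * \<kappa>) / sqrt s"
  shows "(\<exists>P1 P2. \<forall>t\<in>S. ((\<lambda>t. leading_projection q n (p t)) has_vector_derivative P1 t) (at t within S) \<and>
           (P1 has_vector_derivative P2 t) (at t within S) \<and>
           norm (P1 t) \<le> 3000 * c ^ 9 * \<bar>t\<bar> powr \<delta> * (1 / \<bar>t\<bar>) \<and>
           norm (P2 t) \<le> 3000 * c ^ 9 * \<bar>t\<bar> powr \<delta> * (1 / \<bar>t\<bar>)\<^sup>2) \<and>
         (\<forall>t\<in>S. \<forall>u\<in>S. norm (leading_projection q n (p t) - leading_projection q n (p u))
            \<le> 2 * c ^ 3 * (\<bar>t\<bar> powr \<delta> + \<bar>u\<bar> powr \<delta> + \<bar>t - u\<bar>))"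
proof -
  have S: "t \<in> freqs" if "t \<in> S" for t using that by (simp add: S_def)
  have one: "1 \<in> S" using pi_gt3 by (simp add: S_def)
  have n: "0 < real n" "1 \<le> real n" using q by auto
  have \<kappa>: "0 \<le> \<kappa>" using order_trans[OF norm_ge_zero nX[OF one]] .
  have c0: "0 \<le> c0" using order_trans[OF norm_ge_zero order_trans[OF norm_mat_op_le_opnorm]] X1[OF S[OF one]] by blast
  have c_parts: "0 \<le> 16 / s" "0 \<le> 2 * \<kappa> / sqrt s" "0 \<le> (1 + 16 / s * \<kappa>) / sqrt s" using s \<kappa> by auto
  have c_ge: "100 \<le> c" "c0 \<le> c" "\<kappa> \<le> c" "16 / s \<le> c" "2 * \<kappa> / sqrt s \<le> c" "(1 + 16 / s * \<kappa>) / sqrt s \<le> c"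
    using c_parts c0 \<kappa> unfolding c by linarith+
  have \<delta>1: "\<delta> \<le> 1" using df[of 0] q by auto
  have d0: "0 \<le> df l" "df l < 1 / 2" "\<delta> \<le> 2 * df l" if "l < q" for l using df[OF that] \<delta> by auto
  define w v where "w t = \<bar>t\<bar> powr \<delta>" and "v t = 1 / \<bar>t\<bar>" for t :: real
  have wv: "0 < w t" "w t \<le> 4" "0 < v t" "1 \<le> c * v t" "1 \<le> c * v t * w t" if t: "t \<in> S" for t
  proof -
    have t': "t \<in> freqs - {0}" using t by (simp add: S_def)
    have abs: "0 < \<bar>t\<bar>" "\<bar>t\<bar> \<le> pi" using t' by auto
    show "0 < w t" "0 < v t" using abs by (auto simp: w_def v_def)
    show "w t \<le> 4" using powr_theta_le_pi[OF t', of \<delta>] \<delta> \<delta>1 pi_less_4 by (simp add: w_def)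
    have "1 \<le> 4 * v t" using abs pi_less_4 by (simp add: v_def divide_simps)
    also have "\<dots> \<le> c * v t" using c_ge \<open>0 < v t\<close> by (intro mult_right_mono) auto
    finally show "1 \<le> c * v t" .
    have "\<bar>t\<bar> powr (1 - \<delta>) \<le> 4" using powr_theta_le_pi[OF t', of "1 - \<delta>"] \<delta> \<delta>1 pi_less_4 by simp
    moreover have "v t * w t * \<bar>t\<bar> powr (1 - \<delta>) = 1"
      using abs by (simp add: v_def w_def powr_add[symmetric])
    ultimately have "1 \<le> v t * w t * 4"
      using mult_left_mono[of "\<bar>t\<bar> powr (1 - \<delta>)" 4 "v t * w t"] \<open>0 < w t\<close> \<open>0 < v t\<close> by simp
    also have "\<dots> \<le> v t * w t * c" using c_ge \<open>0 < w t\<close> \<open>0 < v t\<close> by (intro mult_left_mono) auto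
    finally show "1 \<le> c * v t * w t" by (simp add: mult_ac)
  qed
  define E where "E t = eigen_op n (p t)" for t
  define \<phi> where "\<phi> t l = sqdist t powr (- df l)" for t l
  define Sg where "Sg t = (1 / real n) *\<^sub>R mat_op (Sig t)" for t
  define G where "G t = (1 / sqrt (real n)) *\<^sub>R mat_op (Gm t)" for t
  define D where "D t = diag_op q (\<phi> t)" for t
  define X where "X t = (1 / real n) *\<^sub>R mat_op (Xm t)" for t
  define P where "P t = leading_projection q n (p t)" for t
  define a where "a t = spectral_sum n (E t) (\<lambda>j. if j < q then real n / lam t j else 0)" for t
  have Sigc: "Sig t \<in> carrier_mat n n" if "t \<in> S" for t
    unfolding dec[OF that] using Gc[OF S[OF that]] Xc[OF S[OF that]] by (auto simp: mat_diag_def)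
  have opSig: "mat_op (Sig t) = mat_op (Gm t) * D t * adj (mat_op (Gm t)) + mat_op (Xm t)" if t: "t \<in> S" for t
  proof -
    let ?d = "mat_diag q (\<lambda>l. complex_of_real (cmod (1 - cis (- t)) powr (- 2 * df l)))"
    have G: "Gm t \<in> carrier_mat n q" by (rule Gc[OF S[OF t]])
    have d: "?d \<in> carrier_mat q q" by (simp add: mat_diag_def)
    have G': "mat_adjoint (Gm t) \<in> carrier_mat q n" using G by (intro carrier_matI) auto
    have D: "mat_op ?d = D t" unfolding mat_op_diag D_def by (rule diag_op_cong) (simp only: cmod_powr_eq \<phi>_def)
    have "mat_op (Sig t) = mat_op (Gm t * ?d * mat_adjoint (Gm t)) + mat_op (Xm t)"
      unfolding dec[OF t] by (rule mat_op_add[OF mult_carrier_mat[OF mult_carrier_mat[OF G d] G'] Xc[OF S[OF t]]])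
    then show ?thesis by (simp only: mat_op_mult[OF mult_carrier_mat[OF G d] G'] mat_op_mult[OF G d] mat_op_adjoint D)
  qed
  have Sg: "Sg t = G t * D t * adj (G t) + X t" if t: "t \<in> S" for t
    using n by (simp add: Sg_def G_def X_def opSig[OF t] scaleR_add_right)
  have \<phi>_pos: "0 < \<phi> t l" if "t \<in> S" for t l using sqdist_pos[of t] that by (simp add: \<phi>_def S_def)
  have \<phi>_ge: "1 / (2 * w t) \<le> \<phi> t l" if "t \<in> S" "l < q" for t l
    using sqdist_powr_ge[OF _ d0(1,2)[OF that(2)] \<delta> d0(3)[OF that(2)]] that by (simp add: S_def \<phi>_def w_def)
  have \<phi>_le: "\<phi> t l \<le> c * v t" if t: "t \<in> S" "l < q" for t l
  proof -
    have "\<phi> t l \<le> 2 * pi * (1 / \<bar>t\<bar>)"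
      using sqdist_powr_le[OF _ d0(1,2)[OF t(2)]] t(1) unfolding \<phi>_def S_def by blast
    also have "\<dots> \<le> c * (1 / \<bar>t\<bar>)" using c_ge pi_less_4 by (intro mult_right_mono) auto
    finally show ?thesis by (simp add: v_def)
  qed
  have fes: "factor_eigensystem n q (Sig t) (Gm t) (lam t) (p t) (\<phi> t) (mat_op (Xm t)) \<kappa> (1 / (2 * w t))"
    if t: "t \<in> S" for t
    using wv[OF t] opSig[OF t] \<phi>_ge[OF t] q
    by unfold_locales (auto simp: sys[OF t] Sigc[OF t] Gc[OF S[OF t]] nX[OF t] D_def)
  \<comment> \<open>\<open>w t \<le> pi < 4\<close>, so \<open>large\<close> lets half of \<open>s * n / (2 * w t)\<close> absorb \<open>\<kappa>\<close>.\<close>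
  have lam_large: "s * real n / (4 * w t) \<le> lam t j" if t: "t \<in> S" and j: "j < q" for t j
  proof -
    have "1 / (2 * w t) * (sqrt (s * real n))\<^sup>2 - \<kappa> \<le> lam t j"
      by (rule factor_eigensystem.upper_eigenvalues_large[OF fes[OF t] coercive[OF S[OF t]] _ j]) (use s n in auto)
    then have 1: "s * real n / (2 * w t) - \<kappa> \<le> lam t j" using s n by simp
    have "s * real n / 16 \<le> s * real n / (4 * w t)"
      using wv(1,2)[OF t] s n by (intro divide_left_mono) auto
    then have "\<kappa> \<le> s * real n / (4 * w t)" using large \<kappa> by linarith
    moreover have "s * real n / (2 * w t) = s * real n / (4 * w t) + s * real n / (4 * w t)"
      using wv(1)[OF t] by (simp add: field_simps)
    ultimately show ?thesis using 1 by linarith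
  qed
  have lam_pos: "0 < lam t j" if t: "t \<in> S" and j: "j < q" for t j
  proof -
    have "0 < s * real n / (4 * w t)" using s n wv(1)[OF t] by simp
    then show ?thesis using lam_large[OF t j] by linarith
  qed
  have inv_lam: "\<bar>real n / lam t j\<bar> \<le> 4 / s * w t" if t: "t \<in> S" and j: "j < q" for t j
  proof -
    have "s * real n / (4 * w t) * (4 / s * w t) \<le> lam t j * (4 / s * w t)"
      using s wv(1)[OF t] by (intro mult_right_mono lam_large[OF t j]) auto
    then have "real n \<le> lam t j * (4 / s * w t)" using s wv(1)[OF t] by simp
    then show ?thesis using lam_pos[OF t j] n by (simp add: abs_of_pos divide_le_eq mult.commute)
  qed
  have lam_small: "\<bar>lam t k / real n\<bar> \<le> \<kappa> / real n" if t: "t \<in> S" and k: "q \<le> k" "k < n" for t k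
    using factor_eigensystem.lower_eigenvalues_bounded[OF fes[OF t] k] n by (simp add: abs_divide divide_right_mono)
  have Eproj: "orthogonal_projections n (E t)" if t: "t \<in> S" for t
    unfolding E_def by (rule eigen_op_projections[OF sys[OF t] Sigc[OF t]])
  have Sg_sum: "Sg t = spectral_sum n (E t) (\<lambda>j. lam t j / real n)" if t: "t \<in> S" for t
    unfolding Sg_def E_def eigen_decomposition[OF sys[OF t] Sigc[OF t]]
    by (simp add: spectral_sum_def scaleR_sum_right)
  have P_sum: "P t = spectral_sum n (E t) (\<lambda>j. if j < q then 1 else 0)" for t by (simp add: P_def E_def)
  have cong: "spectral_sum n (E t) f = spectral_sum n (E t) h" if "\<And>j. j < n \<Longrightarrow> f j = h j" for t f h
    unfolding spectral_sum_def using that by (intro sum.cong) auto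
  have K_sum: "Sg t * (1 - P t) = spectral_sum n (E t) (\<lambda>j. if j < q then 0 else lam t j / real n)" if t: "t \<in> S" for t
  proof -
    have "Sg t * (1 - P t) = Sg t - Sg t * P t" by (simp add: right_diff_distrib)
    also have "\<dots> = spectral_sum n (E t) (\<lambda>j. lam t j / real n - lam t j / real n * (if j < q then 1 else 0))"
      unfolding Sg_sum[OF t] P_sum spectral_sum_mult[OF Eproj[OF t]]
      by (simp add: spectral_sum_def sum_subtractf scaleR_diff_left)
    also have "\<dots> = spectral_sum n (E t) (\<lambda>j. if j < q then 0 else lam t j / real n)" by (rule cong) simp
    finally show ?thesis .
  qed
  have norm_a_w: "norm (a t) \<le> 4 / s * w t" if t: "t \<in> S" for t
    unfolding a_def using s wv(1)[OF t] inv_lam[OF t] by (intro norm_spectral_sum_le[OF Eproj[OF t]]) auto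
  have norm_a_const: "norm (a t) \<le> 16 / s" if t: "t \<in> S" for t
  proof -
    have "4 / s * w t \<le> 4 / s * 4" using s wv(2)[OF t] by (intro mult_left_mono) auto
    then show ?thesis using norm_a_w[OF t] by simp
  qed
  have norm_Sg_R: "norm (Sg t * (1 - P t)) \<le> \<kappa> / real n" if t: "t \<in> S" for t
    unfolding K_sum[OF t] using \<kappa> n lam_small[OF t] by (intro norm_spectral_sum_le[OF Eproj[OF t]]) auto
  have gap: "16 / s * (\<kappa> / real n) \<le> 1 / 2" using large s n by (simp add: field_simps)
  interpret spectral_split S Sg P a "16 / s"
  proof
    fix t assume t: "t \<in> S"
    note mult = spectral_sum_mult[OF Eproj[OF t]] and adj = adj_spectral_sum[OF Eproj[OF t]]
    show "at t within S \<noteq> bot" using punctured_freqs_limit_point t unfolding S_def by blast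
    show "adj (Sg t) = Sg t" "adj (P t) = P t" "adj (a t) = a t"
      by (simp_all only: Sg_sum[OF t] P_sum a_def adj)
    show "P t * P t = P t" unfolding P_sum mult by (rule cong) simp
    show "Sg t * P t = P t * Sg t" unfolding P_sum Sg_sum[OF t] mult by (rule cong) simp
    show "a t * P t = a t" unfolding P_sum a_def mult by (rule cong) simp
    show "a t * Sg t = P t" unfolding P_sum Sg_sum[OF t] a_def mult
      using n lam_pos[OF t] by (intro cong) (auto simp: less_imp_neq[symmetric])
    show "norm (a t) \<le> 16 / s" by (rule norm_a_const[OF t])
    have "16 / s * norm (Sg t * (1 - P t)) \<le> 16 / s * (\<kappa> / real n)"
      using s by (intro mult_left_mono norm_Sg_R[OF t]) auto
    then show "16 / s * norm (Sg t * (1 - P t)) \<le> 1 / 2" using gap by linarith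
    fix C show "\<exists>Z. Z = C + a t * Z * (Sg t * (1 - P t))"
      unfolding K_sum[OF t] a_def
    proof (rule spectral_sum_sylvester_solvable[OF Eproj[OF t]])
      fix j k assume jk: "j < n" "k < n"
      show "(if j < q then real n / lam t j else 0) * (if k < q then 0 else lam t k / real n) \<noteq> 1"
      proof (cases "j < q \<and> \<not> k < q")
        case True
        have "\<bar>real n / lam t j\<bar> * \<bar>lam t k / real n\<bar> \<le> 16 / s * (\<kappa> / real n)"
        proof (intro mult_mono)
          show "\<bar>real n / lam t j\<bar> \<le> 16 / s"
          proof -
            have "4 / s * w t \<le> 4 / s * 4" using s wv(2)[OF t] by (intro mult_left_mono) auto
            then show ?thesis using inv_lam[OF t, of j] True by simp
          qed
          show "\<bar>lam t k / real n\<bar> \<le> \<kappa> / real n" using lam_small[OF t, of k] True jk by simp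
        qed (use s in auto)
        then have "\<bar>real n / lam t j * (lam t k / real n)\<bar> \<le> 1 / 2" using gap by (simp only: abs_mult)
        then have "real n / lam t j * (lam t k / real n) \<noteq> 1" by linarith
        then show ?thesis using True by simp
      qed auto
    qed
  qed
  have norm_X: "norm (X t) \<le> \<kappa> / real n" "norm (X t) \<le> \<kappa>" if t: "t \<in> S" for t
  proof -
    show 1: "norm (X t) \<le> \<kappa> / real n" using nX[OF t] n by (simp add: X_def divide_right_mono)
    have "\<kappa> / real n \<le> \<kappa> / 1" using n \<kappa> by (intro divide_left_mono) auto
    then show "norm (X t) \<le> \<kappa>" using 1 by simp
  qed
  have \<sigma>: "sqrt s * norm y \<le> norm (fapp (G t) y)" if t: "t \<in> S" and y: "\<And>i. i \<ge> q \<Longrightarrow> coord y i = 0" for t y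
  proof -
    have "sqrt (s * real n) * norm y \<le> norm (fapp (mat_op (Gm t)) y)" by (rule coercive[OF S[OF t] y])
    then have "sqrt (s * real n) * norm y / sqrt (real n) \<le> norm (fapp (mat_op (Gm t)) y) / sqrt (real n)"
      by (rule divide_right_mono) simp
    then show ?thesis using n by (simp add: G_def real_sqrt_mult)
  qed
  have D_range: "coord (fapp (D t * T) x) i = 0" if "i \<ge> q" for t T x i
    using that by (simp add: D_def coord_diag_op)
  have GDG: "G t * (D t * adj (G t) * T) = Sg t * T - X t * T" if t: "t \<in> S" for t T
    unfolding Sg[OF t] by (simp add: algebra_simps)
  have DGR: "norm (D t * adj (G t) * R t) \<le> 2 * \<kappa> / sqrt s" if t: "t \<in> S" for t
  proof (rule coercive_cancel[where g = "G t" and q = q])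
    show "sqrt s * norm y \<le> norm (fapp (G t) y)" if "\<And>i. i \<ge> q \<Longrightarrow> coord y i = 0" for y by (rule \<sigma>[OF t that])
    show "0 < sqrt s" using s by simp
    show "coord (fapp (D t * adj (G t) * R t) x) i = 0" if "i \<ge> q" for x i
      unfolding mult.assoc by (rule D_range[OF that])
    have "\<kappa> / real n \<le> \<kappa> / 1" using n \<kappa> by (intro divide_left_mono) auto
    then have 1: "norm (Sg t * R t) \<le> \<kappa>" using norm_Sg_R[OF t] by simp
    have 2: "norm (X t * R t) \<le> \<kappa> * 1" by (intro norm_mult_le norm_X norm_R t)
    show "norm (G t * (D t * adj (G t) * R t)) \<le> 2 * \<kappa>"
      unfolding GDG[OF t] using norm_triangle_ineq4[of "Sg t * R t" "X t * R t"] 1 2 by linarith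
  qed
  have DGa: "norm (D t * adj (G t) * a t) \<le> (1 + 16 / s * \<kappa>) / sqrt s" if t: "t \<in> S" for t
  proof (rule coercive_cancel[where g = "G t" and q = q])
    show "sqrt s * norm y \<le> norm (fapp (G t) y)" if "\<And>i. i \<ge> q \<Longrightarrow> coord y i = 0" for y by (rule \<sigma>[OF t that])
    show "0 < sqrt s" using s by simp
    show "coord (fapp (D t * adj (G t) * a t) x) i = 0" if "i \<ge> q" for x i
      unfolding mult.assoc by (rule D_range[OF that])
    have 2: "norm (X t * a t) \<le> \<kappa> * (16 / s)" by (intro norm_mult_le norm_X norm_a_const t)
    have "norm (Sg t * a t) \<le> 1" unfolding Sg_a[OF t] by (rule norm_P[OF t])
    then show "norm (G t * (D t * adj (G t) * a t)) \<le> 1 + 16 / s * \<kappa>"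
      unfolding GDG[OF t] using norm_triangle_ineq4[of "Sg t * a t" "X t * a t"] 2 by (simp add: mult.commute)
  qed
  have aGD: "norm (a t * G t * D t) \<le> c" if t: "t \<in> S" for t
  proof -
    have "a t * G t * D t = adj (D t * adj (G t) * a t)" using adj_a[OF t] by (simp add: D_def adj_diag_op mult.assoc)
    then have "norm (a t * G t * D t) = norm (D t * adj (G t) * a t)" by (simp only: norm_adj)
    then show ?thesis using DGa[OF t] c_ge by linarith
  qed
  have c1: "1 \<le> c" using c_ge by linarith
  have na: "norm (a t) \<le> c * w t" if t: "t \<in> S" for t
  proof -
    have "4 / s \<le> 16 / s" using s by (simp add: divide_right_mono)
    then have "4 / s * w t \<le> c * w t" using c_ge wv(1)[OF t] by (intro mult_right_mono) linarith+
    then show ?thesis using norm_a_w[OF t] by linarith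
  qed
  have GR: "norm (adj (G t) * R t) \<le> c\<^sup>2 * w t" if t: "t \<in> S" for t
  proof -
    have adjG: "mat_adjoint (Gm t) \<in> carrier_mat q n" using Gc[OF S[OF t]] by (intro carrier_matI) auto
    have "diag_op q (\<lambda>l. 1 / \<phi> t l) * D t = diag_op q (\<lambda>_. 1)"
      unfolding D_def diag_op_mult using \<phi>_pos[OF t] by (intro diag_op_cong) (simp add: less_imp_neq[symmetric])
    moreover have "diag_op q (\<lambda>_. 1) * adj (G t) = adj (G t)"
      using diag_op_one_mat_op[OF adjG] by (simp add: G_def mat_op_adjoint)
    ultimately have "adj (G t) * R t = diag_op q (\<lambda>l. 1 / \<phi> t l) * (D t * adj (G t) * R t)"
      by (metis mult.assoc)
    moreover have "norm (diag_op q (\<lambda>l. 1 / \<phi> t l)) \<le> 2 * w t"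
    proof (rule norm_diag_op_le)
      fix l assume l: "l < q"
      have "0 < 1 / (2 * w t)" using wv(1)[OF t] by simp
      then have "1 / \<phi> t l \<le> 1 / (1 / (2 * w t))" using \<phi>_ge[OF t l] \<phi>_pos[OF t] by (intro divide_left_mono) auto
      then show "\<bar>1 / \<phi> t l\<bar> \<le> 2 * w t" using \<phi>_pos[OF t, of l] by simp
    qed (use wv(1)[OF t] in simp)
    ultimately have "norm (adj (G t) * R t) \<le> 2 * w t * c"
      using DGR[OF t] c_ge by (simp only:) (intro norm_mult_le; linarith)
    also have "\<dots> \<le> c * w t * c" using c_ge wv(1)[OF t] by (intro mult_right_mono) auto
    finally show ?thesis by (simp add: power2_eq_square mult_ac)
  qed
  have scaled: "norm ((1 / sqrt (real n)) *\<^sub>R T) \<le> b" if "norm T \<le> b * sqrt (real n)" for T :: fop and b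
    using that n by (simp add: divide_le_eq)
  have nG': "norm (G t) \<le> c" if t: "t \<in> S" for t
    unfolding G_def using scaled[OF nG[OF S[OF t]]] c_ge by linarith
  have lipG: "norm (G t - G u) \<le> c * \<bar>t - u\<bar>" if tu: "t \<in> S" "u \<in> S" for t u
  proof -
    have "norm (mat_op (Gm t) - mat_op (Gm u)) \<le> c0 * \<bar>t - u\<bar> * sqrt (real n)"
      using lip[OF S[OF tu(1)] S[OF tu(2)]] by (simp add: mult_ac)
    from scaled[OF this] have "norm (G t - G u) \<le> c0 * \<bar>t - u\<bar>" by (simp add: G_def scaleR_diff_right[symmetric])
    also have "\<dots> \<le> c * \<bar>t - u\<bar>" using c_ge by (intro mult_right_mono) auto
    finally show ?thesis .
  qed
  have increment: "norm (P t - P u) \<le> 2 * c ^ 3 * (w t + w u + \<bar>t - u\<bar>)" if tu: "t \<in> S" "u \<in> S" for t u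
  proof (rule projection_increment_le[where G = G and D = D and X = X, OF Sg c1 _ na _ aGD GR lipG tu])
    show "0 \<le> w t" if "t \<in> S" for t using wv(1)[OF that] by simp
    show "norm (X t) \<le> c" if "t \<in> S" for t using norm_X(2)[OF that] c_ge by linarith
  qed
  have dims: "G1m t \<in> carrier_mat n q" "X1m t \<in> carrier_mat n n" if "t \<in> freqs" for t
    using G1[OF that] X1[OF that] Gc[OF that] Xc[OF that] by (auto simp: has_mat_deriv_def)
  have sub: "S \<subseteq> freqs" by (auto simp: S_def)
  define H1 where "H1 t = diag_op q (\<lambda>l. rate1 (df l) t)" for t
  define H2 where "H2 t = diag_op q (\<lambda>l. rate2 (df l) t)" for t
  have H1D: "H1 t * D t = diag_op q (\<lambda>l. rate1 (df l) t * sqdist t powr (- df l))"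
    and H2D: "H2 t * D t = diag_op q (\<lambda>l. rate2 (df l) t * sqdist t powr (- df l))"
    and comm: "H1 t * D t = D t * H1 t" for t
    by (simp_all only: H1_def H2_def D_def \<phi>_def[abs_def] diag_op_mult mult.commute)
  have "\<exists>P1 P2. \<forall>t\<in>S. (P has_vector_derivative P1 t) (at t within S) \<and>
     (P1 has_vector_derivative P2 t) (at t within S) \<and>
     norm (P1 t) \<le> 3000 * c ^ 9 * w t * v t \<and> norm (P2 t) \<le> 3000 * c ^ 9 * w t * (v t)\<^sup>2"
  proof (rule factor_derivative_bounds[where G = G and D = D and X = X and ?H1.0 = H1 and ?H2.0 = H2
        and ?G1.0 = "\<lambda>t. (1 / sqrt (real n)) *\<^sub>R mat_op (G1m t)" and ?G2.0 = "\<lambda>t. (1 / sqrt (real n)) *\<^sub>R mat_op (G2m t)"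
        and ?X1.0 = "\<lambda>t. (1 / real n) *\<^sub>R mat_op (X1m t)" and ?X2.0 = "\<lambda>t. (1 / real n) *\<^sub>R mat_op (X2m t)",
        OF Sg _ _ _ _ _ _ c1 _ _ _ _ comm na _ aGD])
    fix t assume t: "t \<in> S"
    have tf: "t \<in> freqs" and t': "t \<in> freqs - {0}" using t by (auto simp: S_def)
    have scale: "((\<lambda>t. r *\<^sub>R f t) has_vector_derivative r *\<^sub>R f') (at t within S)"
      if "(f has_vector_derivative f') (at t within freqs)" for f f' and r :: real
      using bounded_linear.has_vector_derivative[OF bounded_linear_scaleR_right
          has_vector_derivative_within_subset[OF that sub]] .
    show "(G has_vector_derivative (1 / sqrt (real n)) *\<^sub>R mat_op (G1m t)) (at t within S)"
      unfolding G_def by (rule scale[OF mat_op_has_vector_derivative[where F = Gm, OF conjunct1[OF G1[OF tf]] tf Gc]])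
    show "((\<lambda>t. (1 / sqrt (real n)) *\<^sub>R mat_op (G1m t)) has_vector_derivative (1 / sqrt (real n)) *\<^sub>R mat_op (G2m t)) (at t within S)"
      by (rule scale[OF mat_op_has_vector_derivative[where F = G1m, OF conjunct1[OF G2[OF tf]] tf dims(1)]])
    show "(X has_vector_derivative (1 / real n) *\<^sub>R mat_op (X1m t)) (at t within S)"
      unfolding X_def by (rule scale[OF mat_op_has_vector_derivative[where F = Xm, OF conjunct1[OF X1[OF tf]] tf Xc]])
    show "((\<lambda>t. (1 / real n) *\<^sub>R mat_op (X1m t)) has_vector_derivative (1 / real n) *\<^sub>R mat_op (X2m t)) (at t within S)"
      by (rule scale[OF mat_op_has_vector_derivative[where F = X1m, OF conjunct1[OF X2[OF tf]] tf dims(2)]])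
    show "(D has_vector_derivative H1 t * D t) (at t within S)"
      unfolding H1D unfolding D_def \<phi>_def[abs_def]
      by (rule diag_op_has_vector_derivative) (rule powr_has_derivative[OF t'])
    show "((\<lambda>t. H1 t * D t) has_vector_derivative H2 t * D t) (at t within S)"
      unfolding H1D H2D by (rule diag_op_has_vector_derivative) (rule rate1_powr_has_derivative[OF t'])
    show "0 < v t \<and> 0 < w t \<and> w t \<le> c \<and> 1 \<le> c * v t \<and> 1 \<le> c * v t * w t"
      using wv[OF t] c_ge by linarith
    have "norm ((1 / sqrt (real n)) *\<^sub>R mat_op (G1m t)) \<le> c0" "norm ((1 / sqrt (real n)) *\<^sub>R mat_op (G2m t)) \<le> c0"
      using order_trans[OF norm_mat_op_le_opnorm] G1[OF tf] G2[OF tf] by (blast intro: scaled)+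
    then show "norm (G t) \<le> c \<and> norm ((1 / sqrt (real n)) *\<^sub>R mat_op (G1m t)) \<le> c \<and> norm ((1 / sqrt (real n)) *\<^sub>R mat_op (G2m t)) \<le> c"
      using nG'[OF t] c_ge by linarith
    have "norm ((1 / real n) *\<^sub>R T) \<le> c0" if "norm T \<le> c0" for T :: fop
    proof -
      have "norm T / real n \<le> c0 / 1" using that n c0 by (intro frac_le) auto
      then show ?thesis by simp
    qed
    then have "norm ((1 / real n) *\<^sub>R mat_op (X1m t)) \<le> c0" "norm ((1 / real n) *\<^sub>R mat_op (X2m t)) \<le> c0"
      using order_trans[OF norm_mat_op_le_opnorm] X1[OF tf] X2[OF tf] by blast+
    then show "norm ((1 / real n) *\<^sub>R mat_op (X1m t)) \<le> c \<and> norm ((1 / real n) *\<^sub>R mat_op (X2m t)) \<le> c"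
      using c_ge by linarith
    have cv: "0 \<le> c * v t" "0 \<le> c * (v t)\<^sup>2" using wv[OF t] c_ge by auto
    have "norm (D t) \<le> c * v t"
      unfolding D_def using \<phi>_le[OF t] \<phi>_pos[OF t] cv by (intro norm_diag_op_le) (auto simp: abs_of_pos)
    moreover have "norm (H1 t) \<le> c * v t" unfolding H1_def
    proof (rule norm_diag_op_le[OF _ cv(1)])
      fix l assume l: "l < q"
      have "\<bar>rate1 (df l) t\<bar> \<le> 4 * v t" unfolding v_def by (rule abs_rate1_le[OF t' d0(1,2)[OF l]])
      also have "\<dots> \<le> c * v t" using c_ge wv[OF t] by (intro mult_right_mono) auto
      finally show "\<bar>rate1 (df l) t\<bar> \<le> c * v t" .
    qed
    moreover have "norm (H2 t) \<le> c * (v t)\<^sup>2" unfolding H2_def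
    proof (rule norm_diag_op_le[OF _ cv(2)])
      fix l assume l: "l < q"
      have "\<bar>rate2 (df l) t\<bar> \<le> 28 * (v t)\<^sup>2" unfolding v_def by (rule abs_rate2_le[OF t' d0(1,2)[OF l]])
      also have "\<dots> \<le> c * (v t)\<^sup>2" using c_ge by (intro mult_right_mono) auto
      finally show "\<bar>rate2 (df l) t\<bar> \<le> c * (v t)\<^sup>2" .
    qed
    ultimately show "norm (D t) \<le> c * v t \<and> norm (H1 t) \<le> c * v t \<and> norm (H2 t) \<le> c * (v t)\<^sup>2" by blast
    show "norm (D t * adj (G t) * R t) \<le> c" using DGR[OF t] c_ge by linarith
  qed
  then show ?thesis using increment unfolding P_def[abs_def] w_def v_def by blast
qed

section \<open>Rows of the eigenprojection\<close>

text \<open>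
  Distances between frequencies are below \<open>2 pi < 8\<close>; the constant 8 pays for lowering an exponent.
\<close>

lemma powr_le_8: "0 \<le> x \<Longrightarrow> x \<le> 8 \<Longrightarrow> 0 \<le> e \<Longrightarrow> e \<le> 1 \<Longrightarrow> x powr e \<le> (8::real)"
  using powr_mono2[of e x 8] powr_mono[of e 1 8] by simp

text \<open>
  Let \<open>h\<close> be the distance of the two frequencies.  If both lie within \<open>2 h\<close> of 0, the increment bound is
  already of order \<open>h powr \<delta>\<close>.  Otherwise they have the same sign and the segment between them stays at
  distance at least \<open>h\<close> from 0, where the derivative is at most \<open>M * h powr (\<delta> - 1)\<close>.
\<close>

lemma hoelder_of_derivative_bound:
  fixes P P1 :: "real \<Rightarrow> 'a::real_normed_vector"
  assumes P1: "\<And>t. t \<in> freqs - {0} \<Longrightarrow> (P has_vector_derivative P1 t) (at t within (freqs - {0}))"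
    and nP1: "\<And>t. t \<in> freqs - {0} \<Longrightarrow> norm (P1 t) \<le> M * \<bar>t\<bar> powr (\<delta> - 1)"
    and inc: "\<And>t u. t \<in> freqs - {0} \<Longrightarrow> u \<in> freqs - {0} \<Longrightarrow> norm (P t - P u) \<le> B * (\<bar>t\<bar> powr \<delta> + \<bar>u\<bar> powr \<delta> + \<bar>t - u\<bar>)"
    and \<delta>: "0 < \<delta>" "\<delta> \<le> 1" and MB: "0 \<le> M" "0 \<le> B"
    and tu: "t \<in> freqs - {0}" "u \<in> freqs - {0}"
  shows "norm (P t - P u) \<le> (M + 12 * B) * \<bar>t - u\<bar> powr \<delta>"
proof (cases "t = u")
  case False
  define h where "h = \<bar>t - u\<bar>"
  have h: "0 < h" "h \<le> 8" using False tu pi_less_4 by (auto simp: h_def)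
  show ?thesis
  proof (cases "\<bar>t\<bar> \<le> 2 * h \<and> \<bar>u\<bar> \<le> 2 * h")
    case True
    have w: "\<bar>x\<bar> powr \<delta> \<le> 2 * h powr \<delta>" if "\<bar>x\<bar> \<le> 2 * h" for x
    proof -
      have "\<bar>x\<bar> powr \<delta> \<le> (2 * h) powr \<delta>" using that \<delta> by (intro powr_mono2) auto
      also have "\<dots> = 2 powr \<delta> * h powr \<delta>" using h by (simp add: powr_mult)
      also have "\<dots> \<le> 2 powr 1 * h powr \<delta>" using \<delta> by (intro mult_right_mono powr_mono) auto
      finally show ?thesis by simp
    qed
    have "h = h powr (1 - \<delta>) * h powr \<delta>" using h by (simp add: powr_add[symmetric])
    also have "\<dots> \<le> 8 * h powr \<delta>" using h \<delta> by (intro mult_right_mono powr_le_8) auto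
    finally have "\<bar>t\<bar> powr \<delta> + \<bar>u\<bar> powr \<delta> + h \<le> 12 * h powr \<delta>"
      using w[of t] w[of u] True by linarith
    then have "norm (P t - P u) \<le> B * (12 * h powr \<delta>)"
      using order_trans[OF inc[OF tu]] MB by (auto simp: h_def intro: mult_left_mono)
    also have "\<dots> \<le> (M + 12 * B) * h powr \<delta>" using MB by (simp add: algebra_simps)
    finally show ?thesis by (simp add: h_def)
  next
    case far: False
    let ?I = "closed_segment u t"
    have I: "x \<in> freqs - {0}" "h \<le> \<bar>x\<bar>" if x: "x \<in> ?I" for x
    proof -
      have "(u \<le> x \<and> x \<le> t) \<or> (t \<le> x \<and> x \<le> u)" using x by (auto simp: closed_segment_eq_real_ivl split: if_splits)
      then show "x \<in> freqs - {0}" "h \<le> \<bar>x\<bar>" using far tu unfolding h_def by auto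
    qed
    have "norm (P t - P u) \<le> (M * h powr (\<delta> - 1)) * norm (t - u)"
    proof (rule differentiable_bound)
      show "convex ?I" by simp
      show "u \<in> ?I" "t \<in> ?I" by auto
      fix x assume x: "x \<in> ?I"
      have "(P has_vector_derivative P1 x) (at x within ?I)"
        by (rule has_vector_derivative_within_subset[OF P1[OF I(1)[OF x]]]) (use I in blast)
      then show "(P has_derivative (\<lambda>r. r *\<^sub>R P1 x)) (at x within ?I)" by (simp add: has_vector_derivative_def)
      have "\<bar>x\<bar> powr (\<delta> - 1) \<le> h powr (\<delta> - 1)" using \<delta> h I(2)[OF x] by (intro powr_mono2') auto
      then have "norm (P1 x) \<le> M * h powr (\<delta> - 1)"
        using order_trans[OF nP1[OF I(1)[OF x]]] MB by (auto intro: mult_left_mono)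
      then show "onorm (\<lambda>r. r *\<^sub>R P1 x) \<le> M * h powr (\<delta> - 1)"
        by (intro onorm_le) (simp add: mult.commute mult_left_mono)
    qed
    also have "\<dots> = M * h powr \<delta>" using h by (simp add: h_def powr_diff)
    also have "\<dots> \<le> (M + 12 * B) * h powr \<delta>" using MB by (intro mult_right_mono) auto
    finally show ?thesis by (simp add: h_def)
  qed
qed simp

lemma at_within_punctured: "t \<noteq> 0 \<Longrightarrow> at t within (freqs - {0}) = at t within freqs"
  by (rule at_within_nhd[of _ "- {0}"]) auto

context
  fixes q n i :: nat and p :: "nat \<Rightarrow> real \<Rightarrow> nat \<Rightarrow> complex Matrix.vec" and P :: "real \<Rightarrow> fop"
    and \<delta> B :: real
  assumes entries: "\<And>t k. t \<in> freqs - {0} \<Longrightarrow> k < n \<Longrightarrow> vec_index (eigproj_row q p n i t) k = entry i k (P t)"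
    and inc: "\<And>t u. t \<in> freqs - {0} \<Longrightarrow> u \<in> freqs - {0} \<Longrightarrow> norm (P t - P u) \<le> B * (\<bar>t\<bar> powr \<delta> + \<bar>u\<bar> powr \<delta> + \<bar>t - u\<bar>)"
    and \<delta>: "0 < \<delta>"
begin

lemma dim_eigproj_row: "dim_vec (eigproj_row q p n i t) = n"
  by (simp add: eigproj_row_def)

lemma near_zero: "\<forall>\<^sub>F t in at 0. t \<in> freqs - {0}"
  unfolding eventually_at using pi_gt_zero by (intro exI[of _ pi]) (auto simp: dist_real_def)

text \<open>
  The increment bound makes the values along \<open>1 / (m + 1)\<close> a Cauchy sequence, and then compares every other
  frequency, of either sign, with its limit.
\<close>

lemma eigproj_row_tendsto:
  assumes k: "k < n"
  shows "((\<lambda>t. vec_index (eigproj_row q p n i t) k) \<longlongrightarrow> vec_index (eigproj_row q p n i 0) k) (at 0)"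
proof -
  define f where "f t = entry i k (P t)" for t
  define x where "x m = 1 / real (Suc m)" for m
  have x: "x m \<in> freqs - {0}" for m
  proof -
    have "0 < x m" "x m \<le> 1" by (simp_all add: x_def)
    then show ?thesis using pi_gt3 by auto
  qed
  have x0: "x \<longlonglongrightarrow> 0" unfolding x_def by (rule LIMSEQ_Suc[OF lim_1_over_n])
  have entry_le: "cmod (entry i k T) \<le> norm T" for T
    unfolding entry_def using order_trans[OF cmod_coord_le norm_fapp[of T "fsingle k 1"]] by simp
  have f: "dist (f t) (f u) \<le> B * (\<bar>t\<bar> powr \<delta> + \<bar>u\<bar> powr \<delta> + \<bar>t - u\<bar>)" if "t \<in> freqs - {0}" "u \<in> freqs - {0}" for t u
  proof -
    have "f t - f u = entry i k (P t - P u)"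
      by (simp add: f_def linear_diff[OF bounded_linear.linear[OF bounded_linear_entry]])
    then show ?thesis using order_trans[OF entry_le inc[OF that]] by (simp add: dist_norm)
  qed
  have lim0: "((\<lambda>t. B * (\<bar>t\<bar> powr \<delta> + \<bar>t\<bar>)) \<longlongrightarrow> B * (\<bar>0\<bar> powr \<delta> + \<bar>0\<bar>)) (at 0)"
    using \<delta> by (intro tendsto_intros) auto
  have "Cauchy (\<lambda>m. f (x m))"
  proof (rule CauchyI)
    fix e :: real assume e: "0 < e"
    have "(\<lambda>m. B * (\<bar>x m\<bar> powr \<delta> + \<bar>x m\<bar>)) \<longlonglongrightarrow> B * (\<bar>0\<bar> powr \<delta> + \<bar>0\<bar>)"
      using \<delta> x0 by (intro tendsto_intros) auto
    then have "(\<lambda>m. B * (\<bar>x m\<bar> powr \<delta> + \<bar>x m\<bar>)) \<longlonglongrightarrow> 0" by simp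
    from order_tendstoD(2)[OF this half_gt_zero[OF e]]
    obtain N where N: "\<And>m. m \<ge> N \<Longrightarrow> B * (\<bar>x m\<bar> powr \<delta> + \<bar>x m\<bar>) < e / 2"
      unfolding eventually_sequentially by blast
    \<comment> \<open>The hypothesis on the increments at the frequencies 1 and 2 forces this.\<close>
    have B: "0 \<le> B" 
    proof -
      have "0 \<le> B * (\<bar>1\<bar> powr \<delta> + \<bar>2\<bar> powr \<delta> + \<bar>1 - 2\<bar>)"
        by (rule order_trans[OF zero_le_dist f]) (use pi_gt3 in auto)
      moreover have "0 < \<bar>1::real\<bar> powr \<delta> + \<bar>2::real\<bar> powr \<delta> + \<bar>1 - 2::real\<bar>" by (simp add: add_pos_pos)
      ultimately show ?thesis by (simp add: zero_le_mult_iff)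
    qed
    show "\<exists>N. \<forall>m\<ge>N. \<forall>l\<ge>N. norm (f (x m) - f (x l)) < e"
    proof (intro exI[of _ N] allI impI)
      fix m l assume ml: "N \<le> m" "N \<le> l"
      have "norm (f (x m) - f (x l)) \<le> B * (\<bar>x m\<bar> powr \<delta> + \<bar>x l\<bar> powr \<delta> + \<bar>x m - x l\<bar>)"
        using f[OF x x] by (simp add: dist_norm)
      also have "\<dots> \<le> B * (\<bar>x m\<bar> powr \<delta> + \<bar>x l\<bar> powr \<delta> + (\<bar>x m\<bar> + \<bar>x l\<bar>))"
        using B by (intro mult_left_mono add_left_mono) auto
      also have "\<dots> = B * (\<bar>x m\<bar> powr \<delta> + \<bar>x m\<bar>) + B * (\<bar>x l\<bar> powr \<delta> + \<bar>x l\<bar>)" by (simp add: algebra_simps)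
      also have "\<dots> < e" using N[OF ml(1)] N[OF ml(2)] by simp
      finally show "norm (f (x m) - f (x l)) < e" .
    qed
  qed
  then obtain L where L: "(\<lambda>m. f (x m)) \<longlonglongrightarrow> L" using Cauchy_convergent convergent_def by blast
  have bound: "dist (f t) L \<le> B * (\<bar>t\<bar> powr \<delta> + \<bar>t\<bar>)" if t: "t \<in> freqs - {0}" for t
  proof (rule LIMSEQ_le)
    show "(\<lambda>m. dist (f t) (f (x m))) \<longlonglongrightarrow> dist (f t) L" by (intro tendsto_intros L)
    have "(\<lambda>m. B * (\<bar>t\<bar> powr \<delta> + \<bar>x m\<bar> powr \<delta> + \<bar>t - x m\<bar>)) \<longlonglongrightarrow> B * (\<bar>t\<bar> powr \<delta> + \<bar>0\<bar> powr \<delta> + \<bar>t - 0\<bar>)"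
      using \<delta> x0 by (intro tendsto_intros) auto
    then show "(\<lambda>m. B * (\<bar>t\<bar> powr \<delta> + \<bar>x m\<bar> powr \<delta> + \<bar>t - x m\<bar>)) \<longlonglongrightarrow> B * (\<bar>t\<bar> powr \<delta> + \<bar>t\<bar>)" by simp
  qed (use f[OF t x] in blast)
  have "(f \<longlongrightarrow> L) (at 0)"
  proof (rule Lim_transform_bound[where g = "\<lambda>t. B * (\<bar>t\<bar> powr \<delta> + \<bar>t\<bar>)" and f = "\<lambda>t. f t - L", THEN LIM_zero_cancel])
    show "\<forall>\<^sub>F t in at 0. norm (f t - L) \<le> norm (B * (\<bar>t\<bar> powr \<delta> + \<bar>t\<bar>))"
      by (rule eventually_mono[OF near_zero]) (use bound in \<open>fastforce simp: dist_norm\<close>)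
    show "((\<lambda>t. B * (\<bar>t\<bar> powr \<delta> + \<bar>t\<bar>)) \<longlongrightarrow> 0) (at 0)" using lim0 by simp
  qed
  moreover define K where "K t = (\<Sum>j<q. cnj (vec_index (p n t j) i) * vec_index (p n t j) k)" for t
  have K: "K t = f t" if "t \<in> freqs - {0}" for t
    using entries[OF that k] that k by (simp add: eigproj_row_def K_def f_def)
  ultimately have K_lim: "(K \<longlongrightarrow> L) (at 0)"
    using Lim_transform_eventually[of f L "at 0" K] eventually_mono[OF near_zero] by (metis (mono_tags, lifting))
  have "vec_index (eigproj_row q p n i 0) k = L"
    using tendsto_Lim[OF _ K_lim] k by (simp add: eigproj_row_def K_def[abs_def])
  moreover have "((\<lambda>t. vec_index (eigproj_row q p n i t) k) \<longlongrightarrow> L) (at 0)"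
    by (rule Lim_transform_eventually[OF K_lim])
      (rule eventually_mono[OF near_zero], use k in \<open>auto simp: eigproj_row_def K_def\<close>)
  ultimately show ?thesis by simp
qed

lemma vnorm_entries:
  assumes "\<And>k. k < n \<Longrightarrow> vec_index x k = entry i k T" "dim_vec x = n"
  shows "vnorm x \<le> 2 * norm T"
  using row_norm_le[of i T n] assms by (simp add: vnorm_def)

lemma vnorm_diff:
  "vnorm (eigproj_row q p n i t - eigproj_row q p n i u)
    = sqrt (\<Sum>k<n. (cmod (vec_index (eigproj_row q p n i t) k - vec_index (eigproj_row q p n i u) k))\<^sup>2)"
  by (simp add: vnorm_def dim_eigproj_row)

lemma hoelder_extends_to_zero:
  assumes H: "\<And>t u. t \<in> freqs - {0} \<Longrightarrow> u \<in> freqs - {0} \<Longrightarrow> norm (P t - P u) \<le> H * \<bar>t - u\<bar> powr \<rho>"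
    and \<rho>: "0 < \<rho>" "\<rho> \<le> 1"
  shows "hoelder_on freqs \<rho> (2 * H) (eigproj_row q p n i)"
proof -
  let ?K = "eigproj_row q p n i"
  have nonzero: "vnorm (?K t - ?K u) \<le> 2 * H * \<bar>t - u\<bar> powr \<rho>" if tu: "t \<in> freqs - {0}" "u \<in> freqs - {0}" for t u
  proof -
    have "vnorm (?K t - ?K u) \<le> 2 * norm (P t - P u)"
      by (rule vnorm_entries)
        (simp_all add: dim_eigproj_row entries[OF tu(1)] entries[OF tu(2)] linear_diff[OF bounded_linear.linear[OF bounded_linear_entry]])
    then show ?thesis using H[OF tu] by linarith
  qed
  have zero: "vnorm (?K t - ?K 0) \<le> 2 * H * \<bar>t - 0\<bar> powr \<rho>" if t: "t \<in> freqs - {0}" for t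
  proof (rule tendsto_le[of "at (0::real)"])
    show "((\<lambda>u. vnorm (?K t - ?K u)) \<longlongrightarrow> vnorm (?K t - ?K 0)) (at 0)"
      unfolding vnorm_diff by (intro tendsto_intros eigproj_row_tendsto) auto
    show "((\<lambda>u. 2 * H * \<bar>t - u\<bar> powr \<rho>) \<longlongrightarrow> 2 * H * \<bar>t - 0\<bar> powr \<rho>) (at 0)"
      using t by (intro tendsto_intros) auto
    show "\<forall>\<^sub>F u in at 0. vnorm (?K t - ?K u) \<le> 2 * H * \<bar>t - u\<bar> powr \<rho>"
      by (rule eventually_mono[OF near_zero]) (rule nonzero[OF t])
  qed simp
  have "vnorm (?K u - ?K t) \<le> 2 * H * \<bar>u - t\<bar> powr \<rho>" if "t \<in> freqs" "u \<in> freqs" for t u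
  proof -
    have sym: "vnorm (?K 0 - ?K t) = vnorm (?K t - ?K 0)" unfolding vnorm_diff by (simp add: norm_minus_commute)
    have same: "vnorm (?K 0 - ?K 0) = 0" unfolding vnorm_diff by simp
    show ?thesis
      using nonzero[of u t] zero[of u] zero[of t] that sym same
      by (cases "t = 0"; cases "u = 0") auto
  qed
  then show ?thesis unfolding hoelder_on_def using \<rho> by blast
qed

lemma eigproj_row_derivative:
  assumes P1: "\<And>t. t \<in> freqs - {0} \<Longrightarrow> (P has_vector_derivative P1 t) (at t within (freqs - {0}))"
    and P2: "\<And>t. t \<in> freqs - {0} \<Longrightarrow> (P1 has_vector_derivative P2 t) (at t within (freqs - {0}))"
    and nP1: "\<And>t. t \<in> freqs - {0} \<Longrightarrow> norm (P1 t) \<le> C * \<bar>t\<bar> powr (\<rho> - 1)"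
    and nP2: "\<And>t. t \<in> freqs - {0} \<Longrightarrow> norm (P2 t) \<le> C * \<bar>t\<bar> powr (\<rho> - 2)"
  shows "\<exists>K1 K2. \<forall>t\<in>freqs - {0}. has_vec_deriv (eigproj_row q p n i) (K1 t) t \<and> has_vec_deriv K1 (K2 t) t \<and>
      vnorm (K1 t) \<le> (2 * C) * \<bar>t\<bar> powr (\<rho> - 1) \<and> vnorm (K2 t) \<le> (2 * C) * \<bar>t\<bar> powr (\<rho> - 2)"
proof -
  define V where "V T = Matrix.vec n (\<lambda>k. entry i k T)" for T
  have V: "dim_vec (V T) = n" "k < n \<Longrightarrow> vec_index (V T) k = entry i k T" for T k by (simp_all add: V_def)
  have entry_deriv: "((\<lambda>t. entry i k (F t)) has_vector_derivative entry i k F') (at t within freqs)"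
    if "t \<in> freqs - {0}" "(F has_vector_derivative F') (at t within (freqs - {0}))" for F F' t k
    using bounded_linear.has_vector_derivative[OF bounded_linear_entry that(2)] that(1) at_within_punctured[of t] by auto
  have main: "has_vec_deriv (eigproj_row q p n i) (V (P1 t)) t \<and> has_vec_deriv (\<lambda>t. V (P1 t)) (V (P2 t)) t \<and>
      vnorm (V (P1 t)) \<le> (2 * C) * \<bar>t\<bar> powr (\<rho> - 1) \<and> vnorm (V (P2 t)) \<le> (2 * C) * \<bar>t\<bar> powr (\<rho> - 2)"
    if t: "t \<in> freqs - {0}" for t
  proof (intro conjI)
    show "has_vec_deriv (eigproj_row q p n i) (V (P1 t)) t"
      unfolding has_vec_deriv_def V dim_eigproj_row
    proof (intro conjI allI impI refl)
      fix k assume k: "k < n"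
      have "((\<lambda>t. entry i k (P t)) has_vector_derivative entry i k (P1 t)) (at t within (freqs - {0}))"
        using entry_deriv[OF t P1[OF t]] at_within_punctured[of t] t by simp
      from has_vector_derivative_transform[OF t entries[OF _ k] this]
      show "((\<lambda>t. vec_index (eigproj_row q p n i t) k) has_vector_derivative vec_index (V (P1 t)) k) (at t within freqs)"
        using at_within_punctured[of t] t k by (simp add: V)
    qed
    show "has_vec_deriv (\<lambda>t. V (P1 t)) (V (P2 t)) t"
      unfolding has_vec_deriv_def using entry_deriv[OF t P2[OF t]] by (auto simp: V)
    have "vnorm (V (P1 t)) \<le> 2 * norm (P1 t)" by (rule vnorm_entries) (simp_all add: V)
    then show "vnorm (V (P1 t)) \<le> (2 * C) * \<bar>t\<bar> powr (\<rho> - 1)" using nP1[OF t] by linarith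
    have "vnorm (V (P2 t)) \<le> 2 * norm (P2 t)" by (rule vnorm_entries) (simp_all add: V)
    then show "vnorm (V (P2 t)) \<le> (2 * C) * \<bar>t\<bar> powr (\<rho> - 2)" using nP2[OF t] by linarith
  qed
  show ?thesis
    by (rule exI[of _ "\<lambda>t. V (P1 t)"], rule exI[of _ "\<lambda>t. V (P2 t)"], rule ballI, rule main)
qed

end

section \<open>The exponents\<close>

lemma rho_le_alpha: "1 \<le> q \<Longrightarrow> rho q df q \<le> alpha q df q (Suc q)"
proof -
  assume "1 \<le> q"
  then obtain m where m: "q = Suc m" by (cases q) auto
  have "rho q df (Suc m) \<le> alpha q df (Suc m) (Suc (Suc m))" unfolding rho.simps by (rule Min_le) auto
  then show ?thesis unfolding m .
qed

text \<open>
  Gap dominance makes each member of the minimum positive; for \<open>l = 0\<close> the member is \<open>2 - 1\<close>.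
\<close>

lemma rho_pos:
  assumes gap: "gap_dominance_cond q df" shows "m \<le> q \<Longrightarrow> 0 < rho q df m"
proof (induction m)
  case (Suc m)
  have "0 < alpha q df (Suc m) (Suc (Suc m))"
    using gap Suc.prems unfolding gap_dominance_cond_def by auto
  moreover have "0 < 2 * rho q df l - alpha q df l (Suc m)" if l: "l \<le> m" for l
  proof (cases "l = 0")
    case False
    then have "Suc m \<in> {2..q}" "l \<in> {1..Suc m - 1}" "2 \<le> q" using l Suc.prems by auto
    then have "alpha q df l (Suc m) < 2 * rho q df l" using gap unfolding gap_dominance_cond_def by blast
    then show ?thesis by simp
  qed (simp add: alpha_def)
  moreover have "0 < rho q df m" using Suc by simp
  ultimately show ?case unfolding rho.simps by (subst Min_gr_iff) auto
qed simp

lemma d_ord_last: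
  assumes q: "1 \<le> q"
  shows "l < q \<Longrightarrow> d_ord q df q \<le> df l" and "\<exists>l<q. d_ord q df q = df l"
proof -
  let ?xs = "sort (map df [0..<q])"
  have len: "length ?xs = q" by simp
  have d: "d_ord q df q = ?xs ! 0" using q len by (simp add: d_ord_def rev_nth)
  have set: "set ?xs = df ` {..<q}" by (simp add: atLeast0LessThan)
  show "\<exists>l<q. d_ord q df q = df l"
    using nth_mem[of 0 ?xs] q len unfolding d set by auto
  assume "l < q"
  then have "df l \<in> set ?xs" unfolding set by auto
  then obtain k where "k < length ?xs" "df l = ?xs ! k" by (metis in_set_conv_nth)
  then show "d_ord q df q \<le> df l" unfolding d using sorted_nth_mono[of ?xs 0 k] by simp
qed

section \<open>Pervasiveness as operator inequalities\<close>

lemma inner_fseq_of_vec: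
  assumes "dim_vec u = dim_vec v" shows "inner (fseq_of_vec u) (fseq_of_vec v) = Re (u \<bullet>c v)"
proof -
  have "inner (fseq_of_vec u) (fseq_of_vec v)
      = (\<Sum>i<dim_vec v. Re (coord (fseq_of_vec u) i * cnj (coord (fseq_of_vec v) i)))"
    by (rule inner_fseq_upto) (simp add: assms)
  then show ?thesis using assms by (simp add: scalar_prod_def atLeast0LessThan)
qed

lemma loewner_le_quadratic_form:
  assumes AB: "A \<preceq>\<^sub>L B" and A: "A \<in> carrier_mat q q" and y: "\<And>i. i \<ge> q \<Longrightarrow> coord y i = 0"
  shows "inner (fapp (mat_op A) y) y \<le> inner (fapp (mat_op B) y) y"
proof -
  obtain m where m: "A \<in> carrier_mat m m" "B \<in> carrier_mat m m"
    and psd: "\<And>v. v \<in> carrier_vec m \<Longrightarrow> 0 \<le> Re (((B - A) *\<^sub>v v) \<bullet>c v)"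
    using AB unfolding loewner_le_def by blast
  have mq: "m = q" using m(1) A by auto
  define x where "x = Matrix.vec q (\<lambda>k. coord y k)"
  have yx: "y = fseq_of_vec x" using y by (intro fseq_eqI) (auto simp: x_def)
  have "0 \<le> Re (((B - A) *\<^sub>v x) \<bullet>c x)" by (rule psd) (simp add: x_def mq)
  also have "\<dots> = inner (fapp (mat_op (B - A)) y) y"
  proof -
    have dx: "dim_vec x = q" by (simp add: x_def)
    have "fapp (mat_op (B - A)) (fseq_of_vec x) = fseq_of_vec ((B - A) *\<^sub>v x)"
      by (rule mat_op_fseq_of_vec) (use m mq dx in auto)
    then have "inner (fapp (mat_op (B - A)) y) y = inner (fseq_of_vec ((B - A) *\<^sub>v x)) (fseq_of_vec x)"
      by (simp only: yx)
    also have "\<dots> = Re (((B - A) *\<^sub>v x) \<bullet>c x)"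
      by (rule inner_fseq_of_vec) (use m mq dx in auto)
    finally show ?thesis by simp
  qed
  also have "\<dots> = inner (fapp (mat_op B) y) y - inner (fapp (mat_op A) y) y"
    by (simp add: mat_op_diff[OF m(2,1)] inner_diff_left)
  finally show ?thesis by simp
qed

lemma Gmat_carrier: "Gmat q g n \<theta> \<in> carrier_mat n q" by (simp add: Gmat_def)

lemma mat_op_Smat: "mat_op (Smat q g n \<theta>) = (1 / real n) *\<^sub>R (adj (mat_op (Gmat q g n \<theta>)) * mat_op (Gmat q g n \<theta>))"
proof -
  have "mat_adjoint (Gmat q g n \<theta>) \<in> carrier_mat q n" using Gmat_carrier[of q g n \<theta>] by (intro carrier_matI) auto
  then show ?thesis
    using mat_op_smult[of "1 / real n" "mat_adjoint (Gmat q g n \<theta>) * Gmat q g n \<theta>"]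
    by (simp add: Smat_def mat_op_mult[OF _ Gmat_carrier] mat_op_adjoint)
qed

lemma mat_op_scalar: "mat_op (complex_of_real c \<cdot>\<^sub>m 1\<^sub>m q) = c *\<^sub>R diag_op q (\<lambda>_. 1)"
proof -
  have "mat_op (1\<^sub>m q) = diag_op q (\<lambda>_. 1)"
    using mat_op_diag[of q "\<lambda>_. 1"] by (simp add: mat_diag_def one_mat_def)
  then show ?thesis by (simp only: mat_op_smult)
qed

lemma inner_Smat: "inner (fapp (mat_op (Smat q g n \<theta>)) y) y = (norm (fapp (mat_op (Gmat q g n \<theta>)) y))\<^sup>2 / real n"
  by (simp add: mat_op_Smat inner_adj' power2_norm_eq_inner)

text \<open>
  The quadratic form of \<open>Smat\<close> at \<open>y\<close> is \<open>\<parallel>G y\<parallel>\<^sup>2 / n\<close>.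
\<close>

lemma Gmat_coercive:
  assumes lo: "complex_of_real s \<cdot>\<^sub>m 1\<^sub>m q \<preceq>\<^sub>L Smat q g n \<theta>" and n: "0 < n"
    and y: "\<And>i. i \<ge> q \<Longrightarrow> coord y i = 0"
  shows "sqrt (s * real n) * norm y \<le> norm (fapp (mat_op (Gmat q g n \<theta>)) y)"
proof -
  have C: "complex_of_real s \<cdot>\<^sub>m 1\<^sub>m q \<in> carrier_mat q q" by simp
  have one: "fapp (diag_op q (\<lambda>_. 1)) y = y" by (rule diag_op_one_eq) (rule y)
  have "inner (fapp (mat_op (complex_of_real s \<cdot>\<^sub>m 1\<^sub>m q)) y) y \<le> inner (fapp (mat_op (Smat q g n \<theta>)) y) y"
    by (rule loewner_le_quadratic_form[OF lo C]) (rule y)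
  then have "s * (norm y)\<^sup>2 \<le> (norm (fapp (mat_op (Gmat q g n \<theta>)) y))\<^sup>2 / real n"
    unfolding inner_Smat mat_op_scalar by (simp add: one power2_norm_eq_inner[of y])
  then have "s * real n * (norm y)\<^sup>2 \<le> (norm (fapp (mat_op (Gmat q g n \<theta>)) y))\<^sup>2"
    using n by (simp add: field_simps)
  then have "sqrt (s * real n * (norm y)\<^sup>2) \<le> norm (fapp (mat_op (Gmat q g n \<theta>)) y)"
    by (intro real_le_lsqrt) auto
  then show ?thesis by (simp add: real_sqrt_mult)
qed

lemma norm_Gmat_le:
  assumes hi: "Smat q g n \<theta> \<preceq>\<^sub>L complex_of_real s \<cdot>\<^sub>m 1\<^sub>m q" and n: "0 < n" and s: "0 \<le> s"
  shows "norm (mat_op (Gmat q g n \<theta>)) \<le> sqrt s * sqrt (real n)"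
proof (rule norm_fop_bound)
  fix x
  let ?g = "mat_op (Gmat q g n \<theta>)"
  define y where "y = fapp (diag_op q (\<lambda>_. 1)) x"
  have y: "coord y i = 0" if "i \<ge> q" for i using that by (simp add: y_def coord_diag_op)
  have gx: "fapp ?g x = fapp ?g y"
    using Gmat_carrier[of q g n \<theta>] by (intro fseq_eqI) (auto simp: coord_mat_op y_def coord_diag_op)
  have "norm (diag_op q (\<lambda>_. 1)) \<le> 1" by (rule norm_diag_op_le) auto
  then have yx: "norm y \<le> norm x"
    unfolding y_def using norm_fapp[of "diag_op q (\<lambda>_. 1)" x] mult_right_mono[of "norm (diag_op q (\<lambda>_. 1))" 1 "norm x"] by simp
  have S: "Smat q g n \<theta> \<in> carrier_mat q q" using Gmat_carrier[of q g n \<theta>] by (intro carrier_matI) (auto simp: Smat_def)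
  have one: "fapp (diag_op q (\<lambda>_. 1)) y = y" by (rule diag_op_one_eq) (rule y)
  have "inner (fapp (mat_op (Smat q g n \<theta>)) y) y \<le> inner (fapp (mat_op (complex_of_real s \<cdot>\<^sub>m 1\<^sub>m q)) y) y"
    by (rule loewner_le_quadratic_form[OF hi S]) (rule y)
  then have "(norm (fapp ?g y))\<^sup>2 / real n \<le> s * (norm y)\<^sup>2"
    unfolding inner_Smat mat_op_scalar by (simp add: one power2_norm_eq_inner[of y])
  then have "(norm (fapp ?g y))\<^sup>2 \<le> (sqrt s * sqrt (real n) * norm y)\<^sup>2"
    using n s by (simp add: field_simps power_mult_distrib)
  then have "norm (fapp ?g y) \<le> sqrt s * sqrt (real n) * norm y"
    by (rule power2_le_imp_le) (use s in simp)
  also have "\<dots> \<le> sqrt s * sqrt (real n) * norm x" using yx s by (intro mult_left_mono) auto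
  finally show "norm (fapp ?g x) \<le> sqrt s * sqrt (real n) * norm x" by (simp add: gx)
qed (use s in simp)

section \<open>Hoelder continuity and derivatives of the rows\<close>

lemma eigproj_row_regularity:
  fixes n q :: nat and p :: "nat \<Rightarrow> real \<Rightarrow> nat \<Rightarrow> complex Matrix.vec"
  assumes q: "q \<le> n" and i: "i < n"
    and sys: "\<And>t. t \<in> freqs - {0} \<Longrightarrow> row_eigensystem n (Sig t) (lam t) (p n t)"
    and Sig: "\<And>t. t \<in> freqs - {0} \<Longrightarrow> Sig t \<in> carrier_mat n n"
    and \<rho>: "0 < \<rho>" "\<rho> \<le> \<delta>" "\<delta> \<le> 1" and MB: "0 \<le> M" "0 \<le> B"
    and P1: "\<And>t. t \<in> freqs - {0} \<Longrightarrow>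
      ((\<lambda>t. leading_projection q n (p n t)) has_vector_derivative P1 t) (at t within (freqs - {0}))"
    and P2: "\<And>t. t \<in> freqs - {0} \<Longrightarrow> (P1 has_vector_derivative P2 t) (at t within (freqs - {0}))"
    and nP1: "\<And>t. t \<in> freqs - {0} \<Longrightarrow> norm (P1 t) \<le> M * \<bar>t\<bar> powr \<delta> * (1 / \<bar>t\<bar>)"
    and nP2: "\<And>t. t \<in> freqs - {0} \<Longrightarrow> norm (P2 t) \<le> M * \<bar>t\<bar> powr \<delta> * (1 / \<bar>t\<bar>)\<^sup>2"
    and inc: "\<And>t u. t \<in> freqs - {0} \<Longrightarrow> u \<in> freqs - {0} \<Longrightarrow>
      norm (leading_projection q n (p n t) - leading_projection q n (p n u)) \<le> B * (\<bar>t\<bar> powr \<delta> + \<bar>u\<bar> powr \<delta> + \<bar>t - u\<bar>)"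
  shows "\<forall>k<n. ((\<lambda>\<theta>. vec_index (eigproj_row q p n i \<theta>) k) \<longlongrightarrow> vec_index (eigproj_row q p n i 0) k) (at 0)"
    and "hoelder_on freqs \<rho> (2 * (8 * (M + 12 * B))) (eigproj_row q p n i)"
    and "\<exists>K1 K2. \<forall>\<theta>\<in>freqs - {0}. has_vec_deriv (eigproj_row q p n i) (K1 \<theta>) \<theta> \<and> has_vec_deriv K1 (K2 \<theta>) \<theta> \<and>
           vnorm (K1 \<theta>) \<le> 2 * (8 * M) * \<bar>\<theta>\<bar> powr (\<rho> - 1) \<and> vnorm (K2 \<theta>) \<le> 2 * (8 * M) * \<bar>\<theta>\<bar> powr (\<rho> - 2)"
proof -
  define P where "P t = leading_projection q n (p n t)" for t
  have \<delta>: "0 < \<delta>" using \<rho> by linarith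
  have entries: "vec_index (eigproj_row q p n i t) k = entry i k (P t)" if t: "t \<in> freqs - {0}" and k: "k < n" for t k
  proof -
    have "entry i k (P t) = (\<Sum>j<n. (if j < q then 1 else 0) *\<^sub>R entry i k (eigen_op n (p n t) j))"
      unfolding P_def spectral_sum_def
      by (simp only: linear_sum[OF bounded_linear.linear[OF bounded_linear_entry]]
          linear_scale[OF bounded_linear.linear[OF bounded_linear_entry]])
    also have "\<dots> = (\<Sum>j<q. (if j < q then 1 else 0) *\<^sub>R entry i k (eigen_op n (p n t) j))"
      by (rule sum.mono_neutral_right) (use q in auto)
    also have "\<dots> = (\<Sum>j<q. cnj (vec_index (p n t j) i) * vec_index (p n t j) k)"
      using q i k by (intro sum.cong) (simp_all add: entry_eigen_op[OF sys[OF t] Sig[OF t]])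
    finally show ?thesis using t k by (simp add: eigproj_row_def)
  qed
  have incP: "norm (P t - P u) \<le> B * (\<bar>t\<bar> powr \<delta> + \<bar>u\<bar> powr \<delta> + \<bar>t - u\<bar>)"
    if "t \<in> freqs - {0}" "u \<in> freqs - {0}" for t u
    using inc[OF that] by (simp add: P_def)
  have dP: "(P has_vector_derivative P1 t) (at t within (freqs - {0}))" if "t \<in> freqs - {0}" for t
    using P1[OF that] by (simp add: P_def[abs_def])
  show "\<forall>k<n. ((\<lambda>\<theta>. vec_index (eigproj_row q p n i \<theta>) k) \<longlongrightarrow> vec_index (eigproj_row q p n i 0) k) (at 0)"
    by (intro allI impI) (rule eigproj_row_tendsto[OF entries incP \<delta>])
  have exponent: "x powr \<delta> \<le> 8 * x powr \<rho>" if "0 \<le> x" "x \<le> 8" for x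
  proof (cases "x = 0")
    case False
    have "x powr \<delta> = x powr (\<delta> - \<rho>) * x powr \<rho>" using False by (simp add: powr_add[symmetric])
    also have "\<dots> \<le> 8 * x powr \<rho>" using that \<rho> by (intro mult_right_mono powr_le_8) auto
    finally show ?thesis .
  qed simp
  have nP1': "norm (P1 t) \<le> M * \<bar>t\<bar> powr (\<delta> - 1)" if t: "t \<in> freqs - {0}" for t
    using nP1[OF t] t by (simp add: powr_diff)
  show "hoelder_on freqs \<rho> (2 * (8 * (M + 12 * B))) (eigproj_row q p n i)"
  proof (rule hoelder_extends_to_zero[OF entries incP \<delta>])
    fix t u assume tu: "t \<in> freqs - {0}" "u \<in> freqs - {0}"
    have "norm (P t - P u) \<le> (M + 12 * B) * \<bar>t - u\<bar> powr \<delta>"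
      by (rule hoelder_of_derivative_bound[OF dP nP1' incP \<delta> \<rho>(3) MB tu])
    also have "\<dots> \<le> (M + 12 * B) * (8 * \<bar>t - u\<bar> powr \<rho>)"
      using MB tu pi_less_4 by (intro mult_left_mono exponent) auto
    finally show "norm (P t - P u) \<le> 8 * (M + 12 * B) * \<bar>t - u\<bar> powr \<rho>"
      by (simp only: mult_ac)
  qed (use \<rho> in auto)
  have weaken: "M * \<bar>t\<bar> powr \<delta> * (1 / \<bar>t\<bar>) ^ r \<le> 8 * M * \<bar>t\<bar> powr (\<rho> - real r)" if t: "t \<in> freqs - {0}" for t r
  proof -
    have "M * \<bar>t\<bar> powr \<delta> * (1 / \<bar>t\<bar>) ^ r \<le> M * (8 * \<bar>t\<bar> powr \<rho>) * (1 / \<bar>t\<bar>) ^ r"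
      using t MB pi_less_4 by (intro mult_right_mono mult_left_mono exponent) auto
    also have "\<dots> = 8 * M * \<bar>t\<bar> powr (\<rho> - real r)"
      using t by (simp add: powr_diff powr_realpow power_divide)
    finally show ?thesis .
  qed
  show "\<exists>K1 K2. \<forall>\<theta>\<in>freqs - {0}. has_vec_deriv (eigproj_row q p n i) (K1 \<theta>) \<theta> \<and> has_vec_deriv K1 (K2 \<theta>) \<theta> \<and>
           vnorm (K1 \<theta>) \<le> 2 * (8 * M) * \<bar>\<theta>\<bar> powr (\<rho> - 1) \<and> vnorm (K2 \<theta>) \<le> 2 * (8 * M) * \<bar>\<theta>\<bar> powr (\<rho> - 2)"
  proof (rule eigproj_row_derivative[OF entries incP \<delta> dP P2])
    fix t assume t: "t \<in> freqs - {0}"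
    show "norm (P1 t) \<le> 8 * M * \<bar>t\<bar> powr (\<rho> - 1)" 
      by (rule order_trans[OF nP1[OF t]]) (use weaken[OF t, of 1] in simp)
    show "norm (P2 t) \<le> 8 * M * \<bar>t\<bar> powr (\<rho> - 2)" 
      by (rule order_trans[OF nP2[OF t]]) (use weaken[OF t, of 2] in simp)
  qed
qed

text \<open>
  The remainder is Hermitian since \<open>A\<close> is, having an orthonormal eigenbasis with real eigenvalues, and
  since \<open>G diag(d) G\<^sup>*\<close> is.  In the application this shows that the chosen version of the idiosyncratic
  density is Hermitian at each nonzero frequency, whereas a spectral density as such is so only almost
  everywhere.
\<close>

lemma norm_hermitian_remainder_le:
  assumes sys: "row_eigensystem n A lam p" and G: "G \<in> carrier_mat n q" and X: "X \<in> carrier_mat n n"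
    and dec: "A = G * mat_diag q (\<lambda>l. complex_of_real (d l)) * mat_adjoint G + X"
    and ev: "\<And>e. eigenvalue X e \<Longrightarrow> cmod e < r" and r: "0 < r"
  shows "norm (mat_op X) \<le> r"
proof (rule norm_hermitian_le_eigenvalues[OF X _ ev r])
  let ?d = "mat_diag q (\<lambda>l. complex_of_real (d l))"
  have d: "?d \<in> carrier_mat q q" by (simp add: mat_diag_def)
  have G': "mat_adjoint G \<in> carrier_mat q n" using G by (intro carrier_matI) auto
  note GdG = mult_carrier_mat[OF mult_carrier_mat[OF G d] G']
  have A: "A \<in> carrier_mat n n" unfolding dec by (rule add_carrier_mat[OF X])
  have "mat_op A = mat_op (G * ?d * mat_adjoint G) + mat_op X"
    unfolding dec by (rule mat_op_add[OF GdG X])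
  then have "mat_op A = mat_op G * diag_op q d * adj (mat_op G) + mat_op X"
    by (simp only: mat_op_mult[OF mult_carrier_mat[OF G d] G'] mat_op_mult[OF G d] mat_op_adjoint mat_op_diag)
  then have "mat_op X = mat_op A - mat_op G * diag_op q d * adj (mat_op G)" by simp
  moreover have "adj (mat_op A) = mat_op A"
    unfolding eigen_decomposition[OF sys A] by (rule adj_spectral_sum[OF eigen_op_projections[OF sys A]])
  ultimately show "adj (mat_op X) = mat_op X" by (simp add: adj_diag_op mult.assoc)
qed

theorem lemmaD3:
  fixes M :: "'w measure"
    and q :: nat
    and x chi xi u :: "'w process"
    and b g :: "nat \<Rightarrow> nat \<Rightarrow> lag_filter"
    and d :: "nat \<Rightarrow> nat \<Rightarrow> real"
    and df :: "nat \<Rightarrow> real"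
    and \<epsilon> :: "nat \<Rightarrow> 'w process"
    and B_xi :: "nat \<Rightarrow> int \<Rightarrow> real mat"
    and Sig Sig_chi Sig_xi :: "nat \<Rightarrow> real \<Rightarrow> complex mat"
    and lam :: "nat \<Rightarrow> real \<Rightarrow> nat \<Rightarrow> real"
    and p :: "nat \<Rightarrow> real \<Rightarrow> nat \<Rightarrow> complex Matrix.vec"
  assumes "model_cond M q x chi xi u b \<epsilon> B_xi Sig Sig_chi Sig_xi"
    and "long_memory_cond q d g b"
    and "pervasiveness_cond q g"
    and "memory_structure_cond q d df g Sig_chi"
    and "idiosyncratic_cond M \<epsilon> Sig_xi"
    and "row_bounded_cond q g"
    and "gap_dominance_cond q df"
    and "\<And>n \<theta>. \<theta> \<in> freqs - {0} \<Longrightarrow> row_eigensystem n (Sig n \<theta>) (lam n \<theta>) (p n \<theta>)"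
  shows "(\<exists>H. \<forall>\<^sub>F n in sequentially. \<forall>i<n.
           (\<forall>k<n. ((\<lambda>\<theta>. eigproj_row q p n i \<theta> $ k) \<longlongrightarrow> eigproj_row q p n i 0 $ k) (at 0)) \<and>
           hoelder_on freqs (rho q df q) H (eigproj_row q p n i)) \<and>
         (\<exists>C. \<forall>\<^sub>F n in sequentially. \<forall>i<n. \<exists>K1 K2. \<forall>\<theta>\<in>freqs - {0}.
           has_vec_deriv (eigproj_row q p n i) (K1 \<theta>) \<theta> \<and> has_vec_deriv K1 (K2 \<theta>) \<theta> \<and>
           vnorm (K1 \<theta>) \<le> C * \<bar>\<theta>\<bar> powr (rho q df q - 1) \<and>
           vnorm (K2 \<theta>) \<le> C * \<bar>\<theta>\<bar> powr (rho q df q - 2))"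
proof -
  note model = assms(1)[unfolded model_cond_def]
  have q: "1 \<le> q" using model by (elim conjE)
  have xi: "\<forall>n. has_spectral_density M n xi (Sig_xi n)" using model by (elim conjE)
  have sum: "\<forall>n. \<forall>\<theta>\<in>freqs - {0}. Sig n \<theta> = Sig_chi n \<theta> + Sig_xi n \<theta>" using model by (elim conjE)
  have Xc: "Sig_xi n \<theta> \<in> carrier_mat n n" if "\<theta> \<in> freqs" for n \<theta>
    using spec[OF xi, of n] that unfolding has_spectral_density_def by (elim conjE) (erule (1) bspec)
  have Sig: "Sig n \<theta> = Sig_chi n \<theta> + Sig_xi n \<theta>" if "\<theta> \<in> freqs - {0}" for n \<theta>
    using sum that by blast
  have chi: "\<And>n \<theta>. \<theta> \<in> freqs - {0} \<Longrightarrow> Sig_chi n \<theta> = Gmat q g n \<theta>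
        * mat_diag q (\<lambda>l. complex_of_real (cmod (1 - cis (- \<theta>)) powr (- 2 * df l))) * mat_adjoint (Gmat q g n \<theta>)"
    and d: "\<And>i l. l < q \<Longrightarrow> d i l = df l"
    using assms(4) unfolding memory_structure_cond_def by blast+
  have dec: "Sig n \<theta> = Gmat q g n \<theta> * mat_diag q (\<lambda>l. complex_of_real (cmod (1 - cis (- \<theta>)) powr (- 2 * df l)))
        * mat_adjoint (Gmat q g n \<theta>) + Sig_xi n \<theta>" if "\<theta> \<in> freqs - {0}" for n \<theta>
    by (simp only: Sig[OF that] chi[OF that])
  have df: "0 \<le> df l" "df l < 1 / 2" if "l < q" for l
    using assms(2) d[OF that, of 0] that unfolding long_memory_cond_def by metis+
  define \<delta> where "\<delta> = 2 * d_ord q df q"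
  obtain l0 where l0: "l0 < q" "d_ord q df q = df l0" using d_ord_last(2)[OF q] by blast
  have alpha: "alpha q df q (Suc q) = \<delta>"
    using df(1)[OF l0(1)] q l0 by (simp add: alpha_def \<delta>_def d_ord_def[of q df "Suc q"])
  have \<delta>: "0 < \<delta>" "\<delta> \<le> 1"
  proof -
    have "q \<in> {1..q + 1}" "Suc q \<in> {1..q + 1}" "q \<noteq> Suc q" using q by auto
    then have "0 < alpha q df q (Suc q)" using assms(7) unfolding gap_dominance_cond_def by blast
    then show "0 < \<delta>" by (simp add: alpha)
    show "\<delta> \<le> 1" using df(2)[OF l0(1)] l0 by (simp add: \<delta>_def)
  qed
  have df_\<delta>: "\<delta> \<le> 2 * df l \<and> df l < 1 / 2" if "l < q" for l
    using d_ord_last(1)[OF q that, of df] df(2)[OF that] by (simp add: \<delta>_def)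
  have \<rho>: "0 < rho q df q" "rho q df q \<le> \<delta>"
    using rho_pos[OF assms(7), of q] rho_le_alpha[OF q, of df] by (simp_all add: alpha)
  obtain s s_hi C1 C2 L where s: "0 < s" "s \<le> s_hi" and perv: "\<forall>\<^sub>F n in sequentially.
        (\<forall>\<theta>\<in>freqs. complex_of_real s \<cdot>\<^sub>m 1\<^sub>m q \<preceq>\<^sub>L Smat q g n \<theta> \<and>
                   Smat q g n \<theta> \<preceq>\<^sub>L complex_of_real s_hi \<cdot>\<^sub>m 1\<^sub>m q) \<and>
        twice_diff_bounded (Gmat q g n) (C1 * sqrt (real n)) (C2 * sqrt (real n)) \<and>
        (\<forall>\<theta>1\<in>freqs. \<forall>\<theta>2\<in>freqs.
           opnorm (Gmat q g n \<theta>2 - Gmat q g n \<theta>1) \<le> sqrt (real n) * L * \<bar>\<theta>2 - \<theta>1\<bar>)"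
    using assms(3) unfolding pervasiveness_cond_def by blast
  obtain \<Lambda>_lo \<Lambda>_hi D1 D2 where idio: "\<forall>\<^sub>F n in sequentially.
     (\<forall>\<theta>\<in>freqs. \<forall>ev. eigenvalue (Sig_xi n \<theta>) ev \<longrightarrow> ev \<in> complex_of_real ` {\<Lambda>_lo..\<Lambda>_hi}) \<and>
     twice_diff_bounded (Sig_xi n) D1 D2"
  proof -
    from assms(5) obtain \<Lambda>_lo \<Lambda>_hi D1 D2 C where "\<forall>\<^sub>F n in sequentially.
       (\<forall>\<theta>\<in>freqs. \<forall>ev. eigenvalue (Sig_xi n \<theta>) ev \<longrightarrow> ev \<in> complex_of_real ` {\<Lambda>_lo..\<Lambda>_hi}) \<and>
       twice_diff_bounded (Sig_xi n) D1 D2 \<and>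
       (\<forall>k<n. \<forall>t. integrable M (\<lambda>\<omega>. (\<epsilon> n k t \<omega>) ^ 4)) \<and>
       (\<forall>t v1 v2 v3 v4.
          (\<forall>v\<in>{v1, v2, v3, v4}. (\<Sum>k<n. (v k)\<^sup>2) = 1) \<longrightarrow>
          (let lin = (\<lambda>v \<omega>. \<Sum>k<n. v k * \<epsilon> n k t \<omega>)
           in \<bar>cum4 M (lin v1) (lin v2) (lin v3) (lin v4)\<bar> \<le> C))"
      unfolding idiosyncratic_cond_def by (elim exE)
    from that[OF eventually_mono[OF this]] show ?thesis by blast
  qed
  \<comment> \<open>Adding 1 makes the bound on the eigenvalues strict.\<close>
  define \<kappa> where "\<kappa> = \<bar>\<Lambda>_lo\<bar> + \<bar>\<Lambda>_hi\<bar> + 1"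
  define c0 where "c0 = \<bar>C1\<bar> + \<bar>C2\<bar> + \<bar>L\<bar> + sqrt s_hi + \<bar>D1\<bar> + \<bar>D2\<bar>"
  define c where "c = 100 + c0 + \<kappa> + 16 / s + 2 * \<kappa> / sqrt s + (1 + 16 / s * \<kappa>) / sqrt s"
  have s_hi: "0 \<le> s_hi" using s by linarith
  have c0: "C1 \<le> c0" "C2 \<le> c0" "L \<le> c0" "sqrt s_hi \<le> c0" "D1 \<le> c0" "D2 \<le> c0"
    using real_sqrt_ge_zero[OF s_hi] unfolding c0_def by linarith+
  have \<kappa>: "0 < \<kappa>" by (simp add: \<kappa>_def)
  have "0 \<le> c0" using real_sqrt_ge_zero[OF s_hi] by (simp add: c0_def)
  then have c: "0 \<le> c" unfolding c_def using \<kappa> s by (intro add_nonneg_nonneg) auto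
  define Mc Bc where "Mc = 3000 * c ^ 9" and "Bc = 2 * c ^ 3"
  have MB: "0 \<le> Mc" "0 \<le> Bc" using c by (simp_all add: Mc_def Bc_def)
  have "\<forall>\<^sub>F n in sequentially. q < n" by (rule eventually_gt_at_top)
  moreover have "\<forall>\<^sub>F n in sequentially. nat \<lceil>32 * \<kappa> / s\<rceil> \<le> n" by (rule eventually_ge_at_top)
  ultimately have main: "\<forall>\<^sub>F n in sequentially. \<forall>i<n.
     (\<forall>k<n. ((\<lambda>\<theta>. eigproj_row q p n i \<theta> $ k) \<longlongrightarrow> eigproj_row q p n i 0 $ k) (at 0)) \<and>
     hoelder_on freqs (rho q df q) (2 * (8 * (Mc + 12 * Bc))) (eigproj_row q p n i) \<and>
     (\<exists>K1 K2. \<forall>\<theta>\<in>freqs - {0}.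
           has_vec_deriv (eigproj_row q p n i) (K1 \<theta>) \<theta> \<and> has_vec_deriv K1 (K2 \<theta>) \<theta> \<and>
           vnorm (K1 \<theta>) \<le> 2 * (8 * Mc) * \<bar>\<theta>\<bar> powr (rho q df q - 1) \<and>
           vnorm (K2 \<theta>) \<le> 2 * (8 * Mc) * \<bar>\<theta>\<bar> powr (rho q df q - 2))"
    using perv idio
  proof eventually_elim
    case (elim n)
    have n: "0 < n" using elim(1) by simp
    have large: "32 * \<kappa> \<le> s * real n"
    proof -
      have "32 * \<kappa> / s \<le> real n" using elim(2) by linarith
      then show ?thesis using s by (simp add: divide_le_eq mult.commute)
    qed
    have lo: "complex_of_real s \<cdot>\<^sub>m 1\<^sub>m q \<preceq>\<^sub>L Smat q g n t" and hi: "Smat q g n t \<preceq>\<^sub>L complex_of_real s_hi \<cdot>\<^sub>m 1\<^sub>m q"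
      if "t \<in> freqs" for t
      using elim(3) that by blast+
    obtain G1m G2m where G: "\<forall>t\<in>freqs. has_mat_deriv (Gmat q g n) (G1m t) t \<and> has_mat_deriv G1m (G2m t) t \<and>
         opnorm (G1m t) \<le> C1 * sqrt (real n) \<and> opnorm (G2m t) \<le> C2 * sqrt (real n)"
      using elim(3) unfolding twice_diff_bounded_def by blast
    obtain X1m X2m where X: "\<forall>t\<in>freqs. has_mat_deriv (Sig_xi n) (X1m t) t \<and> has_mat_deriv X1m (X2m t) t \<and>
         opnorm (X1m t) \<le> D1 \<and> opnorm (X2m t) \<le> D2"
      using elim(4) unfolding twice_diff_bounded_def by blast
    have c0_mono: "C * sqrt (real n) \<le> c0 * sqrt (real n)" if "C \<le> c0" for C
      using that by (intro mult_right_mono) auto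
    have G_norm: "norm (mat_op (Gmat q g n t)) \<le> c0 * sqrt (real n)" if "t \<in> freqs" for t
      using norm_Gmat_le[OF hi[OF that] n s_hi] c0_mono[OF c0(4)] by linarith
    have G1: "has_mat_deriv (Gmat q g n) (G1m t) t \<and> opnorm (G1m t) \<le> c0 * sqrt (real n)"
      and G2: "has_mat_deriv G1m (G2m t) t \<and> opnorm (G2m t) \<le> c0 * sqrt (real n)" if "t \<in> freqs" for t
      using bspec[OF G that] c0_mono[OF c0(1)] c0_mono[OF c0(2)] by auto
    have X1: "has_mat_deriv (Sig_xi n) (X1m t) t \<and> opnorm (X1m t) \<le> c0"
      and X2: "has_mat_deriv X1m (X2m t) t \<and> opnorm (X2m t) \<le> c0" if "t \<in> freqs" for t
      using bspec[OF X that] c0(5,6) by auto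
    have lip: "norm (mat_op (Gmat q g n t) - mat_op (Gmat q g n v)) \<le> c0 * sqrt (real n) * \<bar>t - v\<bar>"
      if "t \<in> freqs" "v \<in> freqs" for t v
    proof -
      have "norm (mat_op (Gmat q g n t) - mat_op (Gmat q g n v)) \<le> opnorm (Gmat q g n t - Gmat q g n v)"
        unfolding mat_op_diff[OF Gmat_carrier Gmat_carrier, symmetric] by (rule norm_mat_op_le_opnorm)
      also have "\<dots> \<le> sqrt (real n) * L * \<bar>t - v\<bar>" using elim(3) that by blast
      also have "\<dots> \<le> c0 * sqrt (real n) * \<bar>t - v\<bar>"
        using c0_mono[OF c0(3)] by (intro mult_right_mono) (auto simp: mult.commute)
      finally show ?thesis .
    qed
    have coercive: "sqrt (s * real n) * norm y \<le> norm (fapp (mat_op (Gmat q g n t)) y)"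
      if "t \<in> freqs" "\<And>i. i \<ge> q \<Longrightarrow> coord y i = 0" for t y
      by (rule Gmat_coercive[OF lo[OF that(1)] n]) (rule that(2))
    have X_norm: "norm (mat_op (Sig_xi n t)) \<le> \<kappa>" if t: "t \<in> freqs - {0}" for t
    proof (rule norm_hermitian_remainder_le[OF assms(8)[OF t] Gmat_carrier Xc dec[OF t] _ \<kappa>])
      fix e assume "eigenvalue (Sig_xi n t) e"
      then have "e \<in> complex_of_real ` {\<Lambda>_lo..\<Lambda>_hi}" using elim(4) t by blast
      then show "cmod e < \<kappa>" by (auto simp: \<kappa>_def)
    qed (use t in blast)
    from leading_projection_bounds[where Gm = "Gmat q g n" and Xm = "Sig_xi n" and Sig = "Sig n" and lam = "lam n"
        and p = "p n" and df = df and s = s and \<kappa> = \<kappa> and c = c,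
        OF q elim(1) Gmat_carrier Xc assms(8) dec df_\<delta> \<delta>(1) coercive s(1) G_norm G1 G2 lip X_norm X1 X2 large c_def]
    obtain P1 P2 where P: "\<And>t. t \<in> freqs - {0} \<Longrightarrow>
          ((\<lambda>t. leading_projection q n (p n t)) has_vector_derivative P1 t) (at t within (freqs - {0}))"
        "\<And>t. t \<in> freqs - {0} \<Longrightarrow> (P1 has_vector_derivative P2 t) (at t within (freqs - {0}))"
        "\<And>t. t \<in> freqs - {0} \<Longrightarrow> norm (P1 t) \<le> Mc * \<bar>t\<bar> powr \<delta> * (1 / \<bar>t\<bar>)"
        "\<And>t. t \<in> freqs - {0} \<Longrightarrow> norm (P2 t) \<le> Mc * \<bar>t\<bar> powr \<delta> * (1 / \<bar>t\<bar>)\<^sup>2"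
      and inc: "\<And>t v. t \<in> freqs - {0} \<Longrightarrow> v \<in> freqs - {0} \<Longrightarrow>
          norm (leading_projection q n (p n t) - leading_projection q n (p n v)) \<le> Bc * (\<bar>t\<bar> powr \<delta> + \<bar>v\<bar> powr \<delta> + \<bar>t - v\<bar>)"
      unfolding Mc_def Bc_def by blast
    have carrier: "Sig n t \<in> carrier_mat n n" if t: "t \<in> freqs - {0}" for t
      unfolding Sig[OF t] by (rule add_carrier_mat) (use Xc t in blast)
    have qn: "q \<le> n" using elim(1) by simp
    \<comment> \<open>The bounds for \<open>P\<close> have constants free of \<open>n\<close>; only their transfer to rows is left.\<close>
    note regular = eigproj_row_regularity[where Sig = "Sig n" and lam = "lam n" and p = p and ?P1.0 = P1 and ?P2.0 = P2,
        OF qn _ assms(8) carrier \<rho> \<delta>(2) MB P inc]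
    show ?case by (intro allI impI conjI) (rule regular(1)[THEN spec, THEN mp] regular(2,3), assumption+)+
  qed
  show ?thesis
  proof (intro conjI exI)
    show "\<forall>\<^sub>F n in sequentially. \<forall>i<n.
           (\<forall>k<n. ((\<lambda>\<theta>. eigproj_row q p n i \<theta> $ k) \<longlongrightarrow> eigproj_row q p n i 0 $ k) (at 0)) \<and>
           hoelder_on freqs (rho q df q) (2 * (8 * (Mc + 12 * Bc))) (eigproj_row q p n i)"
      using main by (rule eventually_mono) blast
    show "\<forall>\<^sub>F n in sequentially. \<forall>i<n. \<exists>K1 K2. \<forall>\<theta>\<in>freqs - {0}.
           has_vec_deriv (eigproj_row q p n i) (K1 \<theta>) \<theta> \<and> has_vec_deriv K1 (K2 \<theta>) \<theta> \<and>
           vnorm (K1 \<theta>) \<le> 2 * (8 * Mc) * \<bar>\<theta>\<bar> powr (rho q df q - 1) \<and>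
           vnorm (K2 \<theta>) \<le> 2 * (8 * Mc) * \<bar>\<theta>\<bar> powr (rho q df q - 2)"
      using main by (rule eventually_mono) blast
  qed
qed

end
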